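(* Let $R$ be a skew-invertible Hecke symmetry with generic parameter $q$ and of bi-rank $(m|0)$, and let $L(u)$ be the generating matrix of the corresponding braided Yangian $\mathbf Y(R)$. Then the following Cayley–Hamilton identity holds: $$\sum_{p=0}^m(-q)^p\,L^{m-p}(q^{-2p}u)\,e_p(u)=0.$$
   Context: Let $\mathbb K=\mathbb C$ or $\mathbb R$, $V$ a $\mathbb K$-vector space with $\dim V=N$ and basis $\{x_i\}$. A braiding is an operator $R:V^{\otimes 2}\to V^{\otimes 2}$ with $R_{12}R_{23}R_{12}=R_{23}R_{12}R_{23}$ on $V^{\otimes 3}$ (lower indices label the tensor factors on which an operator acts; $R_k:=R_{k\,k+1}$). It is a Hecke symmetry if $(qI-R)(q^{-1}I+R)=0$, $q\in\mathbb K$, $q^2\neq 1$; $q$ is generic, i.e. $q^n\ne 1$ for every nonzero integer $n$. Matrix of $R$: $R(x_i\otimes x_j)=R_{ij}^{kl}x_k\otimes x_l$ (summation over repeated indices; lower index = row, upper index = column). $R$ is skew-invertible if there is $\Psi:V^{\otimes 2}\to V^{\otimes 2}$ with $\mathrm{Tr}_2R_{12}\Psi_{23}=P_{13}$ ($P$ the flip), i.e. $R_{ij}^{kl}\Psi_{lp}^{jq}=\delta_i^q\delta_p^k$. Put $C=\mathrm{Tr}_2\Psi$, i.e. $C_i^j=\Psi_{ik}^{jk}$. The $R$-trace of an $N\times N$ matrix $M$ is $\mathrm{Tr}_RM=\mathrm{Tr}(CM)$, and $\mathrm{Tr}_{R(i_1\dots i_k)}X=\mathrm{Tr}_{i_1\dots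 i_k}(C_{i_1}\cdots C_{i_k}X)$. $k_q=(q^k-q^{-k})/(q-q^{-1})$. Skew-symmetrizers: $\mathcal P_-^{(1)}=I$, $\mathcal P_-^{(k)}=\frac1{k_q}\mathcal P_-^{(k-1)}\big(q^{k-1}I-(k-1)_qR_{k-1}\big)\mathcal P_-^{(k-1)}$, acting in positions $1,\dots,k$. Bi-rank: let $\bigwedge_R(V)=T(V)/\langle\mathrm{Im}(q^{-1}I+R)\rangle$ and $P_-(t)=\sum_k\dim\bigwedge_R^{(k)}(V)\,t^k$ (a rational function). Written in lowest terms, if its numerator has degree $m$ and its denominator degree $n$, the bi-rank of $R$ is $(m|n)$. Braided Yangian $\mathbf Y(R)$: let $R(u,v)=R-\frac{(q-q^{-1})u}{u-v}I$. $\mathbf Y(R)$ is the unital associative algebra generated by the entries of the coefficients $L[k]$, $k\ge1$, of $L(u)=\sum_{k\ge0}L[k]u^{-k}$, $L[0]=I$, $L[k]=\|l_i^j[k]\|_{1\le i,j\le N}$, subject to $R(u,v)L_1(u)RL_1(v)-L_1(v)RL_1(u)R(u,v)=0$. Put $L_{\overline1}(u)=L_1(u)$, $L_{\overline k}(u)=R_{k-1}L_{\overline{k-1}}(u)R_{k-1}^{-1}$ for $k\ge2$. Define $L^0(u)=I$, $L^k(u)=L(q^{-2(k-1)}u)L(q^{-2(k-2)}u)\cdots L(u)$ for $k\ge1$; $e_0(u)=1$ and $e_k(u)=\mathrm{Tr}_{R(1\dots k)}\big(\mathcal P_-^{(k)}L_{\overline1}(u)L_{\overline2}(q^{-2}u)\cdots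 L_{\overline k}(q^{-2(k-1)}u)\big)$ for $k\ge1$. *)

theory Defs
  imports
    "HOL-Analysis.Analysis"
    "HOL-Library.Poly_Mapping"
    "HOL-Computational_Algebra.Polynomial_FPS"
    "HOL-Computational_Algebra.Polynomial_Factorial"
    "HOL-Algebra.QuotRing"
    "HOL-Algebra.Embedded_Algebras"
    "HOL-Algebra.Algebraic_Closure_Type"
begin

section \<open>Operators on tensor powers\<close>

text \<open>
  The space \<open>V\<close> has basis \<open>x\<^sub>i\<close> indexed by a finite type \<open>'n\<close>, so \<open>N = CARD('n)\<close>. Lists of length
  \<open>k\<close> over \<open>'n\<close> index the basis of the \<open>k\<close>-th tensor power, and an operator there is a matrix
  \<open>A x y\<close> with row (lower) multi-index \<open>x\<close> and column (upper) multi-index \<open>y\<close>; only entries with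
  \<open>length x = length y = k\<close> are meaningful. Products are matrix products, row by column. Entries
  may lie in a noncommutative ring. An operator on the tensor square with scalar entries is a matrix
  over \<open>'n \<times> 'n\<close>, with \<open>R $ (i,j) $ (k,l)\<close> for the coefficient of \<open>x\<^sub>k \<otimes> x\<^sub>l\<close> in
  \<open>R (x\<^sub>i \<otimes> x\<^sub>j)\<close>. Positions of tensor factors are counted from 1.

  The definitions make sense over any field. The intended ground fields, the reals and the complex
  numbers, are up to isomorphism exactly the instances of class \<open>real_normed_field\<close>, by the
  Gelfand-Mazur theorem.
\<close>

type_synonym ('n, 'b) tens = "'n list \<Rightarrow> 'n list \<Rightarrow> 'b"
type_synonym ('n, 'b) op1 = "'b ^ 'n ^ 'n"
type_synonym ('n, 'b) op2 = "'b ^ ('n \<times> 'n) ^ ('n \<times> 'n)"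

definition tens_id :: "('n, 'b::zero_neq_one) tens" where
  "tens_id x y = (if x = y then 1 else 0)"

definition tens_mult :: "nat \<Rightarrow> ('n, 'b::semiring_1) tens \<Rightarrow> ('n, 'b) tens \<Rightarrow> ('n, 'b) tens" where
  "tens_mult k A B x y = (\<Sum>z | length z = k. A x z * B z y)"

definition tens_prod :: "nat \<Rightarrow> ('n, 'b::semiring_1) tens list \<Rightarrow> ('n, 'b) tens" where
  "tens_prod k As = foldr (tens_mult k) As tens_id"

definition tens_trace :: "nat \<Rightarrow> ('n, 'b::semiring_1) tens \<Rightarrow> 'b" where
  "tens_trace k A = (\<Sum>x | length x = k. A x x)"

definition tens_map :: "('b \<Rightarrow> 'c) \<Rightarrow> ('n, 'b) tens \<Rightarrow> ('n, 'c) tens" where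
  "tens_map f A x y = f (A x y)"

text \<open>\<open>at1 M a\<close> is \<open>M\<close> acting in factor \<open>a\<close>; \<open>at2 R a\<close> is \<open>R\<close> acting in factors \<open>a\<close>, \<open>a + 1\<close>.\<close>

definition at1 :: "('n::finite, 'b::zero) op1 \<Rightarrow> nat \<Rightarrow> ('n, 'b) tens" where
  "at1 M a x y =
     (if \<forall>p < length x. p \<noteq> a - 1 \<longrightarrow> x ! p = y ! p
      then M $ (x ! (a - 1)) $ (y ! (a - 1)) else 0)"

definition at2 :: "('n::finite, 'b::zero) op2 \<Rightarrow> nat \<Rightarrow> ('n, 'b) tens" where
  "at2 R a x y =
     (if \<forall>p < length x. p \<noteq> a - 1 \<and> p \<noteq> a \<longrightarrow> x ! p = y ! p
      then R $ (x ! (a - 1), x ! a) $ (y ! (a - 1), y ! a) else 0)"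


section \<open>Hecke symmetries\<close>

definition braiding :: "('n::finite, 'a::field) op2 \<Rightarrow> bool" where
  "braiding R \<longleftrightarrow>
     (\<forall>x y. length x = 3 \<longrightarrow> length y = 3 \<longrightarrow>
        tens_prod 3 [at2 R 1, at2 R 2, at2 R 1] x y = tens_prod 3 [at2 R 2, at2 R 1, at2 R 2] x y)"

definition hecke_symmetry :: "'a::field \<Rightarrow> ('n::finite, 'a) op2 \<Rightarrow> bool" where
  "hecke_symmetry q R \<longleftrightarrow>
     q \<noteq> 0 \<and> q\<^sup>2 \<noteq> 1 \<and> braiding R \<and> (mat q - R) ** (mat (inverse q) + R) = 0"

definition generic :: "'a::field \<Rightarrow> bool" where
  "generic q \<longleftrightarrow> (\<forall>n::int. n \<noteq> 0 \<longrightarrow> q powi n \<noteq> 1)"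

definition skew_inverse :: "('n::finite, 'a::field) op2 \<Rightarrow> ('n, 'a) op2 \<Rightarrow> bool" where
  "skew_inverse R \<Psi> \<longleftrightarrow>
     (\<forall>i p k r. (\<Sum>j\<in>UNIV. \<Sum>l\<in>UNIV. R $ (i, j) $ (k, l) * \<Psi> $ (l, p) $ (j, r)) =
        (if i = r \<and> p = k then 1 else 0))"

definition skew_invertible :: "('n::finite, 'a::field) op2 \<Rightarrow> bool" where
  "skew_invertible R \<longleftrightarrow> (\<exists>\<Psi>. skew_inverse R \<Psi>)"

text \<open>
  The choice below is harmless: \<open>\<Psi>\<close> is, after regrouping indices, the two-sided inverse of a
  square matrix, hence unique.
\<close>

definition skew_inv :: "('n::finite, 'a::field) op2 \<Rightarrow> ('n, 'a) op2" where
  "skew_inv R = (SOME \<Psi>. skew_inverse R \<Psi>)"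

definition C_op :: "('n::finite, 'a::field) op2 \<Rightarrow> ('n, 'a) op1" where
  "C_op R = (\<chi> i j. \<Sum>k\<in>UNIV. skew_inv R $ (i, k) $ (j, k))"

definition qnum :: "'a::field \<Rightarrow> nat \<Rightarrow> 'a" where
  "qnum q k = (q ^ k - inverse q ^ k) / (q - inverse q)"

text \<open>\<open>skew_symmetrizer q R n k\<close> is the \<open>k\<close>-th skew-symmetrizer acting in factors \<open>1,\<dots>,k\<close> of the
  \<open>n\<close>-th tensor power, for \<open>1 \<le> k \<le> n\<close>.\<close>

fun skew_symmetrizer :: "'a::field \<Rightarrow> ('n::finite, 'a) op2 \<Rightarrow> nat \<Rightarrow> nat \<Rightarrow> ('n, 'a) tens" where
  "skew_symmetrizer q R n 0 = tens_id"
| "skew_symmetrizer q R n (Suc 0) = tens_id"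
| "skew_symmetrizer q R n (Suc (Suc k)) =
     (\<lambda>x y. inverse (qnum q (k + 2)) *
        tens_prod n
          [skew_symmetrizer q R n (Suc k),
           \<lambda>x y. q ^ (k + 1) * tens_id x y - qnum q (k + 1) * at2 R (k + 1) x y,
           skew_symmetrizer q R n (Suc k)] x y)"


section \<open>Free algebras and algebras given by generators and relations\<close>

text \<open>
  The free associative unital algebra on a set of generators is the monoid algebra of the free
  monoid of words, that is, of lists under concatenation.
\<close>

instantiation list :: (type) monoid_add
begin
definition zero_list :: "'a list" where "zero_list = []"
definition plus_list :: "'a list \<Rightarrow> 'a list \<Rightarrow> 'a list" where "plus_list xs ys = xs @ ys"
instance by standard (simp_all add: zero_list_def plus_list_def)
end

type_synonym ('x, 'a) free_alg = "'x list \<Rightarrow>\<^sub>0 'a"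

definition scal :: "'a \<Rightarrow> ('x, 'a::ring_1) free_alg" where
  "scal c = Poly_Mapping.single [] c"

definition gen :: "'x \<Rightarrow> ('x, 'a::ring_1) free_alg" where
  "gen x = Poly_Mapping.single [x] 1"

text \<open>
  Ideals in \<^theory>\<open>HOL-Algebra.Ideal\<close> are two-sided. They are automatically linear subspaces here,
  because the scalars belong to the free algebra.
\<close>

definition rel_ideal :: "('x, 'a::ring_1) free_alg set \<Rightarrow> ('x, 'a) free_alg set" where
  "rel_ideal S = genideal ring_of_type_algebra S"

definition presented :: "('x, 'a::ring_1) free_alg set \<Rightarrow> ('x, 'a) free_alg set ring" where
  "presented S = FactRing ring_of_type_algebra (rel_ideal S)"

definition presented_class ::
    "('x, 'a::ring_1) free_alg set \<Rightarrow> ('x, 'a) free_alg \<Rightarrow> ('x, 'a) free_alg set" where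
  "presented_class S f = rel_ideal S +>\<^bsub>ring_of_type_algebra\<^esub> f"


section \<open>The skew-symmetric algebra and the bi-rank\<close>

text \<open>The tensor algebra of \<open>V\<close> is the free algebra on \<open>'n\<close>; the relations form the image of
  \<open>q\<^sup>-\<^sup>1 I + R\<close>, where \<open>R\<close> sends the vector with coordinates \<open>v\<close> to the one with coordinates
  \<open>v v* R\<close>.\<close>

definition ext_rels :: "'a::field \<Rightarrow> ('n::finite, 'a) op2 \<Rightarrow> ('n, 'a) free_alg set" where
  "ext_rels q R =
     range (\<lambda>v :: 'a ^ ('n \<times> 'n).
       \<Sum>k\<in>UNIV. \<Sum>l\<in>UNIV. scal ((v v* (mat (inverse q) + R)) $ (k, l)) * (gen k * gen l))"

definition homogeneous :: "nat \<Rightarrow> ('x, 'a::ring_1) free_alg set" where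
  "homogeneous k = {f. \<forall>w \<in> Poly_Mapping.keys f. length w = k}"

definition ext_dim :: "'a::field \<Rightarrow> ('n::finite, 'a) op2 \<Rightarrow> nat \<Rightarrow> nat" where
  "ext_dim q R k =
     ring.dim (presented (ext_rels q R))
       (presented_class (ext_rels q R) ` range scal)
       (presented_class (ext_rels q R) ` homogeneous k)"

definition poincare_minus :: "'a::field \<Rightarrow> ('n::finite, 'a) op2 \<Rightarrow> rat fps" where
  "poincare_minus q R = Abs_fps (\<lambda>k. of_nat (ext_dim q R k))"

definition bi_rank :: "'a::field \<Rightarrow> ('n::finite, 'a) op2 \<Rightarrow> nat \<Rightarrow> nat \<Rightarrow> bool" where
  "bi_rank q R m n \<longleftrightarrow>
     (\<exists>num den :: rat poly. den \<noteq> 0 \<and> coprime num den \<and>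
        poincare_minus q R * fps_of_poly den = fps_of_poly num \<and>
        Polynomial.degree num = m \<and> Polynomial.degree den = n)"


section \<open>The braided Yangian\<close>

text \<open>
  The generator \<open>(i, j, k)\<close> stands for the entry of \<open>L[k + 1]\<close> in row \<open>i\<close> and column \<open>j\<close>, so
  that exactly the coefficients with positive index are generators. Series in \<open>u\<^sup>-\<^sup>1\<close> are formal
  power series, \<open>fps_X\<close> being \<open>u\<^sup>-\<^sup>1\<close>.
\<close>

type_synonym ('n, 'a) yfree = "('n \<times> 'n \<times> nat, 'a) free_alg"

fun L_coeff :: "nat \<Rightarrow> ('n::finite, ('n, 'a::ring_1) yfree) op1" where
  "L_coeff 0 = mat 1"
| "L_coeff (Suc k) = (\<chi> i j. gen (i, j, k))"

text \<open>\<open>L_at c\<close> is \<open>L(c u)\<close>.\<close>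

definition L_at :: "'a::field \<Rightarrow> ('n::finite, ('n, 'a) yfree fps) op1" where
  "L_at c = (\<chi> i j. Abs_fps (\<lambda>k. scal (inverse c ^ k) * L_coeff k $ i $ j))"

text \<open>
  For the defining relations we use series in two variables: the outer \<open>fps_X\<close> is \<open>v\<^sup>-\<^sup>1\<close> and
  \<open>fps_const fps_X\<close> is \<open>u\<^sup>-\<^sup>1\<close>. As \<open>u/(u - v) = v\<^sup>-\<^sup>1/(v\<^sup>-\<^sup>1 - u\<^sup>-\<^sup>1)\<close>, the denominator is cleared by
  multiplying \<open>R(u,v)\<close>, and hence the whole relation, by \<open>v\<^sup>-\<^sup>1 - u\<^sup>-\<^sup>1\<close>.
\<close>

definition scal_uv :: "'a \<Rightarrow> ('x, 'a::ring_1) free_alg fps fps" where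
  "scal_uv c = fps_const (fps_const (scal c))"

definition L_u :: "('n::finite, ('n, 'a::field) yfree fps fps) op1" where
  "L_u = (\<chi> i j. fps_const (Abs_fps (\<lambda>k. L_coeff k $ i $ j)))"

definition L_v :: "('n::finite, ('n, 'a::field) yfree fps fps) op1" where
  "L_v = (\<chi> i j. Abs_fps (\<lambda>k. fps_const (L_coeff k $ i $ j)))"

definition R_uv :: "'a::field \<Rightarrow> ('n::finite, 'a) op2 \<Rightarrow> ('n, ('n, 'a) yfree fps fps) tens" where
  "R_uv q R x y =
     (fps_X - fps_const fps_X) * scal_uv (at2 R 1 x y)
     - scal_uv (q - inverse q) * fps_X * tens_id x y"

definition yangian_defect ::
    "'a::field \<Rightarrow> ('n::finite, 'a) op2 \<Rightarrow> ('n, ('n, 'a) yfree fps fps) tens" where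
  "yangian_defect q R x y =
     tens_prod 2 [R_uv q R, at1 L_u 1, tens_map scal_uv (at2 R 1), at1 L_v 1] x y
     - tens_prod 2 [at1 L_v 1, tens_map scal_uv (at2 R 1), at1 L_u 1, R_uv q R] x y"

definition yangian_rels :: "'a::field \<Rightarrow> ('n::finite, 'a) op2 \<Rightarrow> ('n, 'a) yfree set" where
  "yangian_rels q R =
     {fps_nth (fps_nth (yangian_defect q R x y) b) a | x y a b. length x = 2 \<and> length y = 2}"

definition braided_yangian :: "'a::field \<Rightarrow> ('n::finite, 'a) op2 \<Rightarrow> ('n, 'a) yfree set ring" where
  "braided_yangian q R = presented (yangian_rels q R)"

definition yangian_class ::
    "'a::field \<Rightarrow> ('n::finite, 'a) op2 \<Rightarrow> ('n, 'a) yfree \<Rightarrow> ('n, 'a) yfree set" where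
  "yangian_class q R = presented_class (yangian_rels q R)"


section \<open>Powers and elementary symmetric elements\<close>

text \<open>
  Both are noncommutative polynomial expressions in the generators with scalar coefficients. They
  are written in the free algebra and denote elements of the Yangian through \<open>yangian_class\<close>. The
  argument \<open>c\<close> means that the series is taken at \<open>c u\<close>.
\<close>

definition scal_ser :: "'a \<Rightarrow> ('x, 'a::ring_1) free_alg fps" where
  "scal_ser c = fps_const (scal c)"

fun L_pow :: "'a::field \<Rightarrow> nat \<Rightarrow> 'a \<Rightarrow> ('n::finite, ('n, 'a) yfree fps) op1" where
  "L_pow q 0 c = mat 1"
| "L_pow q (Suc k) c = L_at (inverse q ^ (2 * k) * c) ** L_pow q k c"

text \<open>\<open>L_bar R n k c\<close> is \<open>L\<close> with overlined index \<open>k\<close> at \<open>c u\<close>, acting on the \<open>n\<close>-th tensor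
  power, for \<open>1 \<le> k \<le> n\<close>.\<close>

fun L_bar :: "('n::finite, 'a::field) op2 \<Rightarrow> nat \<Rightarrow> nat \<Rightarrow> 'a \<Rightarrow> ('n, ('n, 'a) yfree fps) tens" where
  "L_bar R n 0 c = tens_id"
| "L_bar R n (Suc 0) c = at1 (L_at c) 1"
| "L_bar R n (Suc (Suc k)) c =
     tens_prod n
       [tens_map scal_ser (at2 R (Suc k)),
        L_bar R n (Suc k) c,
        tens_map scal_ser (at2 (matrix_inv R) (Suc k))]"

definition R_trace ::
    "('n::finite, 'a::field) op2 \<Rightarrow> nat \<Rightarrow> ('n, ('x, 'a) free_alg fps) tens
       \<Rightarrow> ('x, 'a) free_alg fps" where
  "R_trace R k A =
     tens_trace k (tens_prod k
       (map (\<lambda>i. tens_map scal_ser (at1 (C_op R) i)) [1..<Suc k] @ [A]))"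

definition e_sym :: "'a::field \<Rightarrow> ('n::finite, 'a) op2 \<Rightarrow> nat \<Rightarrow> 'a \<Rightarrow> ('n, 'a) yfree fps" where
  "e_sym q R k c =
     (if k = 0 then 1
      else R_trace R k (tens_prod k
        (tens_map scal_ser (skew_symmetrizer q R k k)
         # map (\<lambda>i. L_bar R k i (inverse q ^ (2 * (i - 1)) * c)) [1..<Suc k])))"

end

theory Submission
  imports Defs
begin

no_notation var (\<open>X\<index>\<close>)
no_notation fps_nth (infixl \<open>$\<close> 75)

text \<open>
  Write \<open>[k]\<close> for the \<open>q\<close>-number, \<open>P\<^sub>k\<close> for the skew-symmetrizer in the factors \<open>1,\<dots>,k\<close>,
  \<open>E\<^sub>k\<close> for the product of the overlined \<open>L\<close> with indices \<open>1,\<dots>,k\<close> at the arguments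
  \<open>q\<^sup>-\<^sup>2\<^sup>(\<^sup>k\<^sup>-\<^sup>1\<^sup>)u, \<dots>, q\<^sup>-\<^sup>2u, u\<close>, and \<open>E'\<^sub>k\<close> for the product with the same arguments in the
  opposite order.

  At arguments of ratio \<open>q\<^sup>2\<close> the matrix \<open>R(u,v)\<close> degenerates to a multiple of \<open>P\<^sub>2\<close>, and at the
  other ratios \<open>q\<^sup>2\<^sup>j\<close> that occur it acts on the image of \<open>P\<^sub>k\<close> by a nonzero scalar. The defining
  relations therefore allow the arguments to be reversed next to a skew-symmetrizer:
  \<open>P\<^sub>k E'\<^sub>k = E\<^sub>k P\<^sub>k = P\<^sub>k E\<^sub>k P\<^sub>k\<close> (\<open>asym_asc_desc\<close>, \<open>asym_desc_absorb\<close>). In particular \<open>e\<^sub>k(u)\<close>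
  is the \<open>R\<close>-trace of \<open>E\<^sub>k P\<^sub>k\<close>.

  Let \<open>D\<^sub>k = [k] Tr\<^sub>R\<^sub>(\<^sub>2\<^sub>\<dots>\<^sub>k\<^sub>) (E\<^sub>k P\<^sub>k)\<close>, a matrix acting in the first factor. In \<open>D\<^sub>k\<^sub>+\<^sub>1\<close> split off the first
  generator, \<open>[k+1] P\<^sub>k\<^sub>+\<^sub>1 = P (q\<^sup>k - [k] R\<^sub>1) P\<close> with \<open>P\<close> the skew-symmetrizer in the factors
  \<open>2,\<dots>,k+1\<close> (\<open>asym_first\<close>), and absorb both idempotents by the cyclicity of the trace. The first
  summand gives \<open>e\<^sub>k(u)\<close>, because the \<open>R\<close>-trace does not change when an operator is moved to the right
  by conjugation with \<open>R\<^sub>1\<dots>R\<^sub>k\<close>; the second gives \<open>D\<^sub>k\<close>, because \<open>Tr\<^sub>R\<^sub>(\<^sub>2\<^sub>) R\<^sub>1\<^sub>2 = I\<close>. Hence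
  \<open>D\<^sub>k\<^sub>+\<^sub>1 = L(q\<^sup>-\<^sup>2\<^sup>ku) (q\<^sup>k e\<^sub>k(u) - D\<^sub>k)\<close> (\<open>skew_power_Suc\<close>), and by iteration \<open>D\<^sub>m\<close> is, up to sign, the
  sum in the theorem without its last summand. If \<open>P\<^sub>m\<^sub>+\<^sub>1 = 0\<close>, the same expansion with \<open>R\<^sub>1\<^sup>-\<^sup>1\<close> in
  place of \<open>R\<^sub>1\<close> gives \<open>q\<^sup>-\<^sup>m e\<^sub>m(u) = t D\<^sub>m\<close> with the scalar \<open>t = 1 - (q - q\<^sup>-\<^sup>1) Tr C\<close>. Tracing
  \<open>P\<^sub>m\<^sub>+\<^sub>1 = 0\<close> over its last factor yields \<open>t = q\<^sup>-\<^sup>2\<^sup>m\<close> unless \<open>P\<^sub>m = 0\<close>, when both sides vanish. So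
  \<open>D\<^sub>m = q\<^sup>m e\<^sub>m(u)\<close>, which is the identity (\<open>cayley_hamilton\<close>).

  That \<open>P\<^sub>m\<^sub>+\<^sub>1 = 0\<close> follows from the bi-rank: the Poincare series is a polynomial of degree \<open>m\<close>, so
  every word of length \<open>m + 1\<close> lies in the ideal of relations of the skew-symmetric algebra, and
  pairing with \<open>P\<^sub>m\<^sub>+\<^sub>1\<close> annihilates this ideal (\<open>skew_symmetrizer_zero\<close>).

  All operators are realised as row-finite matrices over the configurations of an infinite chain of
  sites, so that tensor powers of all orders share one ring; the relations of the Yangian enter as
  congruences modulo the ideal they generate.
\<close>

section \<open>Skew-symmetrizers in an abstract algebra\<close>

text \<open>
  Scalar multiplication is an explicit operation: the ground field will act through constant series
  with coefficients in the free algebra.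
\<close>

locale scalar_algebra =
  fixes sc :: "'a::field \<Rightarrow> 'r::ring_1 \<Rightarrow> 'r"
  assumes sc_add_left: "sc (a + b) x = sc a x + sc b x"
    and sc_add: "sc a (x + y) = sc a x + sc a y"
    and sc_sc [simp]: "sc a (sc b x) = sc (a * b) x"
    and sc_one [simp]: "sc 1 x = x"
    and sc_mult_left [simp]: "sc a x * y = sc a (x * y)"
    and sc_mult_right [simp]: "x * sc a y = sc a (x * y)"
begin

lemma sc_zero [simp]: "sc a 0 = 0" using sc_add[of a 0 0] by simp
lemma sc_zero_left [simp]: "sc 0 x = 0" using sc_add_left[of 0 0 x] by simp
lemma sc_minus [simp]: "sc a (- x) = - sc a x"
  using sc_add[of a x "- x"] by (simp add: eq_neg_iff_add_eq_0 add.commute)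
lemma sc_minus_left [simp]: "sc (- a) x = - sc a x"
  using sc_add_left[of a "- a" x] by (simp add: eq_neg_iff_add_eq_0 add.commute)
lemma sc_diff: "sc a (x - y) = sc a x - sc a y"
  using sc_add[of a x "- y"] by (simp add: sc_minus)
lemma sc_diff_left: "sc (a - b) x = sc a x - sc b x"
  using sc_add_left[of a "- b" x] by (simp add: sc_minus_left)
lemma sc_sum: "sc a (sum f A) = (\<Sum>i\<in>A. sc a (f i))"
  by (induction A rule: infinite_finite_induct) (simp_all add: sc_add)
lemma sc_cancel: "a \<noteq> 0 \<Longrightarrow> sc a x = sc a y \<longleftrightarrow> x = y"
  by (metis left_inverse sc_one sc_sc)
lemma sc_eq_0: "a \<noteq> 0 \<Longrightarrow> sc a x = 0 \<longleftrightarrow> x = 0"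
  by (metis sc_cancel sc_zero)

lemmas sc_distrib = sc_add sc_diff sc_minus distrib_left distrib_right left_diff_distrib
  right_diff_distrib
lemmas sc_collect = sc_add_left sc_diff_left sc_minus_left

end

locale two_sided_ideal = scalar_algebra sc for sc :: "'a::field \<Rightarrow> 'r::ring_1 \<Rightarrow> 'r" +
  fixes J :: "'r set"
  assumes zero_J [simp]: "0 \<in> J"
    and add_J: "x \<in> J \<Longrightarrow> y \<in> J \<Longrightarrow> x + y \<in> J"
    and lmult_J: "x \<in> J \<Longrightarrow> a * x \<in> J"
    and rmult_J: "x \<in> J \<Longrightarrow> x * a \<in> J"
begin

definition cong_J :: "'r \<Rightarrow> 'r \<Rightarrow> bool"  (infix \<open>\<asymp>\<close> 50) where "x \<asymp> y \<longleftrightarrow> x - y \<in> J"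

lemma minus_J: "x \<in> J \<Longrightarrow> - x \<in> J" using lmult_J[of x "- 1"] by simp
lemma sc_J: "x \<in> J \<Longrightarrow> sc a x \<in> J" using lmult_J[of x "sc a 1"] by simp
lemma diff_J: "x \<in> J \<Longrightarrow> y \<in> J \<Longrightarrow> x - y \<in> J" using add_J[OF _ minus_J] by fastforce

lemma cong_refl [simp]: "x \<asymp> x" by (simp add: cong_J_def)
lemma cong_sym: "x \<asymp> y \<Longrightarrow> y \<asymp> x" using minus_J by (force simp: cong_J_def)
lemma cong_trans [trans]: "x \<asymp> y \<Longrightarrow> y \<asymp> z \<Longrightarrow> x \<asymp> z"
  using add_J by (force simp: cong_J_def)
lemma cong_eq_trans [trans]: "x \<asymp> y \<Longrightarrow> y = z \<Longrightarrow> x \<asymp> z" by simp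
lemma eq_cong_trans [trans]: "x = y \<Longrightarrow> y \<asymp> z \<Longrightarrow> x \<asymp> z" by simp
lemma cong_diff: "x \<asymp> y \<Longrightarrow> z \<asymp> w \<Longrightarrow> x - z \<asymp> y - w"
  unfolding cong_J_def using diff_J[of "x - y" "z - w"] by (simp add: algebra_simps)
lemma cong_sc: "x \<asymp> y \<Longrightarrow> sc a x \<asymp> sc a y"
  unfolding cong_J_def using sc_J[of "x - y" a] by (simp add: sc_diff)
lemma cong_lmult: "x \<asymp> y \<Longrightarrow> a * x \<asymp> a * y"
  unfolding cong_J_def using lmult_J[of "x - y" a] by (simp add: right_diff_distrib)
lemma cong_rmult: "x \<asymp> y \<Longrightarrow> x * a \<asymp> y * a"
  unfolding cong_J_def using rmult_J[of "x - y" a] by (simp add: left_diff_distrib)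
lemma cong_sc_cancel: "a \<noteq> 0 \<Longrightarrow> sc a x \<asymp> sc a y \<Longrightarrow> x \<asymp> y"
  using cong_sc[of "sc a x" "sc a y" "inverse a"] by simp
lemma cong_0: "x \<asymp> 0 \<longleftrightarrow> x \<in> J" by (simp add: cong_J_def)

end

locale q_algebra = scalar_algebra sc for sc :: "'a::field \<Rightarrow> 'r::ring_1 \<Rightarrow> 'r" +
  fixes q :: 'a
  assumes q_nonzero: "q \<noteq> 0" and qdiff_nonzero: "q - inverse q \<noteq> 0"
    and qnum_nonzero: "0 < k \<Longrightarrow> qnum q k \<noteq> 0"
begin

text \<open>The Hecke relation reads \<open>R\<^sup>2 = 1 + (q - q\<^sup>-\<^sup>1) R\<close>.\<close>

definition qd :: 'a where "qd = q - inverse q"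

lemma qnum_0 [simp]: "qnum q 0 = 0" by (simp add: qnum_def)
lemma qnum_1 [simp]: "qnum q (Suc 0) = 1" using qdiff_nonzero by (simp add: qnum_def)

lemma qnum_Suc: "qnum q (Suc k) = q ^ k + qnum q k * inverse q"
  using qdiff_nonzero q_nonzero by (simp add: qnum_def field_simps)

lemma qnum_Suc': "qnum q (Suc k) = inverse q ^ k + qnum q k * q"
  using qdiff_nonzero q_nonzero by (simp add: qnum_def field_simps)

definition hecke_seq :: "nat \<Rightarrow> (nat \<Rightarrow> 'r) \<Rightarrow> bool" where
  "hecke_seq n S \<longleftrightarrow>
     (\<forall>i<n. S i * S i = 1 + sc qd (S i)) \<and>
     (\<forall>i. Suc i < n \<longrightarrow> S i * S (Suc i) * S i = S (Suc i) * S i * S (Suc i)) \<and>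
     (\<forall>i j. Suc i < j \<and> j < n \<longrightarrow> S i * S j = S j * S i)"

lemma hecke_seq_quad: "hecke_seq n S \<Longrightarrow> i < n \<Longrightarrow> S i * S i = 1 + sc qd (S i)"
  by (simp add: hecke_seq_def)
lemma hecke_seq_braid:
  "hecke_seq n S \<Longrightarrow> Suc i < n \<Longrightarrow> S i * S (Suc i) * S i = S (Suc i) * S i * S (Suc i)"
  by (simp add: hecke_seq_def)
lemma hecke_seq_comm: "hecke_seq n S \<Longrightarrow> Suc i < j \<Longrightarrow> j < n \<Longrightarrow> S i * S j = S j * S i"
  unfolding hecke_seq_def by blast

lemma quad_eigen_left:
  assumes "T * T = 1 + sc qd T"
  shows "T * (sc (q * b) Y - sc b (T * Y)) = sc (- inverse q) (sc (q * b) Y - sc b (T * Y))"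
proof -
  have "T * (T * Y) = Y + sc qd (T * Y)"
    using assms by (simp add: mult.assoc[symmetric] distrib_right)
  then have "T * (sc (q * b) Y - sc b (T * Y)) = sc (q * b - b * qd) (T * Y) - sc b Y"
    by (simp add: right_diff_distrib sc_add sc_diff_left)
  also have "q * b - b * qd = inverse q * b" by (simp add: qd_def algebra_simps)
  finally show ?thesis using q_nonzero by (simp add: sc_diff mult.assoc[symmetric])
qed

lemma quad_eigen_right:
  assumes "T * T = 1 + sc qd T"
  shows "(sc (q * b) Y - sc b (Y * T)) * T = sc (- inverse q) (sc (q * b) Y - sc b (Y * T))"
proof -
  have "Y * T * T = Y + sc qd (Y * T)"
    using assms by (simp add: mult.assoc distrib_left)
  then have "(sc (q * b) Y - sc b (Y * T)) * T = sc (q * b - b * qd) (Y * T) - sc b Y"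
    by (simp add: left_diff_distrib sc_add sc_diff_left)
  also have "q * b - b * qd = inverse q * b" by (simp add: qd_def algebra_simps)
  finally show ?thesis using q_nonzero by (simp add: sc_diff mult.assoc[symmetric])
qed

text \<open>
  The skew-symmetrizer of an arbitrary sequence of generators: besides \<open>R\<^sub>1, R\<^sub>2, \<dots>\<close> also its shifts
  and reversals are used.
\<close>

fun asym :: "(nat \<Rightarrow> 'r) \<Rightarrow> nat \<Rightarrow> 'r" where
  "asym S 0 = 1"
| "asym S (Suc 0) = 1"
| "asym S (Suc (Suc k)) = sc (inverse (qnum q (k + 2)))
     (asym S (Suc k) * (sc (q ^ (k + 1)) 1 - sc (qnum q (k + 1)) (S k)) * asym S (Suc k))"

lemma asym_commute: "(\<And>i. Suc i < k \<Longrightarrow> X * S i = S i * X) \<Longrightarrow> X * asym S k = asym S k * X"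
proof (induction S k rule: asym.induct)
  case (3 S k)
  let ?A = "asym S (Suc k)" and ?m = "sc (q ^ (k + 1)) 1 - sc (qnum q (k + 1)) (S k)"
  have A: "X * ?A = ?A * X" using 3 by simp
  have B: "X * ?m = ?m * X"
    using "3.prems"[of k] by (simp add: sc_distrib)
  have "X * (?A * ?m * ?A) = (X * ?A) * ?m * ?A" by (simp only: mult.assoc)
  also have "\<dots> = ?A * (X * ?m) * ?A" by (simp only: A mult.assoc)
  also have "\<dots> = ?A * ?m * (X * ?A)" by (simp only: B mult.assoc)
  also have "\<dots> = (?A * ?m * ?A) * X" by (simp only: A mult.assoc)
  finally have "X * (?A * ?m * ?A) = (?A * ?m * ?A) * X" .
  then show ?case by simp
qed auto

end

locale q_algebra_ideal = q_algebra sc q + two_sided_ideal sc J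
  for sc :: "'a::field \<Rightarrow> 'r::ring_1 \<Rightarrow> 'r" and q J
begin

text \<open>
  The skew-symmetrizer is a polynomial in the generators which takes the value 1 when all of them are
  replaced by \<open>- q\<^sup>-\<^sup>1\<close>, since \<open>[k+1] = q\<^sup>k + q\<^sup>-\<^sup>1 [k]\<close>.
\<close>

lemma cong_asym_right:
  "(\<And>i. Suc i < k \<Longrightarrow> X * S i \<asymp> sc (- inverse q) X) \<Longrightarrow> X * asym S k \<asymp> X"
proof (induction S k rule: asym.induct)
  case (3 S k)
  let ?A = "asym S (Suc k)" and ?m = "sc (q ^ (k + 1)) 1 - sc (qnum q (k + 1)) (S k)"
  have A: "X * ?A \<asymp> X" using 3 by simp
  have "X * ?m = sc (q ^ (k + 1)) X - sc (qnum q (k + 1)) (X * S k)" by (simp add: sc_distrib)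
  also have "\<dots> \<asymp> sc (q ^ (k + 1)) X - sc (qnum q (k + 1)) (sc (- inverse q) X)"
    by (intro cong_diff cong_sc "3.prems") auto
  also have "\<dots> = sc (qnum q (k + 2)) X" using qnum_Suc[of "Suc k"] by (simp add: sc_collect)
  finally have m: "X * ?m \<asymp> sc (qnum q (k + 2)) X" .
  have "X * (?A * ?m * ?A) \<asymp> X * (?m * ?A)"
    using cong_rmult[OF A] by (simp add: mult.assoc)
  also have "\<dots> \<asymp> sc (qnum q (k + 2)) X * ?A"
    using cong_rmult[OF m] by (simp add: mult.assoc)
  also have "\<dots> \<asymp> sc (qnum q (k + 2)) X" using cong_sc[OF A] by simp
  finally have "sc (inverse (qnum q (k + 2))) (X * (?A * ?m * ?A)) \<asymp>
      sc (inverse (qnum q (k + 2))) (sc (qnum q (k + 2)) X)" by (rule cong_sc)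
  then show ?case using qnum_nonzero[of "k + 2"] by simp
qed auto

lemma cong_asym_left:
  "(\<And>i. Suc i < k \<Longrightarrow> S i * X \<asymp> sc (- inverse q) X) \<Longrightarrow> asym S k * X \<asymp> X"
proof (induction S k rule: asym.induct)
  case (3 S k)
  let ?A = "asym S (Suc k)" and ?m = "sc (q ^ (k + 1)) 1 - sc (qnum q (k + 1)) (S k)"
  have A: "?A * X \<asymp> X" using 3 by simp
  have "?m * X = sc (q ^ (k + 1)) X - sc (qnum q (k + 1)) (S k * X)" by (simp add: sc_distrib)
  also have "\<dots> \<asymp> sc (q ^ (k + 1)) X - sc (qnum q (k + 1)) (sc (- inverse q) X)"
    by (intro cong_diff cong_sc "3.prems") auto
  also have "\<dots> = sc (qnum q (k + 2)) X" using qnum_Suc[of "Suc k"] by (simp add: sc_collect)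
  finally have m: "?m * X \<asymp> sc (qnum q (k + 2)) X" .
  have "(?A * ?m * ?A) * X \<asymp> ?A * (?m * X)"
    using cong_lmult[OF A, of "?A * ?m"] by (simp add: mult.assoc)
  also have "\<dots> \<asymp> ?A * sc (qnum q (k + 2)) X"
    using cong_lmult[OF m] by (simp add: mult.assoc)
  also have "\<dots> \<asymp> sc (qnum q (k + 2)) X" using cong_sc[OF A] by simp
  finally have "sc (inverse (qnum q (k + 2))) ((?A * ?m * ?A) * X) \<asymp>
      sc (inverse (qnum q (k + 2))) (sc (qnum q (k + 2)) X)" by (rule cong_sc)
  then show ?case using qnum_nonzero[of "k + 2"] by simp
qed auto

end

context q_algebra
begin

sublocale zero: q_algebra_ideal sc q "{0}"
  by unfold_locales auto

lemma asym_right: "(\<And>i. Suc i < k \<Longrightarrow> X * S i = sc (- inverse q) X) \<Longrightarrow> X * asym S k = X"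
  using zero.cong_asym_right[of k X S] by (simp add: zero.cong_J_def)

lemma asym_left: "(\<And>i. Suc i < k \<Longrightarrow> S i * X = sc (- inverse q) X) \<Longrightarrow> asym S k * X = X"
  using zero.cong_asym_left[of k S X] by (simp add: zero.cong_J_def)

lemma hecke_seq_mono: "hecke_seq n S \<Longrightarrow> m \<le> n \<Longrightarrow> hecke_seq m S"
  unfolding hecke_seq_def by (meson less_le_trans)

text \<open>
  The step from \<open>k\<close> to \<open>k + 1\<close> factors, with \<open>P = P\<^sub>k\<close>, \<open>P' = P\<^sub>k\<^sub>-\<^sub>1\<close>, \<open>T = R\<^sub>k\<close> and \<open>U = R\<^sub>k\<^sub>-\<^sub>1\<close>.
  Expanding one of the outer factors \<open>P\<close> leaves a part in the span of \<open>P\<close> and \<open>T P\<close>, on which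
  \<open>T\<close> acts by \<open>- q\<^sup>-\<^sup>1\<close> because of the quadratic relation, and the term \<open>P' U T P\<close>, where
  \<open>T U T P = U T U P = - q\<^sup>-\<^sup>1 U T P\<close>.
\<close>

lemma eigen_step:
  assumes PP: "P * P = P" "P' * P = P" "P * P' = P"
    and comm: "T * P' = P' * T" and braid: "T * U * T = U * T * U"
    and UP: "U * P = sc (- inverse q) P" "P * U = sc (- inverse q) P"
    and quad: "T * T = 1 + sc qd T"
    and P: "sc c' P = P' * (sc b 1 - sc c U) * P'"
  shows "T * (P * (sc (q * b) 1 - sc c' T) * P) = sc (- inverse q) (P * (sc (q * b) 1 - sc c' T) * P)"
    and "(P * (sc (q * b) 1 - sc c' T) * P) * T = sc (- inverse q) (P * (sc (q * b) 1 - sc c' T) * P)"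
proof -
  let ?m = "sc (q * b) 1 - sc c' T"
  have c1: "T * (P' * Z) = P' * (T * Z)" and c2: "Z * P' * T = Z * T * P'" for Z
    by (simp_all only: mult.assoc comm) (simp only: mult.assoc[symmetric] comm)
  have PTP: "P' * (T * P) = T * P" by (simp only: c1[symmetric] PP)
  have PTP': "(P * T) * P' = P * T" by (simp only: c2[symmetric] PP)
  have X0: "P * ?m * P = sc (q * b) P - sc c' (P * (T * P))"
    by (simp add: left_diff_distrib right_diff_distrib PP mult.assoc)
  have "sc c' (P * (T * P)) = sc c' P * (T * P)" by simp
  also have "\<dots> = P' * (sc b 1 - sc c U) * (P' * (T * P))" by (simp only: P mult.assoc)
  also have "\<dots> = sc b (T * P) - sc c (P' * (U * (T * P)))"
    unfolding PTP by (simp add: left_diff_distrib right_diff_distrib PTP mult.assoc)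
  finally have X1: "P * ?m * P = (sc (q * b) P - sc b (T * P)) + sc c (P' * (U * (T * P)))"
    using X0 by simp
  have "sc c' (P * (T * P)) = (P * T) * sc c' P" by (simp add: mult.assoc)
  also have "\<dots> = ((P * T) * P') * (sc b 1 - sc c U) * P'" by (simp only: P mult.assoc)
  also have "\<dots> = sc b (P * T) - sc c (P * T * U * P')"
    unfolding PTP' by (simp add: left_diff_distrib right_diff_distrib PTP')
  finally have X2: "P * ?m * P = (sc (q * b) P - sc b (P * T)) + sc c (P * T * U * P')"
    using X0 by simp
  have "T * (P' * (U * (T * P))) = P' * (T * U * T * P)" by (simp only: c1 mult.assoc)
  also have "\<dots> = P' * (U * (T * (U * P)))" by (simp only: braid) (simp only: mult.assoc)
  finally have b1: "T * (P' * (U * (T * P))) = sc (- inverse q) (P' * (U * (T * P)))"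
    by (simp add: UP)
  have "(P * T * U * P') * T = P * (T * U * T) * P'" by (simp only: c2 mult.assoc[symmetric])
  also have "\<dots> = (P * U) * T * U * P'" by (simp only: braid) (simp only: mult.assoc)
  finally have b2: "(P * T * U * P') * T = sc (- inverse q) (P * T * U * P')"
    by (simp add: UP mult.assoc)
  show "T * (P * ?m * P) = sc (- inverse q) (P * ?m * P)"
    unfolding X1 distrib_left[of T] quad_eigen_left[OF quad] sc_mult_right b1 sc_add
    by (simp add: mult.commute)
  show "(P * ?m * P) * T = sc (- inverse q) (P * ?m * P)"
    unfolding X2 distrib_right[of _ _ T] quad_eigen_right[OF quad] sc_mult_left b2 sc_add
    by (simp add: mult.commute)
qed

lemma asym_eigen:
  "hecke_seq (k - 1) S \<Longrightarrow> Suc i < k \<Longrightarrow>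
     S i * asym S k = sc (- inverse q) (asym S k) \<and> asym S k * S i = sc (- inverse q) (asym S k)"
proof (induction k arbitrary: i rule: less_induct)
  case (less k)
  obtain k' where k: "k = Suc (Suc k')" using less.prems by (cases k; cases "k - 1") auto
  let ?P = "asym S (Suc k')" and ?T = "S k'"
  let ?m = "sc (q ^ (k' + 1)) 1 - sc (qnum q (k' + 1)) ?T"
  have seq: "hecke_seq k' S" using less.prems(1) k hecke_seq_mono by auto
  have eig: "S i * ?P = sc (- inverse q) ?P" "?P * S i = sc (- inverse q) ?P" if "i < k'" for i
    using less.IH[of "Suc k'" i] seq that k by auto
  have P: "asym S k = sc (inverse (qnum q (k' + 2))) (?P * ?m * ?P)" by (simp add: k)
  have quad: "?T * ?T = 1 + sc qd ?T" using hecke_seq_quad[OF less.prems(1)] k by simp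
  have PP: "?P * ?P = ?P" using asym_right[of "Suc k'" ?P S] eig by auto
  have "S i * (?P * ?m * ?P) = sc (- inverse q) (?P * ?m * ?P) \<and>
    (?P * ?m * ?P) * S i = sc (- inverse q) (?P * ?m * ?P)"
  proof (cases "i < k'")
    case True
    have "S i * (?P * ?m * ?P) = sc (- inverse q) (?P * ?m * ?P)"
      using eig(1)[OF True] by (simp add: mult.assoc[symmetric])
    moreover have "(?P * ?m * ?P) * S i = sc (- inverse q) (?P * ?m * ?P)"
      using eig(2)[OF True] by (simp add: mult.assoc)
    ultimately show ?thesis by blast
  next
    case False
    then have i: "i = k'" using less.prems k by auto
    show ?thesis
    proof (cases k')
      case 0
      then show ?thesis
        using i quad_eigen_left[OF quad, of 1 1] quad_eigen_right[OF quad, of 1 1] by simp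
    next
      case (Suc l)
      let ?P' = "asym S (Suc l)" and ?U = "S l"
      have Pl: "sc (qnum q (l + 2)) ?P = ?P' * (sc (q ^ (l + 1)) 1 - sc (qnum q (l + 1)) ?U) * ?P'"
        using qnum_nonzero[of "l + 2"] by (simp add: Suc)
      have comm: "?T * ?P' = ?P' * ?T"
        using hecke_seq_comm[OF less.prems(1), symmetric] k Suc by (intro asym_commute) auto
      have PP': "?P' * ?P = ?P" "?P * ?P' = ?P"
        using asym_left[of "Suc l" S ?P] asym_right[of "Suc l" ?P S] eig Suc by (simp_all del: asym.simps)
      have braid: "?T * ?U * ?T = ?U * ?T * ?U"
        using hecke_seq_braid[OF less.prems(1), of l] k Suc by simp
      have "l < k'" using Suc by simp
      from eigen_step[OF PP PP' comm braid eig[OF this] quad Pl]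
      show ?thesis using i Suc by (simp del: asym.simps)
    qed
  qed
  then show ?case unfolding P by (simp only: sc_mult_left sc_mult_right sc_sc mult.commute)
qed

lemma asym_idem: "hecke_seq (k - 1) S \<Longrightarrow> asym S k * asym S k = asym S k"
  using asym_right[of k "asym S k" S] asym_eigen by auto

text \<open>
  Each of the two elements is fixed by multiplication with the other, from opposite sides.
\<close>

lemma asym_unique:
  assumes "hecke_seq (k - 1) S" "hecke_seq (k - 1) S'" "S ` {..<k - 1} = S' ` {..<k - 1}"
  shows "asym S k = asym S' k"
proof -
  have 1: "S i * asym S' k = sc (- inverse q) (asym S' k)" if "Suc i < k" for i
  proof -
    have "S i \<in> S' ` {..<k - 1}" using that assms(3) by auto
    then show ?thesis using asym_eigen[OF assms(2)] by auto
  qed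
  have 2: "asym S k * S' i = sc (- inverse q) (asym S k)" if "Suc i < k" for i
  proof -
    have "S' i \<in> S ` {..<k - 1}" using that assms(3) by auto
    then show ?thesis using asym_eigen[OF assms(1)] by auto
  qed
  show ?thesis using asym_left[of k S "asym S' k", OF 1] asym_right[of k "asym S k" S', OF 2] by simp
qed

text \<open>
  For the reversed sequence the defining recursion adds the first generator instead of the last one,
  and by uniqueness the reversal does not change the skew-symmetrizer.
\<close>

lemma asym_first:
  assumes "hecke_seq k S"
  shows "sc (qnum q (Suc k)) (asym S (Suc k)) =
    asym (\<lambda>i. S (Suc i)) k * (sc (q ^ k) 1 - sc (qnum q k) (S 0)) * asym (\<lambda>i. S (Suc i)) k"
proof (cases k)
  case (Suc l)
  let ?S = "\<lambda>i. S (Suc i)" and ?rS = "\<lambda>i. S (l - i)"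
  have rev: "hecke_seq (Suc l) ?rS"
    unfolding hecke_seq_def
  proof (intro conjI allI impI)
    fix i assume "Suc i < Suc l"
    then have e: "l - i = Suc (l - Suc i)" by auto
    have "S (l - Suc i) * S (l - i) * S (l - Suc i) = S (l - i) * S (l - Suc i) * S (l - i)"
      using hecke_seq_braid[OF assms, of "l - Suc i"] \<open>Suc i < Suc l\<close> Suc unfolding e by simp
    then show "?rS i * ?rS (Suc i) * ?rS i = ?rS (Suc i) * ?rS i * ?rS (Suc i)" by simp
  next
    fix i j assume ij: "Suc i < j \<and> j < Suc l"
    then have "Suc (l - j) < l - i" "l - i < Suc l" by auto
    then show "?rS i * ?rS j = ?rS j * ?rS i" using hecke_seq_comm[OF assms] Suc by simp
  qed (use hecke_seq_quad[OF assms] Suc in simp)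
  have sh: "hecke_seq l ?S"
    unfolding hecke_seq_def
  proof (intro conjI allI impI)
    show "?S i * ?S j = ?S j * ?S i" if "Suc i < j \<and> j < l" for i j
      using hecke_seq_comm[OF assms, of "Suc i" "Suc j"] that Suc by simp
  qed (use hecke_seq_quad[OF assms] hecke_seq_braid[OF assms] Suc in auto)
  have "asym S (Suc k) = asym ?rS (Suc k)"
  proof (rule asym_unique)
    show "S ` {..<Suc k - 1} = ?rS ` {..<Suc k - 1}"
    proof -
      have "i \<in> (\<lambda>i. l - i) ` {..<Suc l}" if "i < Suc l" for i
        by (rule image_eqI[of _ _ "l - i"]) (use that in auto)
      then have "{..<Suc l} = (\<lambda>i. l - i) ` {..<Suc l}" by auto
      then show ?thesis unfolding Suc by (metis diff_Suc_1 image_image)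
    qed
  qed (use assms Suc rev in auto)
  moreover have "asym ?rS k = asym ?S k"
  proof (rule asym_unique)
    have "Suc i \<in> (\<lambda>i. l - i) ` {..<l}" if "i < l" for i
      by (rule image_eqI[of _ _ "l - Suc i"]) (use that in auto)
    moreover have "l - i \<in> Suc ` {..<l}" if "i < l" for i
      by (rule image_eqI[of _ _ "l - Suc i"]) (use that in auto)
    ultimately have "(\<lambda>i. l - i) ` {..<l} = Suc ` {..<l}" by auto
    then have "S ` ((\<lambda>i. l - i) ` {..<l}) = S ` Suc ` {..<l}" by simp
    then show "?rS ` {..<k - 1} = ?S ` {..<k - 1}" unfolding Suc by (simp add: image_image)
    show "hecke_seq (k - 1) ?rS" using rev Suc hecke_seq_mono by auto
  qed (use sh Suc in auto)
  ultimately show ?thesis using qnum_nonzero[of "Suc k"] Suc by simp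
qed simp

end

section \<open>Operators on a chain of sites with partial traces\<close>

context q_algebra
begin

lemma asym_cong: "(\<And>i. Suc i < k \<Longrightarrow> F i = G i) \<Longrightarrow> asym F k = asym G k"
  by (induction F k rule: asym.induct) auto

lemma asym_hom:
  assumes "\<And>x y. f (x * y) = f x * f y" "\<And>x y. f (x - y) = f x - f y"
    "\<And>a x. f (sc a x) = sc a (f x)" "f 1 = 1"
  shows "f (asym F k) = asym (\<lambda>i. f (F i)) k"
  by (induction F k rule: asym.induct) (simp_all add: assms)

end

fun iter_trace :: "(nat \<Rightarrow> 'r \<Rightarrow> 'r) \<Rightarrow> nat \<Rightarrow> nat \<Rightarrow> 'r \<Rightarrow> 'r" where
  "iter_trace T a 0 x = x"
| "iter_trace T a (Suc n) x = iter_trace T a n (T (a + n) x)"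

text \<open>
  The sites are counted from 0, and \<open>S k\<close> is \<open>R\<close> acting at the sites \<open>k\<close>, \<open>k + 1\<close>. The set \<open>triv k\<close>
  consists of the operators that act as the identity at \<open>k\<close>, and \<open>T k\<close> takes the \<open>R\<close>-trace over this
  site and puts the identity there. The assumption \<open>T_S\<close> is \<open>Tr\<^sub>R\<^sub>(\<^sub>2\<^sub>) R\<^sub>1\<^sub>2 = I\<close>, \<open>T_copy\<close> is
  \<open>Tr\<^sub>R\<^sub>(\<^sub>2\<^sub>) (R\<^sub>1\<^sub>2 X\<^sub>1 R\<^sub>1\<^sub>2\<^sup>-\<^sup>1) = Tr\<^sub>R(X) I\<close>, and \<open>T_cyc\<close> says that \<open>R\<close> commutes with \<open>C\<^sub>1 C\<^sub>2\<close>. In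
  \<open>L_rel\<close> the two arguments of the defining relation are \<open>c u\<close> and \<open>d u\<close>.
\<close>

locale braided_tower = q_algebra_ideal sc q J
  for sc :: "'a::field \<Rightarrow> 'r::ring_1 \<Rightarrow> 'r" and q J +
  fixes S :: "nat \<Rightarrow> 'r" and triv :: "nat \<Rightarrow> 'r set" and T :: "nat \<Rightarrow> 'r \<Rightarrow> 'r"
    and \<tau> :: 'a and L :: "'a \<Rightarrow> 'r"
  assumes S_hecke: "hecke_seq n S"
    and triv_one: "1 \<in> triv k"
    and triv_sc: "x \<in> triv k \<Longrightarrow> sc a x \<in> triv k"
    and triv_add: "x \<in> triv k \<Longrightarrow> y \<in> triv k \<Longrightarrow> x + y \<in> triv k"
    and triv_mult: "x \<in> triv k \<Longrightarrow> y \<in> triv k \<Longrightarrow> x * y \<in> triv k"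
    and S_triv: "k \<noteq> i \<Longrightarrow> k \<noteq> Suc i \<Longrightarrow> S i \<in> triv k"
    and T_add: "T k (x + y) = T k x + T k y"
    and T_lmult: "y \<in> triv k \<Longrightarrow> T k (y * x) = y * T k x"
    and T_rmult: "y \<in> triv k \<Longrightarrow> T k (x * y) = T k x * y"
    and T_triv: "T k x \<in> triv k"
    and T_J: "x \<in> J \<Longrightarrow> T k x \<in> J"
    and T_one: "T k 1 = sc \<tau> 1"
    and T_S: "T (Suc k) (S k) = 1"
    and T_copy: "x \<in> triv (Suc k) \<Longrightarrow> T (Suc k) (S k * x * (S k - sc qd 1)) = T k x"
    and T_cyc: "T k (T (Suc k) (S k * x)) = T k (T (Suc k) (x * S k))"
    and L_triv: "0 < k \<Longrightarrow> L c \<in> triv k"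
    and L_comm: "0 < k \<Longrightarrow> S k * L c = L c * S k"
    and L_rel: "c \<noteq> 0 \<Longrightarrow> d \<noteq> 0 \<Longrightarrow> c \<noteq> d \<Longrightarrow>
      (S 0 - sc (qd / (1 - d / c)) 1) * L c * S 0 * L d \<asymp>
      L d * S 0 * L c * (S 0 - sc (qd / (1 - d / c)) 1)"
begin

subsection \<open>Shifting\<close>

definition S_inv :: "nat \<Rightarrow> 'r" where "S_inv k = S k - sc qd 1"

lemma S_quad: "S k * S k = 1 + sc qd (S k)" using hecke_seq_quad[OF S_hecke] by blast
lemma S_braid: "S k * S (Suc k) * S k = S (Suc k) * S k * S (Suc k)"
  using hecke_seq_braid[OF S_hecke] by blast
lemma S_far: "Suc i < j \<Longrightarrow> S i * S j = S j * S i" using hecke_seq_comm[OF S_hecke] by blast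

lemma S_S_inv [simp]: "S k * S_inv k = 1" "S_inv k * S k = 1"
  by (simp_all add: S_inv_def algebra_simps S_quad)
lemma S_S_inv' [simp]: "S k * (S_inv k * x) = x" "S_inv k * (S k * x) = x"
  by (simp_all add: mult.assoc[symmetric])

lemma triv_diff: "x \<in> triv k \<Longrightarrow> y \<in> triv k \<Longrightarrow> x - y \<in> triv k"
  using triv_add[of x k "sc (- 1) y"] triv_sc[of y k "- 1"] by simp
lemma S_inv_triv: "k \<noteq> i \<Longrightarrow> k \<noteq> Suc i \<Longrightarrow> S_inv i \<in> triv k"
  by (simp add: S_inv_def triv_diff S_triv triv_sc triv_one)
lemma S_inv_comm: "S k * x = x * S k \<Longrightarrow> S_inv k * x = x * S_inv k"
  by (simp add: S_inv_def algebra_simps)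

lemma T_sc: "T k (sc a x) = sc a (T k x)"
  using T_lmult[OF triv_sc[OF triv_one], of k a x] by simp
lemma T_diff: "T k (x - y) = T k x - T k y"
  using T_add[of k x "sc (- 1) y"] by (simp add: T_sc del: sc_minus_left) simp
lemma T_cong: "x \<asymp> y \<Longrightarrow> T k x \<asymp> T k y"
  by (simp add: cong_J_def T_diff[symmetric] T_J)

fun U :: "nat \<Rightarrow> 'r" where "U 0 = 1" | "U (Suc n) = U n * S n"
fun Ui :: "nat \<Rightarrow> 'r" where "Ui 0 = 1" | "Ui (Suc n) = S_inv n * Ui n"

lemma U_Ui [simp]: "U n * Ui n = 1" "Ui n * U n = 1"
   by (induction n) (simp_all add: mult.assoc, simp add: mult.assoc[symmetric])
lemma U_Ui' [simp]: "U n * (Ui n * x) = x" "Ui n * (U n * x) = x"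
  by (simp_all add: mult.assoc[symmetric])

text \<open>
  Conjugation by \<open>R\<^sub>1 \<dots> R\<^sub>n\<close> moves the generators of the operators at the first \<open>n\<close> sites one site to
  the right.
\<close>

definition shift :: "nat \<Rightarrow> 'r \<Rightarrow> 'r" where "shift n x = U n * x * Ui n"

lemma shift_mult: "shift n (x * y) = shift n x * shift n y" by (simp add: shift_def mult.assoc)
lemma shift_diff: "shift n (x - y) = shift n x - shift n y" by (simp add: shift_def algebra_simps)
lemma shift_sc: "shift n (sc a x) = sc a (shift n x)" by (simp add: shift_def)
lemma shift_one [simp]: "shift n 1 = 1" by (simp add: shift_def)
lemma shift_0 [simp]: "shift 0 x = x" by (simp add: shift_def)
lemma shift_Suc: "shift (Suc n) x = shift n (S n * x * S_inv n)" by (simp add: shift_def mult.assoc)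
lemma shift_cong: "x \<asymp> y \<Longrightarrow> shift n x \<asymp> shift n y"
  unfolding shift_def by (intro cong_rmult cong_lmult)

lemma U_comm: "(\<And>j. j < n \<Longrightarrow> S j * x = x * S j) \<Longrightarrow> U n * x = x * U n"
proof (induction n)
  case (Suc n)
  have "U (Suc n) * x = U n * (S n * x)" by (simp add: mult.assoc)
  also have "\<dots> = U n * x * S n" by (simp add: Suc.prems mult.assoc)
  finally show ?case using Suc by (simp add: mult.assoc)
qed simp

lemma shift_id: "(\<And>j. j < n \<Longrightarrow> S j * x = x * S j) \<Longrightarrow> shift n x = x"
  unfolding shift_def by (subst U_comm) (auto simp: mult.assoc)

lemma conj_id: "S n * x = x * S n \<Longrightarrow> S n * x * S_inv n = x"
  by (simp add: mult.assoc)

lemma shift_S: "Suc i < n \<Longrightarrow> shift n (S i) = S (Suc i)"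
proof (induction n)
  case (Suc n)
  show ?case
  proof (cases "Suc i < n")
    case True
    then show ?thesis using Suc.IH conj_id[OF S_far[OF True, symmetric]] by (simp add: shift_Suc)
  next
    case False
    then have n: "n = Suc i" using Suc.prems by simp
    have "S i * (S (Suc i) * S i * S_inv (Suc i)) * S_inv i
      = (S i * S (Suc i) * S i) * S_inv (Suc i) * S_inv i" by (simp only: mult.assoc)
    also have "\<dots> = S (Suc i)" by (simp only: S_braid) (simp add: mult.assoc)
    finally have "shift (Suc n) (S i) = shift i (S (Suc i))" by (simp add: n shift_Suc)
    also have "\<dots> = S (Suc i)" by (rule shift_id, rule S_far) simp
    finally show ?thesis .
  qed
qed simp

fun bar :: "nat \<Rightarrow> 'a \<Rightarrow> 'r" where
  "bar 0 c = L c"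
| "bar (Suc k) c = S k * bar k c * S_inv k"

lemma bar_triv: "k < j \<Longrightarrow> bar k c \<in> triv j"
  by (induction k) (auto intro!: triv_mult L_triv S_triv S_inv_triv)

lemma conj_comm:
  assumes "y * z = z * y" "y * x = x * y" "y * z' = z' * y"
  shows "y * (z * x * z') = (z * x * z') * (y::'r)"
proof -
  have "y * (z * x * z') = z * (y * x) * z'" by (simp only: mult.assoc[symmetric] assms(1))
  also have "\<dots> = z * x * (y * z')" by (simp only: mult.assoc assms(2))
  finally show ?thesis by (simp only: mult.assoc assms)
qed

lemma bar_comm: "i \<noteq> k \<Longrightarrow> Suc i \<noteq> k \<Longrightarrow> S i * bar k c = bar k c * S i"
proof (induction k arbitrary: i rule: less_induct)
  case (less k)
  show ?case
  proof (cases k)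
    case 0
    then show ?thesis using less.prems L_comm by simp
  next
    case (Suc k')
    show ?thesis
    proof (cases "k' = Suc i")
      case False
      then have far: "S i * S k' = S k' * S i"
        using less.prems Suc S_far[of i k'] S_far[of k' i] by (cases "i < k'") auto
      have "S i * bar k' c = bar k' c * S i" using less.IH[of k' i] False Suc less.prems by auto
      then show ?thesis unfolding Suc bar.simps
        using far S_inv_comm[OF far[symmetric]] by (intro conj_comm) auto
    next
      case True
      have Lk: "bar k c = S (Suc i) * S i * bar i c * (S_inv i * S_inv (Suc i))"
        by (simp add: Suc True mult.assoc)
      have com: "S (Suc i) * bar i c = bar i c * S (Suc i)" using less.IH[of i "Suc i"] Suc True by simp
      \<comment> \<open>\<open>S i\<close> passes the conjugating word as \<open>S (i + 1)\<close>, by the braid relation.\<close>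
      have inv: "S (Suc i) * S_inv i * S_inv (Suc i) = S_inv i * S_inv (Suc i) * S i"
      proof -
        have "S_inv i * S_inv (Suc i) * S i * (S (Suc i) * S i) = S_inv i * S_inv (Suc i) * (S i * S (Suc i) * S i)"
          by (simp only: mult.assoc)
        also have "\<dots> = S (Suc i)" by (simp only: S_braid) (simp add: mult.assoc)
        finally have "S_inv i * S_inv (Suc i) * S i * (S (Suc i) * S i) * (S_inv i * S_inv (Suc i))
            = S (Suc i) * (S_inv i * S_inv (Suc i))" by simp
        then show ?thesis by (simp add: mult.assoc)
      qed
      have "S i * bar k c = (S i * S (Suc i) * S i) * bar i c * (S_inv i * S_inv (Suc i))"
        by (simp only: Lk mult.assoc)
      also have "\<dots> = S (Suc i) * S i * (S (Suc i) * bar i c) * (S_inv i * S_inv (Suc i))"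
        by (simp only: S_braid) (simp only: mult.assoc)
      also have "\<dots> = S (Suc i) * S i * bar i c * (S (Suc i) * S_inv i * S_inv (Suc i))"
        by (simp only: com mult.assoc)
      also have "\<dots> = bar k c * S i" by (simp only: Lk mult.assoc inv[unfolded mult.assoc])
      finally show ?thesis .
    qed
  qed
qed

lemma shift_bar: "k < n \<Longrightarrow> shift n (bar k c) = bar (Suc k) c"
proof (induction n)
  case (Suc n)
  show ?case
  proof (cases "k = n")
    case True
    have "shift (Suc n) (bar k c) = shift n (bar (Suc n) c)" by (simp add: shift_Suc True)
    also have "\<dots> = bar (Suc n) c" by (rule shift_id) (rule bar_comm, auto)
    finally show ?thesis using True by simp
  next
    case False
    then show ?thesis using Suc conj_id[OF bar_comm[of n k c]] by (simp add: shift_Suc)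
  qed
qed simp

definition asym_at :: "nat \<Rightarrow> nat \<Rightarrow> 'r" where "asym_at a k = asym (\<lambda>i. S (a + i)) k"

lemma asym_at_hecke: "hecke_seq n (\<lambda>i. S (a + i))"
  unfolding hecke_seq_def
proof (intro conjI allI impI)
  show "S (a + i) * S (a + j) = S (a + j) * S (a + i)" if "Suc i < j \<and> j < n" for i j
    using that by (intro S_far) simp
qed (use S_quad S_braid in simp_all)

lemma asym_at_eigen:
  assumes "a \<le> i" "Suc i < a + k"
  shows "S i * asym_at a k = sc (- inverse q) (asym_at a k)" "asym_at a k * S i = sc (- inverse q) (asym_at a k)"
  using asym_eigen[OF asym_at_hecke[of "k - 1" a], of "i - a"] assms by (auto simp: asym_at_def)

lemma asym_at_idem [simp]: "asym_at a k * asym_at a k = asym_at a k" unfolding asym_at_def by (rule asym_idem[OF asym_at_hecke])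

lemma shift_asym_at: "a + k \<le> n \<Longrightarrow> shift n (asym_at a k) = asym_at (Suc a) k"
  unfolding asym_at_def
  by (subst asym_hom[of "shift n"]) (auto simp: shift_mult shift_diff shift_sc shift_S intro!: asym_cong)

lemma asym_at_first: "sc (qnum q (Suc k)) (asym_at a (Suc k)) =
    asym_at (Suc a) k * (sc (q ^ k) 1 - sc (qnum q k) (S a)) * asym_at (Suc a) k"
  using asym_first[OF asym_at_hecke[of k a]] by (simp add: asym_at_def)

lemma asym_at_first_inv: "sc (qnum q (Suc k)) (asym_at a (Suc k)) =
    asym_at (Suc a) k * (sc (inverse q ^ k) 1 - sc (qnum q k) (S_inv a)) * asym_at (Suc a) k"
proof -
  have "q ^ k = inverse q ^ k + qnum q k * qd"
    using qnum_Suc[of k] qnum_Suc'[of k] by (simp add: qd_def algebra_simps)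
  then have "sc (q ^ k) 1 - sc (qnum q k) (S a) = sc (inverse q ^ k) 1 - sc (qnum q k) (S_inv a)"
    by (simp add: S_inv_def sc_diff sc_add_left)
  then show ?thesis using asym_at_first by simp
qed

lemma asym_at_comm: "(\<And>i. a \<le> i \<Longrightarrow> Suc i < a + k \<Longrightarrow> S i * x = x * S i) \<Longrightarrow> asym_at a k * x = x * asym_at a k"
  unfolding asym_at_def by (rule asym_commute[symmetric]) auto

fun bar_prod :: "nat \<Rightarrow> 'a list \<Rightarrow> 'r" where
  "bar_prod a [] = 1"
| "bar_prod a (c # cs) = bar a c * bar_prod (Suc a) cs"

lemma bar_prod_append: "bar_prod a (cs @ ds) = bar_prod a cs * bar_prod (a + length cs) ds"
  by (induction cs arbitrary: a) (simp_all add: mult.assoc)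

lemma bar_prod_comm: "Suc i < a \<or> a + length cs \<le> i \<Longrightarrow> S i * bar_prod a cs = bar_prod a cs * S i"
proof (induction cs arbitrary: a)
  case (Cons c cs)
  have "S i * bar a c = bar a c * S i" using Cons.prems by (intro bar_comm) auto
  then have "S i * bar_prod a (c # cs) = bar a c * (S i * bar_prod (Suc a) cs)"
    by (simp add: mult.assoc[symmetric])
  moreover have "S i * bar_prod (Suc a) cs = bar_prod (Suc a) cs * S i"
    using Cons.prems by (intro Cons.IH) auto
  ultimately show ?case by (simp add: mult.assoc)
qed simp

lemma bar_prod_triv: "a + length cs \<le> j \<Longrightarrow> bar_prod a cs \<in> triv j"
  by (induction cs arbitrary: a) (auto intro!: triv_one triv_mult bar_triv)

lemma shift_bar_prod: "a + length cs \<le> n \<Longrightarrow> shift n (bar_prod a cs) = bar_prod (Suc a) cs"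
  by (induction cs arbitrary: a) (auto simp: shift_mult shift_bar)

subsection \<open>Iterated traces\<close>

abbreviation "traces \<equiv> iter_trace T"

lemma traces_diff: "traces a n (x - y) = traces a n x - traces a n y"
  by (induction n arbitrary: x y) (simp_all add: T_diff)
lemma traces_sc: "traces a n (sc b x) = sc b (traces a n x)"
  by (induction n arbitrary: x) (simp_all add: T_sc)
lemma traces_cong: "x \<asymp> y \<Longrightarrow> traces a n x \<asymp> traces a n y"
  by (induction n arbitrary: x y) (simp_all add: T_cong)

lemma traces_lmult: "(\<And>j. a \<le> j \<Longrightarrow> j < a + n \<Longrightarrow> y \<in> triv j) \<Longrightarrow> traces a n (y * x) = y * traces a n x"
  by (induction n arbitrary: x) (simp_all add: T_lmult)

text \<open>
  The traces over the sites after \<open>i + 1\<close> are linear over \<open>S i\<close>, which leaves two adjacent traces.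
\<close>

lemma traces_cyc: "a \<le> i \<Longrightarrow> Suc i < a + n \<Longrightarrow> traces a n (S i * x) = traces a n (x * S i)"
proof (induction n arbitrary: x)
  case (Suc n)
  show ?case
  proof (cases "Suc i = a + n")
    case True
    then obtain n' where n: "n = Suc n'" using Suc.prems by (cases n) auto
    then have "a + n' = i" "a + n = Suc i" using True by auto
    then show ?thesis by (simp add: n T_cyc)
  next
    case False
    then have "S i \<in> triv (a + n)" using Suc.prems by (intro S_triv) auto
    then show ?thesis using Suc False by (simp add: T_lmult T_rmult)
  qed
qed simp

definition cyclic :: "nat \<Rightarrow> nat \<Rightarrow> 'r \<Rightarrow> bool" where
  "cyclic a n y \<longleftrightarrow> (\<forall>x. traces a n (y * x) = traces a n (x * y))"

lemma cyclic_S: "a \<le> i \<Longrightarrow> Suc i < a + n \<Longrightarrow> cyclic a n (S i)" by (simp add: cyclic_def traces_cyc)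
lemma cyclic_one: "cyclic a n 1" by (simp add: cyclic_def)
lemma cyclic_sc: "cyclic a n y \<Longrightarrow> cyclic a n (sc b y)" by (simp add: cyclic_def traces_sc)
lemma cyclic_diff: "cyclic a n y \<Longrightarrow> cyclic a n z \<Longrightarrow> cyclic a n (y - z)"
  by (simp add: cyclic_def traces_diff left_diff_distrib right_diff_distrib)
lemma cyclic_mult: "cyclic a n y \<Longrightarrow> cyclic a n z \<Longrightarrow> cyclic a n (y * z)"
  unfolding cyclic_def by (metis mult.assoc)
lemma cyclic_S_inv: "a \<le> i \<Longrightarrow> Suc i < a + n \<Longrightarrow> cyclic a n (S_inv i)"
  by (simp add: S_inv_def cyclic_diff cyclic_S cyclic_sc cyclic_one)
lemma cyclic_asym: "(\<And>i. Suc i < k \<Longrightarrow> cyclic a n (F i)) \<Longrightarrow> cyclic a n (asym F k)"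
  by (induction F k rule: asym.induct)
    (auto intro!: cyclic_one cyclic_mult cyclic_sc cyclic_diff simp del: sc_mult_left sc_mult_right)
lemma cyclic_asym_at: "a \<le> b \<Longrightarrow> b + k \<le> a + n \<Longrightarrow> cyclic a n (asym_at b k)"
  unfolding asym_at_def by (intro cyclic_asym cyclic_S) auto

lemma U_triv: "n < j \<Longrightarrow> U n \<in> triv j" by (induction n) (auto intro!: triv_one triv_mult S_triv)
lemma Ui_triv: "n < j \<Longrightarrow> Ui n \<in> triv j" by (induction n) (auto intro!: triv_one triv_mult S_inv_triv)

text \<open>
  The trace over the last site absorbs the innermost letters of the conjugating word, and the result
  is the shift of an operator on one site less.
\<close>

lemma traces_shift: "x \<in> triv n \<Longrightarrow> traces 1 n (shift n x) = traces 0 n x"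
proof (induction n arbitrary: x)
  case (Suc n)
  have "traces 1 (Suc n) (shift (Suc n) x) = traces 1 n (T (Suc n) (U n * (S n * x * S_inv n) * Ui n))"
    by (simp add: shift_Suc) (simp add: shift_def)
  also have "T (Suc n) (U n * (S n * x * S_inv n) * Ui n) = U n * T (Suc n) (S n * x * S_inv n) * Ui n"
    by (simp add: T_lmult T_rmult U_triv Ui_triv mult.assoc del: U.simps Ui.simps)
       (simp add: T_lmult T_rmult U_triv Ui_triv mult.assoc[symmetric] del: U.simps Ui.simps)
  also have "\<dots> = shift n (T n x)" using T_copy[OF Suc.prems] by (simp add: S_inv_def shift_def)
  also have "traces 1 n \<dots> = traces 0 n (T n x)" by (rule Suc.IH) (rule T_triv)
  finally show ?case by simp
qed simp

text \<open>
  \<open>V n\<close> is the word \<open>S 1 \<dots> S n\<close>, so that the shift on \<open>n + 1\<close> sites is conjugation by \<open>S 0 * V n\<close>.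
  Unlike \<open>S 0\<close>, it can be moved around a trace over the sites from 1 on.
\<close>

fun V :: "nat \<Rightarrow> 'r" where "V 0 = 1" | "V (Suc n) = V n * S (Suc n)"
fun Vi :: "nat \<Rightarrow> 'r" where "Vi 0 = 1" | "Vi (Suc n) = S_inv (Suc n) * Vi n"

lemma U_V: "U (Suc n) = S 0 * V n" by (induction n) (simp_all add: mult.assoc)
lemma Ui_Vi: "Ui (Suc n) = Vi n * S_inv 0" by (induction n) (simp_all add: mult.assoc)
lemma V_Vi [simp]: "V n * Vi n = 1" "Vi n * V n = 1"
   by (induction n) (simp_all add: mult.assoc, simp add: mult.assoc[symmetric])
lemma V_Vi' [simp]: "V n * (Vi n * x) = x" "Vi n * (V n * x) = x"
  by (simp_all add: mult.assoc[symmetric])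
lemma V_shift: "n < k \<Longrightarrow> V n = shift k (U n)"
  by (induction n) (auto simp: shift_mult shift_S)
lemma cyclic_V: "cyclic 1 (Suc n) (V n)" "cyclic 1 (Suc n) (Vi n)"
proof -
  have "m \<le> n \<Longrightarrow> cyclic 1 (Suc n) (V m) \<and> cyclic 1 (Suc n) (Vi m)" for m
    by (induction m) (auto intro!: cyclic_one cyclic_mult cyclic_S cyclic_S_inv)
  then show "cyclic 1 (Suc n) (V n)" "cyclic 1 (Suc n) (Vi n)" by auto
qed

text \<open>The shift on \<open>n + 1\<close> sites carries \<open>U n\<close> to \<open>V n\<close>.\<close>

lemma V_conj: "Vi n * S 0 * V n = U n * S n * Ui n"
proof -
  have "S 0 * V n * U n = U (Suc n) * U n" by (simp add: U_V del: U.simps)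
  also have "\<dots> = shift (Suc n) (U n) * U (Suc n)" by (simp add: shift_def mult.assoc del: U.simps Ui.simps)
  also have "\<dots> = V n * (U n * S n)" by (simp add: V_shift[of n "Suc n"])
  finally have "Vi n * (S 0 * V n * U n) * Ui n = Vi n * (V n * (U n * S n)) * Ui n" by simp
  then show ?thesis by (simp add: mult.assoc)
qed

lemma V_conj_inv: "Vi n * S_inv 0 * V n = U n * S_inv n * Ui n"
proof -
  have "Vi n * S_inv 0 * V n = Vi n * S 0 * V n - sc qd 1" by (simp add: S_inv_def algebra_simps)
  also have "\<dots> = U n * S n * Ui n - sc qd 1" by (simp add: V_conj)
  also have "\<dots> = U n * S_inv n * Ui n" by (simp add: S_inv_def algebra_simps)
  finally show ?thesis .
qed

text \<open>
  The factor \<open>S 0\<close> cancels the outermost letter of the inverse word. The rest of this word can be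
  moved around the trace and turns the remaining \<open>S 0\<close> into a conjugate of \<open>S n\<close>, whose trace over the
  last site is the identity.
\<close>

lemma traces_shift_S:
  assumes "x \<in> triv (Suc n)"
  shows "traces 1 (Suc n) (shift (Suc n) x * S 0) = traces 1 n x"
proof -
  have "shift (Suc n) x * S 0 = (S 0 * V n * x) * Vi n"
    unfolding shift_def U_V Ui_Vi by (simp add: mult.assoc)
  then have "traces 1 (Suc n) (shift (Suc n) x * S 0) = traces 1 (Suc n) (Vi n * (S 0 * V n * x))"
    using cyclic_V[of n] by (simp only: cyclic_def)
  also have "Vi n * (S 0 * V n * x) = U n * S n * Ui n * x"
    by (simp only: V_conj[symmetric]) (simp only: mult.assoc)
  also have "T (Suc n) (U n * S n * Ui n * x) = x"
  proof -
    have "U n * S n * Ui n * x = U n * (S n * (Ui n * x))" by (simp only: mult.assoc)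
    also have "T (Suc n) \<dots> = U n * (T (Suc n) (S n) * (Ui n * x))"
      using assms by (simp only: T_lmult U_triv T_rmult triv_mult Ui_triv lessI)
    finally show ?thesis by (simp add: T_S)
  qed
  then have "traces 1 (Suc n) (U n * S n * Ui n * x) = traces 1 n x" by simp
  finally show ?thesis .
qed

text \<open>
  The same argument leads to \<open>S n\<^sup>-\<^sup>1 = S n - (q - q\<^sup>-\<^sup>1)\<close>, whose trace over the last site is a scalar.
\<close>

lemma traces_S_inv_shift:
  assumes "x \<in> triv (Suc n)"
  shows "traces 1 (Suc n) (S_inv 0 * shift (Suc n) x) = sc (1 - qd * \<tau>) (traces 1 n x)"
proof -
  have "S_inv 0 * shift (Suc n) x = V n * (x * Vi n * S_inv 0)"
    unfolding shift_def U_V Ui_Vi by (simp add: mult.assoc)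
  then have "traces 1 (Suc n) (S_inv 0 * shift (Suc n) x) = traces 1 (Suc n) ((x * Vi n * S_inv 0) * V n)"
    using cyclic_V[of n] by (simp only: cyclic_def)
  also have "(x * Vi n * S_inv 0) * V n = x * (U n * S_inv n * Ui n)"
    by (simp only: V_conj_inv[symmetric]) (simp only: mult.assoc)
  also have "T (Suc n) (x * (U n * S_inv n * Ui n)) = sc (1 - qd * \<tau>) x"
  proof -
    have "x * (U n * S_inv n * Ui n) = (x * U n) * S_inv n * Ui n" by (simp only: mult.assoc)
    also have "T (Suc n) \<dots> = (x * U n) * T (Suc n) (S_inv n) * Ui n"
      using assms by (simp add: T_lmult U_triv T_rmult triv_mult Ui_triv mult.assoc del: U.simps Ui.simps)
    also have "T (Suc n) (S_inv n) = sc (1 - qd * \<tau>) 1"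
      by (simp add: S_inv_def T_diff T_S T_sc T_one sc_diff_left)
    finally show ?thesis by (simp add: mult.assoc)
  qed
  then have "traces 1 (Suc n) (x * (U n * S_inv n * Ui n)) = sc (1 - qd * \<tau>) (traces 1 n x)"
    by (simp add: traces_sc)
  finally show ?thesis .
qed

end

context braided_tower
begin

subsection \<open>Exchanging the factors\<close>

lemma bar_rel:
  assumes "c \<noteq> 0" "d \<noteq> 0" "c \<noteq> d"
  shows "(S k - sc (qd / (1 - d / c)) 1) * bar k c * bar (Suc k) d \<asymp>
      bar k d * bar (Suc k) c * (S k - sc (qd / (1 - d / c)) 1)"
proof (induction k)
  case 0
  let ?s = "S 0 - sc (qd / (1 - d / c)) 1"
  have "?s * L c * S 0 * L d * S_inv 0 \<asymp> L d * S 0 * L c * ?s * S_inv 0"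
    by (intro cong_rmult L_rel assms)
  also have "\<dots> = L d * S 0 * L c * (?s * S_inv 0)" by (simp only: mult.assoc)
  also have "?s * S_inv 0 = S_inv 0 * ?s"
    by (simp add: S_inv_def left_diff_distrib right_diff_distrib sc_diff mult.commute)
  finally show ?case by (simp add: mult.assoc)
next
  case (Suc k)
  from shift_cong[OF Suc, of "Suc (Suc k)"] show ?case
    by (simp add: shift_mult shift_diff shift_sc shift_S shift_bar del: bar.simps)
qed

lemma bar_prod_rel:
  assumes "c \<noteq> 0" "d \<noteq> 0" "c \<noteq> d"
  shows "(S (length xs) - sc (qd / (1 - d / c)) 1) * bar_prod 0 (xs @ c # d # ys) \<asymp>
    bar_prod 0 (xs @ d # c # ys) * (S (length xs) - sc (qd / (1 - d / c)) 1)"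
proof -
  let ?i = "length xs" and ?s = "S (length xs) - sc (qd / (1 - d / c)) 1"
  let ?X = "bar_prod 0 xs" and ?Y = "bar_prod (Suc (Suc (length xs))) ys"
  have X: "?s * ?X = ?X * ?s" using bar_prod_comm[of ?i 0 xs] by (simp add: algebra_simps)
  have Y: "?s * ?Y = ?Y * ?s" using bar_prod_comm[of ?i "Suc (Suc ?i)" ys] by (simp add: algebra_simps)
  have "?s * bar_prod 0 (xs @ c # d # ys) = ?s * ?X * bar ?i c * bar (Suc ?i) d * ?Y"
    by (simp add: bar_prod_append mult.assoc del: bar.simps)
  also have "\<dots> = ?X * (?s * bar ?i c * bar (Suc ?i) d) * ?Y" by (simp only: X mult.assoc)
  also have "\<dots> \<asymp> ?X * (bar ?i d * bar (Suc ?i) c * ?s) * ?Y"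
    by (intro cong_rmult cong_lmult bar_rel assms)
  also have "\<dots> = ?X * (bar ?i d * bar (Suc ?i) c) * (?s * ?Y)" by (simp only: mult.assoc)
  also have "\<dots> = bar_prod 0 (xs @ d # c # ys) * ?s"
    unfolding Y by (simp add: bar_prod_append mult.assoc del: bar.simps)
  finally show ?thesis .
qed

lemma asym_at_sub:
  assumes "Suc i < k"
  shows "asym_at 0 k * (S i - sc b 1) = sc (- inverse q - b) (asym_at 0 k)"
    "(S i - sc b 1) * asym_at 0 k = sc (- inverse q - b) (asym_at 0 k)"
  using asym_at_eigen[of 0 i k] assms by (simp_all add: algebra_simps sc_diff_left)

text \<open>
  Next to the skew-symmetrizer, \<open>R(u,v)\<close> becomes the scalar \<open>- q\<^sup>-\<^sup>1 - (q - q\<^sup>-\<^sup>1)/(1 - d/c)\<close>, which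
  vanishes only if \<open>d = q\<^sup>2 c\<close>.
\<close>

lemma bar_prod_swap:
  assumes "c \<noteq> 0" "d \<noteq> 0" "c \<noteq> d" "d \<noteq> q\<^sup>2 * c"
    and k: "k = length xs + Suc (Suc (length ys))"
  shows "asym_at 0 k * bar_prod 0 (xs @ c # d # ys) * asym_at 0 k \<asymp> asym_at 0 k * bar_prod 0 (xs @ d # c # ys) * asym_at 0 k"
proof -
  let ?a = "qd / (1 - d / c)" and ?i = "length xs" and ?P = "asym_at 0 k"
  let ?M = "bar_prod 0 (xs @ c # d # ys)" and ?M' = "bar_prod 0 (xs @ d # c # ys)"
  have i: "Suc ?i < k" using k by simp
  have "- inverse q - ?a \<noteq> 0"
  proof
    assume "- inverse q - ?a = 0"
    moreover have "1 - d / c \<noteq> 0" using assms by simp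
    ultimately have "qd * q = - (1 - d / c)" using q_nonzero by (simp add: field_simps)
    then have "d / c = q\<^sup>2" using q_nonzero by (simp add: qd_def power2_eq_square algebra_simps)
    then show False using assms by (simp add: field_simps)
  qed
  moreover have "sc (- inverse q - ?a) (?P * ?M * ?P) \<asymp> sc (- inverse q - ?a) (?P * ?M' * ?P)"
  proof -
    have "sc (- inverse q - ?a) (?P * ?M * ?P) = ?P * ((S ?i - sc ?a 1) * ?M) * ?P"
      using asym_at_sub(1)[OF i, of ?a] by (simp add: mult.assoc[symmetric])
    also have "\<dots> \<asymp> ?P * (?M' * (S ?i - sc ?a 1)) * ?P"
      by (intro cong_rmult cong_lmult bar_prod_rel assms)
    also have "\<dots> = sc (- inverse q - ?a) (?P * ?M' * ?P)"
      using asym_at_sub(2)[OF i, of ?a] by (simp add: mult.assoc)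
    finally show ?thesis .
  qed
  ultimately show ?thesis by (rule cong_sc_cancel)
qed

lemma S_proj: "(S i - sc q 1) * (S i + sc (inverse q) 1) = 0" "(S i + sc (inverse q) 1) * (S i - sc q 1) = 0"
proof -
  have "sc q (S i) = sc (inverse q) (S i) + sc qd (S i)" by (simp add: qd_def sc_diff_left)
  then show "(S i - sc q 1) * (S i + sc (inverse q) 1) = 0" "(S i + sc (inverse q) 1) * (S i - sc q 1) = 0"
    using q_nonzero S_quad[of i] by (simp_all add: algebra_simps sc_diff sc_add)
qed

text \<open>
  For these arguments \<open>R(u,v)\<close> is \<open>S - q\<close>, which is annihilated by \<open>S + q\<^sup>-\<^sup>1\<close>.
\<close>

lemma
  assumes "c \<noteq> 0" "c = q\<^sup>2 * d" and k: "k = length xs + Suc (Suc (length ys))"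
  shows bar_prod_adj_right: "asym_at 0 k * bar_prod 0 (xs @ c # d # ys) * S (length xs) \<asymp>
      sc (- inverse q) (asym_at 0 k * bar_prod 0 (xs @ c # d # ys))" (is ?r)
    and bar_prod_adj_left: "S (length xs) * (bar_prod 0 (xs @ d # c # ys) * asym_at 0 k) \<asymp>
      sc (- inverse q) (bar_prod 0 (xs @ d # c # ys) * asym_at 0 k)" (is ?l)
proof -
  let ?i = "length xs" and ?P = "asym_at 0 k"
  let ?M = "bar_prod 0 (xs @ c # d # ys)" and ?M' = "bar_prod 0 (xs @ d # c # ys)"
  have i: "Suc ?i < k" using k by simp
  have d: "d \<noteq> 0" using assms by auto
  have "inverse q - q \<noteq> 0" using qdiff_nonzero by simp
  then have q1: "q\<^sup>2 \<noteq> 1" using q_nonzero by (auto simp: field_simps power2_eq_square)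
  then have cd: "c \<noteq> d" using assms d by auto
  have dc: "d / c = inverse q ^ 2" using assms d q_nonzero by (simp add: field_simps)
  have "qd = q * (1 - inverse q ^ 2)" using q_nonzero by (simp add: qd_def field_simps power2_eq_square)
  moreover have "1 - inverse q ^ 2 \<noteq> 0" using q1 q_nonzero by (simp add: field_simps)
  ultimately have a: "qd / (1 - d / c) = q" using dc by simp
  have "- qnum q 2 = - inverse q - q"
    using qnum_Suc[of 1] by (simp add: numeral_2_eq_2)
  then have b: "- inverse q - q \<noteq> 0" using qnum_nonzero[of 2] by (metis neg_equal_0_iff_equal zero_less_numeral)
  have rel: "(S ?i - sc q 1) * ?M \<asymp> ?M' * (S ?i - sc q 1)"
    using bar_prod_rel[OF assms(1) d cd, of xs ys] unfolding a .
  have "?P * ((S ?i - sc q 1) * ?M) * (S ?i + sc (inverse q) 1) \<asymp>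
      ?P * (?M' * (S ?i - sc q 1)) * (S ?i + sc (inverse q) 1)"
    by (intro cong_rmult cong_lmult rel)
  also have "\<dots> = sc (- inverse q - q) 0" using S_proj by (simp add: mult.assoc)
  finally have "sc (- inverse q - q) (?P * ?M * (S ?i + sc (inverse q) 1)) \<asymp> sc (- inverse q - q) 0"
    using asym_at_sub(1)[OF i, of q] by (simp only: mult.assoc[symmetric] sc_mult_left)
  then have "?P * ?M * (S ?i + sc (inverse q) 1) \<asymp> 0" using cong_sc_cancel[OF b] by blast
  then show ?r by (simp add: cong_J_def algebra_simps)
  have "(S ?i + sc (inverse q) 1) * ((?M' * (S ?i - sc q 1)) * ?P) \<asymp>
      (S ?i + sc (inverse q) 1) * (((S ?i - sc q 1) * ?M) * ?P)"
    by (intro cong_rmult cong_lmult cong_sym[OF rel])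
  also have "\<dots> = sc (- inverse q - q) 0" using S_proj by (simp add: mult.assoc[symmetric])
  finally have "sc (- inverse q - q) ((S ?i + sc (inverse q) 1) * (?M' * ?P)) \<asymp> sc (- inverse q - q) 0"
    using asym_at_sub(2)[OF i, of q] by (simp only: mult.assoc sc_mult_right)
  then have "(S ?i + sc (inverse q) 1) * (?M' * ?P) \<asymp> 0" using cong_sc_cancel[OF b] by blast
  then show ?l by (simp add: cong_J_def algebra_simps)
qed

text \<open>Together with \<open>bar_prod_rev\<close>, a bubble sort of the arguments.\<close>

lemma bar_prod_move:
  assumes "\<And>d. d \<in> set ys \<Longrightarrow> d \<noteq> 0 \<and> c \<noteq> d \<and> d \<noteq> q\<^sup>2 * c" "c \<noteq> 0"
    and "k = length xs + length ys + Suc (length zs)"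
  shows "asym_at 0 k * bar_prod 0 (xs @ c # ys @ zs) * asym_at 0 k \<asymp> asym_at 0 k * bar_prod 0 (xs @ ys @ c # zs) * asym_at 0 k"
  using assms
proof (induction ys arbitrary: xs)
  case (Cons d ys)
  have "asym_at 0 k * bar_prod 0 (xs @ c # d # ys @ zs) * asym_at 0 k \<asymp> asym_at 0 k * bar_prod 0 (xs @ d # c # ys @ zs) * asym_at 0 k"
    using Cons.prems by (intro bar_prod_swap) auto
  also have "asym_at 0 k * bar_prod 0 (xs @ d # c # ys @ zs) * asym_at 0 k \<asymp> asym_at 0 k * bar_prod 0 (xs @ (d # ys) @ c # zs) * asym_at 0 k"
    using Cons.IH[of "xs @ [d]"] Cons.prems by simp
  finally show ?case by simp
qed simp

lemma bar_prod_rev: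
  assumes "sorted_wrt (\<lambda>c d. c \<noteq> d \<and> d \<noteq> q\<^sup>2 * c) cs" "0 \<notin> set cs" "k = length cs + length zs"
  shows "asym_at 0 k * bar_prod 0 (cs @ zs) * asym_at 0 k \<asymp> asym_at 0 k * bar_prod 0 (rev cs @ zs) * asym_at 0 k"
  using assms
proof (induction cs arbitrary: zs)
  case (Cons c cs)
  have "asym_at 0 k * bar_prod 0 ([] @ c # cs @ zs) * asym_at 0 k \<asymp> asym_at 0 k * bar_prod 0 ([] @ cs @ c # zs) * asym_at 0 k"
    using Cons.prems by (intro bar_prod_move) auto
  also have "asym_at 0 k * bar_prod 0 ([] @ cs @ c # zs) * asym_at 0 k \<asymp> asym_at 0 k * bar_prod 0 (rev cs @ c # zs) * asym_at 0 k"
    using Cons.IH[of "c # zs"] Cons.prems by simp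
  finally show ?case by simp
qed simp

text \<open>The arguments \<open>u, q\<^sup>-\<^sup>2u, \<dots>\<close>, given by their ratios to \<open>u\<close>.\<close>

definition qs :: "nat \<Rightarrow> 'a list" where "qs k = map (\<lambda>i. inverse q ^ (2 * i)) [0..<k]"

lemma length_qs [simp]: "length (qs k) = k" by (simp add: qs_def)
lemma qs_Suc: "qs (Suc k) = qs k @ [inverse q ^ (2 * k)]" by (simp add: qs_def)

lemma qpow_neq_1: "0 < k \<Longrightarrow> q ^ (2 * k) \<noteq> 1"
proof
  assume k: "0 < k" "q ^ (2 * k) = 1"
  then have "q ^ k * q ^ k = 1" by (simp add: mult_2 power_add)
  then have "q ^ k = inverse q ^ k" using inverse_unique[of "q ^ k" "q ^ k"] by (simp add: power_inverse)
  then show False using qnum_nonzero[OF k(1)] by (simp add: qnum_def)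
qed

lemma qs_sorted: "sorted_wrt (\<lambda>c d. c \<noteq> d \<and> d \<noteq> q\<^sup>2 * c) (qs k)"
proof -
  have "inverse q ^ (2 * i) \<noteq> inverse q ^ (2 * j) \<and> inverse q ^ (2 * j) \<noteq> q\<^sup>2 * inverse q ^ (2 * i)"
    if ij: "i < j" for i j
  proof -
    obtain l where j: "j = i + Suc l" using less_imp_Suc_add[OF ij] by (metis add_Suc_right)
    have nz: "inverse q ^ (2 * i) \<noteq> 0" using q_nonzero by simp
    have inv: "inverse q ^ (2 * Suc l) * q ^ (2 * Suc l) = 1"
      using q_nonzero by (metis left_inverse power_mult_distrib power_one)
    have split: "inverse q ^ (2 * (i + Suc l)) = inverse q ^ (2 * i) * inverse q ^ (2 * Suc l)"
      by (simp only: distrib_left power_add)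
    have "inverse q ^ (2 * Suc l) \<noteq> 1"
      using qpow_neq_1[of "Suc l"] inv by (metis mult.left_neutral zero_less_Suc)
    then have "inverse q ^ (2 * i) \<noteq> inverse q ^ (2 * (i + Suc l))"
      unfolding split using nz by simp
    moreover have "inverse q ^ (2 * (i + Suc l)) \<noteq> q\<^sup>2 * inverse q ^ (2 * i)"
    proof
      assume "inverse q ^ (2 * (i + Suc l)) = q\<^sup>2 * inverse q ^ (2 * i)"
      then have "inverse q ^ (2 * Suc l) = q\<^sup>2" unfolding split using nz by (metis mult.commute mult_cancel_left)
      then have "q\<^sup>2 * q ^ (2 * Suc l) = 1" using inv by simp
      moreover have "2 * (l + 2) = 2 + 2 * Suc l" by simp
      ultimately have "q ^ (2 * (l + 2)) = 1" by (simp only: power_add)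
      then show False using qpow_neq_1[of "l + 2"] by simp
    qed
    ultimately show ?thesis by (simp add: j)
  qed
  then show ?thesis unfolding qs_def sorted_wrt_map
    by (rule sorted_wrt_mono_rel[OF _ sorted_wrt_upt]) blast
qed

lemma qs_split:
  assumes "Suc i < k"
  obtains xs c d ys where "qs k = xs @ c # d # ys" "length xs = i" "c \<noteq> 0" "c = q\<^sup>2 * d"
    "k = length xs + Suc (Suc (length ys))"
proof (rule that)
  have "drop i (qs k) = qs k ! i # drop (Suc i) (qs k)"
    using assms by (intro Cons_nth_drop_Suc[symmetric]) simp
  also have "drop (Suc i) (qs k) = qs k ! Suc i # drop (Suc (Suc i)) (qs k)"
    using assms by (intro Cons_nth_drop_Suc[symmetric]) simp
  finally show "qs k = take i (qs k) @ qs k ! i # qs k ! Suc i # drop (Suc (Suc i)) (qs k)"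
    using append_take_drop_id[of i "qs k"] by metis
  have "q\<^sup>2 * inverse q ^ 2 = 1" using q_nonzero by (metis power_mult_distrib power_one right_inverse)
  moreover have "2 * Suc i = 2 + 2 * i" by simp
  ultimately have "q\<^sup>2 * inverse q ^ (2 * Suc i) = inverse q ^ (2 * i)"
    by (simp only: power_add mult.assoc[symmetric] mult_1_left)
  then show "qs k ! i = q\<^sup>2 * qs k ! Suc i" using assms by (simp add: qs_def)
  show "qs k ! i \<noteq> 0" using assms q_nonzero by (simp add: qs_def)
  show "length (take i (qs k)) = i" using assms by simp
  show "k = length (take i (qs k)) + Suc (Suc (length (drop (Suc (Suc i)) (qs k))))"
    using assms by simp
qed

subsection \<open>The recursion for skew-symmetrized powers\<close>

text \<open>
  \<open>desc_prod\<close> has the arguments \<open>q\<^sup>-\<^sup>2\<^sup>(\<^sup>k\<^sup>-\<^sup>1\<^sup>)u, \<dots>, u\<close>, like the powers of \<open>L\<close>, and \<open>asc_prod\<close> has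
  the arguments \<open>u, \<dots>, q\<^sup>-\<^sup>2\<^sup>(\<^sup>k\<^sup>-\<^sup>1\<^sup>)u\<close>, like the elementary symmetric elements.
\<close>

definition desc_prod :: "nat \<Rightarrow> 'r" where "desc_prod k = bar_prod 0 (rev (qs k))"
definition asc_prod :: "nat \<Rightarrow> 'r" where "asc_prod k = bar_prod 0 (qs k)"

lemma asym_asc_absorb: "asym_at 0 k * asc_prod k * asym_at 0 k \<asymp> asym_at 0 k * asc_prod k"
proof -
  have "asym_at 0 k * asc_prod k * S i \<asymp> sc (- inverse q) (asym_at 0 k * asc_prod k)" if i: "Suc i < k" for i
  proof -
    obtain xs c d ys where *: "qs k = xs @ c # d # ys" "length xs = i" "c \<noteq> 0" "c = q\<^sup>2 * d"
      "k = length xs + Suc (Suc (length ys))"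
      using qs_split[OF i] by metis
    from bar_prod_adj_right[OF *(3-5)] show ?thesis unfolding asc_prod_def *(1) *(2) .
  qed
  then have "asym_at 0 k * asc_prod k * asym (\<lambda>i. S (0 + i)) k \<asymp> asym_at 0 k * asc_prod k"
    by (intro cong_asym_right) simp
  then show ?thesis by (simp add: asym_at_def)
qed

lemma asym_desc_absorb: "asym_at 0 k * desc_prod k * asym_at 0 k \<asymp> desc_prod k * asym_at 0 k"
proof -
  have "S i * (desc_prod k * asym_at 0 k) \<asymp> sc (- inverse q) (desc_prod k * asym_at 0 k)" if i: "Suc i < k" for i
  proof -
    have "Suc (k - Suc (Suc i)) < k" using i by simp
    then obtain xs c d ys where *: "qs k = xs @ c # d # ys" "length xs = k - Suc (Suc i)" "c \<noteq> 0" "c = q\<^sup>2 * d"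
      "k = length xs + Suc (Suc (length ys))"
      using qs_split by metis
    have "length ys = i" using *(2,5) i by linarith
    then have "length (rev ys) = i" by simp
    moreover have "k = length (rev ys) + Suc (Suc (length (rev xs)))"
      unfolding length_rev using *(5) by linarith
    ultimately show ?thesis using bar_prod_adj_left[OF *(3,4), of k "rev ys" "rev xs"]
      unfolding desc_prod_def *(1) by simp
  qed
  then have "asym (\<lambda>i. S (0 + i)) k * (desc_prod k * asym_at 0 k) \<asymp> desc_prod k * asym_at 0 k"
    by (intro cong_asym_left) simp
  then show ?thesis by (simp add: asym_at_def mult.assoc)
qed

lemma asym_asc_desc: "asym_at 0 k * asc_prod k \<asymp> desc_prod k * asym_at 0 k"
proof -
  have "0 \<notin> set (qs k)" using q_nonzero by (auto simp: qs_def)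
  then have "asym_at 0 k * asc_prod k * asym_at 0 k \<asymp> asym_at 0 k * desc_prod k * asym_at 0 k"
    using bar_prod_rev[OF qs_sorted, of k k "[]"] by (simp add: desc_prod_def asc_prod_def)
  then show ?thesis using asym_asc_absorb asym_desc_absorb cong_sym cong_trans by blast
qed

lemma desc_prod_triv: "desc_prod k \<in> triv k" "asc_prod k \<in> triv k" by (auto simp: desc_prod_def asc_prod_def intro!: bar_prod_triv)
lemma asym_triv: "(\<And>i. Suc i < k \<Longrightarrow> F i \<in> triv j) \<Longrightarrow> asym F k \<in> triv j"
  by (induction F k rule: asym.induct)
    (auto intro!: triv_one triv_mult triv_sc triv_diff simp del: sc_mult_left sc_mult_right)
lemma asym_at_triv: "a + k \<le> j \<Longrightarrow> asym_at a k \<in> triv j"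
  unfolding asym_at_def by (intro asym_triv S_triv) auto

lemma desc_prod_Suc: "desc_prod (Suc k) = L (inverse q ^ (2 * k)) * shift k (desc_prod k)"
  by (simp add: desc_prod_def qs_Suc shift_bar_prod)

lemma S_comm_L: "1 \<le> i \<Longrightarrow> S i * L c = L c * S i" by (rule L_comm) simp

lemma asym_at_L: "asym_at 1 k * L c = L c * asym_at 1 k" by (rule asym_at_comm) (rule S_comm_L)

text \<open>For \<open>k = 0\<close> this is zero, as \<open>[0] = 0\<close>, which starts the recursion.\<close>

definition skew_power :: "nat \<Rightarrow> 'r" where "skew_power k = sc (qnum q k) (traces 1 (k - 1) (desc_prod k * asym_at 0 k))"
definition elem :: "nat \<Rightarrow> 'r" where "elem k = traces 0 k (asym_at 0 k * asc_prod k)"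

lemma L_traces: "traces 1 k (L c * x) = L c * traces 1 k x"
  by (rule traces_lmult) (simp add: L_triv)

text \<open>
  Split off the first generator of the skew-symmetrizer. The outer copies of the skew-symmetrizer at
  the sites \<open>1,\<dots>,k\<close> are absorbed by cyclicity; the two remaining summands are a full trace of a
  shifted operator and the trace of a shifted operator times \<open>S 0\<close>.
\<close>

lemma skew_power_Suc: "skew_power (Suc k) \<asymp> L (inverse q ^ (2 * k)) * (sc (q ^ k) (elem k) - skew_power k)"
proof -
  let ?L = "L (inverse q ^ (2 * k))" and ?P = "asym_at 1 k" and ?W = "shift k (desc_prod k * asym_at 0 k)"
  let ?m = "sc (q ^ k) 1 - sc (qnum q k) (S 0)"
  have cyc: "traces 1 k (?P * x) = traces 1 k (x * ?P)" for x
    using cyclic_asym_at[of 1 1 k k] by (simp add: cyclic_def)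
  have W: "?P * ?W \<asymp> ?W" using shift_cong[OF asym_desc_absorb, of k k] by (simp add: shift_mult shift_asym_at mult.assoc)
  have W': "?W * ?P = ?W" by (simp add: shift_mult shift_asym_at mult.assoc)
  have "sc (qnum q (Suc k)) (desc_prod (Suc k) * asym_at 0 (Suc k)) = ?L * shift k (desc_prod k) * (?P * ?m * ?P)"
    using asym_at_first[of k 0] by (simp add: desc_prod_Suc flip: sc_mult_right)
  also have "\<dots> = ?L * ?W * ?m * ?P" by (simp add: shift_mult shift_asym_at mult.assoc)
  finally have "skew_power (Suc k) = traces 1 k (?L * ?W * ?m * ?P)"
    by (simp add: skew_power_def traces_sc[symmetric])
  also have "\<dots> = traces 1 k (?P * (?L * ?W * ?m))" by (simp only: cyc)
  also have "?P * (?L * ?W * ?m) = ?L * (?P * ?W) * ?m"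
    by (simp only: mult.assoc[symmetric] asym_at_L)
  also have "traces 1 k (?L * (?P * ?W) * ?m) \<asymp> traces 1 k (?L * ?W * ?m)"
    by (intro traces_cong cong_rmult cong_lmult W)
  also have "traces 1 k (?L * ?W * ?m) = ?L * traces 1 k (?W * ?m)" by (simp only: L_traces mult.assoc)
  also have "traces 1 k (?W * ?m) = sc (q ^ k) (traces 1 k ?W) - sc (qnum q k) (traces 1 k (?W * S 0))"
    by (simp add: right_diff_distrib traces_diff traces_sc)
  also have "sc (qnum q k) (traces 1 k (?W * S 0)) = skew_power k"
  proof (cases k)
    case (Suc n)
    have "desc_prod k * asym_at 0 k \<in> triv (Suc n)" using desc_prod_triv asym_at_triv Suc by (simp add: triv_mult)
    then show ?thesis using traces_shift_S by (simp add: Suc skew_power_def)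
  qed (simp add: skew_power_def)
  also have "traces 1 k ?W = traces 0 k (desc_prod k * asym_at 0 k)"
    using desc_prod_triv asym_at_triv by (intro traces_shift triv_mult) auto
  also have "?L * (sc (q ^ k) (traces 0 k (desc_prod k * asym_at 0 k)) - skew_power k) \<asymp> ?L * (sc (q ^ k) (elem k) - skew_power k)"
    unfolding elem_def by (intro cong_lmult cong_diff cong_refl cong_sc traces_cong cong_sym[OF asym_asc_desc])
  finally show ?thesis .
qed

fun L_power :: "nat \<Rightarrow> 'a \<Rightarrow> 'r" where
  "L_power 0 c = 1"
| "L_power (Suc k) c = L (inverse q ^ (2 * k) * c) * L_power k c"

lemma skew_power_sum:
  "skew_power k \<asymp> - (\<Sum>p<k. sc ((- 1) ^ (k - p) * q ^ p) (L_power (k - p) (inverse q ^ (2 * p)) * elem p))"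
proof (induction k)
  case 0
  then show ?case by (simp add: skew_power_def)
next
  case (Suc k)
  let ?L = "L (inverse q ^ (2 * k))"
  let ?t = "\<lambda>k p. sc ((- 1) ^ (k - p) * q ^ p) (L_power (k - p) (inverse q ^ (2 * p)) * elem p)"
  have "skew_power (Suc k) \<asymp> ?L * (sc (q ^ k) (elem k) - skew_power k)" by (rule skew_power_Suc)
  also have "\<dots> \<asymp> ?L * (sc (q ^ k) (elem k) - (- (\<Sum>p<k. ?t k p)))"
    by (intro cong_lmult cong_diff Suc cong_refl)
  also have "\<dots> = sc (q ^ k) (?L * elem k) + (\<Sum>p<k. ?L * ?t k p)"
    by (simp add: distrib_left sum_distrib_left)
  also have "(\<Sum>p<k. ?L * ?t k p) = (\<Sum>p<k. - ?t (Suc k) p)"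
  proof (rule sum.cong)
    fix p assume "p \<in> {..<k}"
    then have p: "p < k" by simp
    have e: "2 * k = 2 * (k - p) + 2 * p" using p by simp
    have "inverse q ^ (2 * (k - p)) * inverse q ^ (2 * p) = inverse q ^ (2 * k)"
      by (simp only: e power_add)
    then show "?L * ?t k p = - ?t (Suc k) p" using p by (simp add: Suc_diff_le mult.assoc)
  qed simp
  also have "sc (q ^ k) (?L * elem k) = - ?t (Suc k) k" by simp
  finally show ?case by (simp add: sum_negf)
qed

text \<open>
  The expansion of \<open>P\<^sub>m\<^sub>+\<^sub>1 = 0\<close> with \<open>R\<^sub>1\<^sup>-\<^sup>1\<close> relates the last elementary symmetric element to
  \<open>skew_power m\<close>; the trace of \<open>P\<^sub>m\<^sub>+\<^sub>1 = 0\<close> over its last site determines the scalar between them.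
\<close>

lemma cayley_hamilton:
  assumes zero: "asym_at 0 (Suc m) = 0"
  shows "(\<Sum>p\<le>m. sc ((- q) ^ p) (L_power (m - p) (inverse q ^ (2 * p)) * elem p)) \<asymp> 0"
proof -
  have rel: "sc (inverse q ^ m) (elem m) \<asymp> sc (1 - qd * \<tau>) (skew_power m)"
  proof -
    let ?P = "asym_at 1 m" and ?W = "shift m (asym_at 0 m * asc_prod m)"
    let ?m = "sc (inverse q ^ m) 1 - sc (qnum q m) (S_inv 0)"
    have cyc: "traces 1 m (?P * x) = traces 1 m (x * ?P)" for x
      using cyclic_asym_at[of 1 1 m m] by (simp add: cyclic_def)
    have W: "?W * ?P \<asymp> ?W" using shift_cong[OF asym_asc_absorb, of m m] by (simp add: shift_mult shift_asym_at)
    have "0 = traces 1 m (?P * ?m * ?P * shift m (asc_prod m))"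
      using asym_at_first_inv[of m 0] zero traces_sc[of 1 m 0 0] by simp
    also have "\<dots> = traces 1 m (?P * (?m * ?W))" by (simp add: shift_mult shift_asym_at mult.assoc)
    also have "\<dots> = traces 1 m (?m * (?W * ?P))" by (simp only: cyc mult.assoc)
    also have "\<dots> \<asymp> traces 1 m (?m * ?W)" by (intro traces_cong cong_lmult W)
    also have "\<dots> = sc (inverse q ^ m) (traces 1 m ?W) - sc (qnum q m) (traces 1 m (S_inv 0 * ?W))"
      by (simp add: left_diff_distrib traces_diff traces_sc)
    also have "traces 1 m ?W = elem m"
      unfolding elem_def using desc_prod_triv asym_at_triv by (intro traces_shift triv_mult) auto
    also have "sc (qnum q m) (traces 1 m (S_inv 0 * ?W)) = sc (qnum q m) (sc (1 - qd * \<tau>) (traces 1 (m - 1) (asym_at 0 m * asc_prod m)))"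
    proof (cases m)
      case (Suc n)
      have "asym_at 0 m * asc_prod m \<in> triv (Suc n)" using desc_prod_triv asym_at_triv Suc by (simp add: triv_mult)
      then show ?thesis using traces_S_inv_shift by (simp add: Suc)
    qed simp
    also have "sc (inverse q ^ m) (elem m) - \<dots> \<asymp> sc (inverse q ^ m) (elem m) -
        sc (qnum q m) (sc (1 - qd * \<tau>) (traces 1 (m - 1) (desc_prod m * asym_at 0 m)))"
      by (intro cong_diff cong_refl cong_sc traces_cong asym_asc_desc)
    also have "\<dots> = sc (inverse q ^ m) (elem m) - sc (1 - qd * \<tau>) (skew_power m)"
      by (simp add: skew_power_def mult.commute)
    finally have "0 \<asymp> \<dots>" .
    from cong_sym[OF this] show ?thesis by (simp add: cong_J_def)
  qed
  have "skew_power m \<asymp> sc (q ^ m) (elem m)"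
  proof (cases "asym_at 0 m = 0")
    case True
    then show ?thesis by (simp add: skew_power_def elem_def traces_sc[of 0 m 0 0, simplified] traces_sc[of 1 "m - 1" 0 0, simplified])
  next
    case False
    have inv: "q ^ m * (inverse q ^ m * inverse q ^ m) = inverse q ^ m"
      using q_nonzero by (simp add: field_simps)
    have t: "1 - qd * \<tau> = inverse q ^ m * inverse q ^ m"
    proof (cases m)
      case 0
      then show ?thesis using zero False by (simp add: asym_at_def)
    next
      case (Suc n)
      let ?P = "asym_at 0 m"
      have "?P * (sc (q ^ m) 1 - sc (qnum q m) (S n)) * ?P = 0"
        using zero qnum_nonzero[of "n + 2"] by (simp add: asym_at_def Suc sc_eq_0)
      then have "0 = T m (?P * (sc (q ^ m) 1 - sc (qnum q m) (S n)) * ?P)"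
        using T_sc[of m 0 0] by simp
      also have "\<dots> = ?P * T m (sc (q ^ m) 1 - sc (qnum q m) (S n)) * ?P"
        by (simp only: T_rmult T_lmult asym_at_triv add_0 order_refl)
      also have "T m (sc (q ^ m) 1 - sc (qnum q m) (S n)) = sc (q ^ m * \<tau> - qnum q m) 1"
        by (simp add: T_diff T_sc T_one Suc T_S sc_diff_left)
      finally have "sc (q ^ m * \<tau> - qnum q m) ?P = 0" by simp
      then have "q ^ m * \<tau> = qnum q m" using False sc_eq_0 by (metis eq_iff_diff_eq_0)
      then have "q ^ m * (qd * \<tau>) = q ^ m - inverse q ^ m"
        using qdiff_nonzero by (simp add: qnum_def qd_def field_simps)
      then have "q ^ m * (1 - qd * \<tau>) = q ^ m * (inverse q ^ m * inverse q ^ m)"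
        unfolding inv by (simp add: algebra_simps)
      then show ?thesis using q_nonzero by simp
    qed
    have e: "inverse q ^ m * inverse q ^ m * q ^ m = inverse q ^ m"
      using inv by (simp add: mult_ac)
    have "sc (inverse q ^ m * inverse q ^ m) (sc (q ^ m) (elem m)) \<asymp> sc (inverse q ^ m * inverse q ^ m) (skew_power m)"
      using rel unfolding t sc_sc e .
    moreover have "inverse q ^ m * inverse q ^ m \<noteq> 0" using q_nonzero by simp
    ultimately show ?thesis by (metis cong_sc_cancel cong_sym)
  qed
  moreover note skew_power_sum[of m]
  ultimately have "sc (q ^ m) (elem m) \<asymp> - (\<Sum>p<m. sc ((- 1) ^ (m - p) * q ^ p) (L_power (m - p) (inverse q ^ (2 * p)) * elem p))"
    using cong_sym cong_trans by blast
  from cong_sc[OF this, of "(- 1) ^ m"]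
  have "sc ((- q) ^ m) (elem m) \<asymp> - (\<Sum>p<m. sc ((- 1) ^ m * ((- 1) ^ (m - p) * q ^ p)) (L_power (m - p) (inverse q ^ (2 * p)) * elem p))"
    by (simp add: power_minus[of q] sc_sum)
  also have "(\<Sum>p<m. sc ((- 1) ^ m * ((- 1) ^ (m - p) * q ^ p)) (L_power (m - p) (inverse q ^ (2 * p)) * elem p))
    = (\<Sum>p<m. sc ((- q) ^ p) (L_power (m - p) (inverse q ^ (2 * p)) * elem p))"
  proof (intro sum.cong refl)
    fix p assume "p \<in> {..<m}"
    then have m: "m = p + (m - p)" by simp
    have "(- 1 :: 'a) ^ m * (- 1) ^ (m - p) = (- 1) ^ p * ((- 1) ^ (m - p) * (- 1) ^ (m - p))"
      by (subst m) (simp add: power_add)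
    also have "(- 1 :: 'a) ^ (m - p) * (- 1) ^ (m - p) = 1" by (simp flip: power_mult_distrib)
    finally have "(- 1 :: 'a) ^ m * ((- 1) ^ (m - p) * q ^ p) = (- q) ^ p"
      by (simp add: power_minus[of q] mult.assoc)
    then show "sc ((- 1) ^ m * ((- 1) ^ (m - p) * q ^ p)) (L_power (m - p) (inverse q ^ (2 * p)) * elem p)
        = sc ((- q) ^ p) (L_power (m - p) (inverse q ^ (2 * p)) * elem p)" by simp
  qed
  finally show ?thesis by (simp add: lessThan_Suc_atMost[symmetric] cong_J_def add.commute)
qed

end

section \<open>Row-finite matrices and local operators\<close>

text \<open>
  The rows and columns will be indexed by the configurations \<open>nat \<Rightarrow> 'n\<close> of an infinite chain of sites.
  Operators that act at finitely many sites have finite rows, so that their products are finite sums.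
\<close>

typedef (overloaded) ('i, 'b) rfm = "{A :: 'i \<Rightarrow> 'i \<Rightarrow> 'b::zero. \<forall>x. finite {y. A x y \<noteq> 0}}"
  morphisms ent Rfm
  by (rule exI[of _ "\<lambda>_ _. 0"]) simp

setup_lifting type_definition_rfm

lemma finite_ent [simp]: "finite {y. ent A x y \<noteq> 0}" using ent[of A] by auto

lemma rfm_eqI: "(\<And>x y. ent A x y = ent B x y) \<Longrightarrow> A = B"
  by (metis ent_inject ext)

instantiation rfm :: (type, ring_1) ring_1
begin

lift_definition zero_rfm :: "('a, 'b) rfm" is "\<lambda>_ _. 0" by simp
lift_definition one_rfm :: "('a, 'b) rfm" is "\<lambda>x y. if x = y then 1 else 0" by simp
lift_definition plus_rfm :: "('a, 'b) rfm \<Rightarrow> ('a, 'b) rfm \<Rightarrow> ('a, 'b) rfm"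
  is "\<lambda>A B x y. A x y + B x y"
proof -
  fix A B :: "'a \<Rightarrow> 'a \<Rightarrow> 'b" and x
  assume "\<And>x. finite {y. A x y \<noteq> 0}" "\<And>x. finite {y. B x y \<noteq> 0}"
  then have "finite ({y. A x y \<noteq> 0} \<union> {y. B x y \<noteq> 0})" by blast
  then show "finite {y. A x y + B x y \<noteq> 0}" by (rule rev_finite_subset) auto
qed
lift_definition minus_rfm :: "('a, 'b) rfm \<Rightarrow> ('a, 'b) rfm \<Rightarrow> ('a, 'b) rfm"
  is "\<lambda>A B x y. A x y - B x y"
proof -
  fix A B :: "'a \<Rightarrow> 'a \<Rightarrow> 'b" and x
  assume "\<And>x. finite {y. A x y \<noteq> 0}" "\<And>x. finite {y. B x y \<noteq> 0}"
  then have "finite ({y. A x y \<noteq> 0} \<union> {y. B x y \<noteq> 0})" by blast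
  then show "finite {y. A x y - B x y \<noteq> 0}" by (rule rev_finite_subset) auto
qed
lift_definition uminus_rfm :: "('a, 'b) rfm \<Rightarrow> ('a, 'b) rfm" is "\<lambda>A x y. - A x y" by simp
lift_definition times_rfm :: "('a, 'b) rfm \<Rightarrow> ('a, 'b) rfm \<Rightarrow> ('a, 'b) rfm"
  is "\<lambda>A B x y. \<Sum>z | A x z \<noteq> 0. A x z * B z y"
proof -
  fix A B :: "'a \<Rightarrow> 'a \<Rightarrow> 'b" and x
  assume "\<And>x. finite {y. A x y \<noteq> 0}" "\<And>x. finite {y. B x y \<noteq> 0}"
  then have "finite (\<Union>z\<in>{z. A x z \<noteq> 0}. {y. B z y \<noteq> 0})" by blast
  moreover have "{y. (\<Sum>z | A x z \<noteq> 0. A x z * B z y) \<noteq> 0} \<subseteq> (\<Union>z\<in>{z. A x z \<noteq> 0}. {y. B z y \<noteq> 0})"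
  proof
    fix y assume "y \<in> {y. (\<Sum>z | A x z \<noteq> 0. A x z * B z y) \<noteq> 0}"
    then obtain z where "A x z \<noteq> 0" "A x z * B z y \<noteq> 0"
      using sum.not_neutral_contains_not_neutral by blast
    then show "y \<in> (\<Union>z\<in>{z. A x z \<noteq> 0}. {y. B z y \<noteq> 0})" by auto
  qed
  ultimately show "finite {y. (\<Sum>z | A x z \<noteq> 0. A x z * B z y) \<noteq> 0}" by (rule rev_finite_subset)
qed

lemma ent_mult_on:
  fixes A B :: "('a, 'b) rfm"
  assumes "finite F" "\<And>z. ent A x z \<noteq> 0 \<Longrightarrow> z \<in> F"
  shows "ent (A * B) x y = (\<Sum>z\<in>F. ent A x z * ent B z y)"
  unfolding times_rfm.rep_eq by (rule sum.mono_neutral_left) (use assms in auto)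

instance
proof
  fix A B C :: "('a, 'b) rfm"
  show "A * B * C = A * (B * C)"
  proof (rule rfm_eqI)
    fix x y
    let ?F = "{z. ent A x z \<noteq> 0}" and ?G = "\<Union>z\<in>{z. ent A x z \<noteq> 0}. {w. ent B z w \<noteq> 0}"
    have G: "finite ?G" by auto
    have sub: "w \<in> ?G" if "ent (A * B) x w \<noteq> 0" for w
    proof -
      have "(\<Sum>z\<in>?F. ent A x z * ent B z w) \<noteq> 0"
        using that by (simp add: times_rfm.rep_eq)
      then obtain z where "z \<in> ?F" "ent A x z * ent B z w \<noteq> 0"
        using sum.not_neutral_contains_not_neutral by blast
      then show ?thesis by auto
    qed
    have "ent (A * B * C) x y = (\<Sum>w\<in>?G. ent (A * B) x w * ent C w y)"
      by (rule ent_mult_on[OF G sub])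
    also have "\<dots> = (\<Sum>w\<in>?G. \<Sum>z\<in>?F. ent A x z * ent B z w * ent C w y)"
      by (simp add: times_rfm.rep_eq sum_distrib_right)
    also have "\<dots> = (\<Sum>z\<in>?F. \<Sum>w\<in>?G. ent A x z * ent B z w * ent C w y)" by (rule sum.swap)
    also have "\<dots> = (\<Sum>z\<in>?F. ent A x z * ent (B * C) z y)"
    proof (rule sum.cong)
      fix z assume "z \<in> ?F"
      then have "ent (B * C) z y = (\<Sum>w\<in>?G. ent B z w * ent C w y)" by (intro ent_mult_on G) auto
      then show "(\<Sum>w\<in>?G. ent A x z * ent B z w * ent C w y) = ent A x z * ent (B * C) z y"
        by (simp add: sum_distrib_left mult.assoc)
    qed simp
    finally show "ent (A * B * C) x y = ent (A * (B * C)) x y" by (simp add: times_rfm.rep_eq[of A])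
  qed
  show "1 * A = A"
    by (rule rfm_eqI) (subst ent_mult_on[of "{x}" for x], auto simp: one_rfm.rep_eq split: if_splits)
  show "A * 1 = A"
  proof (rule rfm_eqI)
    fix x y
    have "ent (A * 1) x y = (\<Sum>z\<in>insert y {z. ent A x z \<noteq> 0}. ent A x z * ent 1 z y)"
      by (rule ent_mult_on) auto
    also have "\<dots> = ent A x y"
      by (subst sum.remove[of _ y]) (auto simp: one_rfm.rep_eq intro!: sum.neutral)
    finally show "ent (A * 1) x y = ent A x y" .
  qed
  show "(A + B) * C = A * C + B * C"
  proof (rule rfm_eqI)
    fix x y
    let ?F = "{z. ent A x z \<noteq> 0} \<union> {z. ent B x z \<noteq> 0}"
    have "ent ((A + B) * C) x y = (\<Sum>z\<in>?F. ent (A + B) x z * ent C z y)"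
      by (rule ent_mult_on) (auto simp: plus_rfm.rep_eq)
    moreover have "ent (A * C) x y = (\<Sum>z\<in>?F. ent A x z * ent C z y)"
      by (rule ent_mult_on) auto
    moreover have "ent (B * C) x y = (\<Sum>z\<in>?F. ent B x z * ent C z y)"
      by (rule ent_mult_on) auto
    ultimately show "ent ((A + B) * C) x y = ent (A * C + B * C) x y"
      by (simp add: plus_rfm.rep_eq distrib_right sum.distrib)
  qed
  show "A * (B + C) = A * B + A * C"
    by (rule rfm_eqI) (simp add: plus_rfm.rep_eq times_rfm.rep_eq distrib_left sum.distrib)
  show "A + B + C = A + (B + C)" "A + B = B + A" "0 + A = A" "- A + A = 0" "A - B = A + - B"
    by (rule rfm_eqI; simp add: plus_rfm.rep_eq zero_rfm.rep_eq uminus_rfm.rep_eq minus_rfm.rep_eq)+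
  show "(0 :: ('a, 'b) rfm) \<noteq> 1"
    by (metis one_rfm.rep_eq zero_rfm.rep_eq zero_neq_one)
qed

end

lemmas ent_simps = plus_rfm.rep_eq minus_rfm.rep_eq uminus_rfm.rep_eq zero_rfm.rep_eq one_rfm.rep_eq

subsection \<open>Operators at one and two sites\<close>

type_synonym ('n, 'b) lop = "(nat \<Rightarrow> 'n, 'b) rfm"

definition put_pair :: "nat \<Rightarrow> (nat \<Rightarrow> 'n) \<Rightarrow> 'n \<times> 'n \<Rightarrow> nat \<Rightarrow> 'n" where
  "put_pair k x ab = x(k := fst ab, Suc k := snd ab)"

definition get_pair :: "nat \<Rightarrow> (nat \<Rightarrow> 'n) \<Rightarrow> 'n \<times> 'n" where "get_pair k x = (x k, x (Suc k))"

definition agree_off :: "nat \<Rightarrow> (nat \<Rightarrow> 'n) \<Rightarrow> (nat \<Rightarrow> 'n) \<Rightarrow> bool" where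
  "agree_off k x y \<longleftrightarrow> (\<forall>p. p \<noteq> k \<longrightarrow> x p = y p)"

definition agree_off2 :: "nat \<Rightarrow> (nat \<Rightarrow> 'n) \<Rightarrow> (nat \<Rightarrow> 'n) \<Rightarrow> bool" where
  "agree_off2 k x y \<longleftrightarrow> (\<forall>p. p \<noteq> k \<and> p \<noteq> Suc k \<longrightarrow> x p = y p)"

lemma agree_off_sym: "agree_off k x y \<longleftrightarrow> agree_off k y x" by (auto simp: agree_off_def)
lemma agree_off2_sym: "agree_off2 k x y \<longleftrightarrow> agree_off2 k y x" by (auto simp: agree_off2_def)
lemma agree_off_upd [simp]: "agree_off k (x(k := a)) y = agree_off k x y" "agree_off k x (y(k := a)) = agree_off k x y"
  by (auto simp: agree_off_def)
lemma agree_off2_upd [simp]: "agree_off2 k (put_pair k x ab) y = agree_off2 k x y" "agree_off2 k x (put_pair k y ab) = agree_off2 k x y"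
  by (auto simp: agree_off2_def put_pair_def)
lemma agree_off_refl [simp]: "agree_off k x x" "agree_off2 k x x" by (auto simp: agree_off_def agree_off2_def)

lemma agree_off_range: "agree_off k x y \<longleftrightarrow> y \<in> range (\<lambda>a. x(k := a))"
proof
  assume "agree_off k x y"
  then have "y = x(k := y k)" by (auto simp: agree_off_def)
  then show "y \<in> range (\<lambda>a. x(k := a))" by blast
qed (auto simp: agree_off_def)

lemma agree_off2_range: "agree_off2 k x y \<longleftrightarrow> y \<in> range (put_pair k x)"
proof
  assume "agree_off2 k x y"
  then have "y = put_pair k x (y k, y (Suc k))" by (auto simp: put_pair_def agree_off2_def)
  then show "y \<in> range (put_pair k x)" by blast
qed (auto simp: put_pair_def agree_off2_def)

lift_definition op1 :: "('n::finite, 'b::zero) op1 \<Rightarrow> nat \<Rightarrow> ('n, 'b) lop" is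
  "\<lambda>M k x y. if agree_off k x y then M $ x k $ y k else 0"
proof -
  fix M :: "('n::finite, 'b::zero) op1" and k and x :: "nat \<Rightarrow> 'n"
  show "finite {y. (if agree_off k x y then M $ x k $ y k else 0) \<noteq> 0}"
    by (rule finite_subset[of _ "range (\<lambda>a. x(k := a))"]) (auto simp: agree_off_range split: if_splits)
qed

lift_definition op2 :: "('n::finite, 'b::zero) op2 \<Rightarrow> nat \<Rightarrow> ('n, 'b) lop" is
  "\<lambda>M k x y. if agree_off2 k x y then M $ get_pair k x $ get_pair k y else 0"
proof -
  fix M :: "('n::finite, 'b::zero) op2" and k and x :: "nat \<Rightarrow> 'n"
  show "finite {y. (if agree_off2 k x y then M $ get_pair k x $ get_pair k y else 0) \<noteq> 0}"
    by (rule finite_subset[of _ "range (put_pair k x)"]) (auto simp: agree_off2_range split: if_splits)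
qed

lemma op1_upd_r: "ent (op1 M k) x (x(k := a)) = M $ x k $ a" by (simp add: op1.rep_eq)
lemma op1_upd_l: "ent (op1 M k) (y(k := a)) y = M $ a $ y k" by (simp add: op1.rep_eq)
lemma get_put_pair [simp]: "get_pair k (put_pair k x ab) = ab" by (simp add: get_pair_def put_pair_def)
lemma op2_upd_r: "ent (op2 M k) x (put_pair k x ab) = M $ get_pair k x $ ab"
  by (simp add: op2.rep_eq)
lemma op2_upd_l: "ent (op2 M k) (put_pair k y ab) y = M $ ab $ get_pair k y"
  by (simp add: op2.rep_eq)

lemma inj_upd: "inj (\<lambda>a. x(k := a))" by (metis fun_upd_same injI)
lemma inj_put_pair: "inj (put_pair k x)" by (metis injI get_put_pair)

lemma op1_mult:
  fixes A :: "('n::finite, 'b::ring_1) lop"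
  shows "ent (op1 M k * A) x y = (\<Sum>a\<in>UNIV. M $ x k $ a * ent A (x(k := a)) y)"
proof -
  have "ent (op1 M k * A) x y = (\<Sum>z\<in>range (\<lambda>a. x(k := a)). ent (op1 M k) x z * ent A z y)"
    by (rule ent_mult_on) (auto simp: op1.rep_eq agree_off_range split: if_splits)
  then show ?thesis by (simp add: sum.reindex inj_upd op1_upd_r)
qed

lemma op2_mult:
  fixes A :: "('n::finite, 'b::ring_1) lop"
  shows "ent (op2 M k * A) x y = (\<Sum>ab\<in>UNIV. M $ get_pair k x $ ab * ent A (put_pair k x ab) y)"
proof -
  have "ent (op2 M k * A) x y = (\<Sum>z\<in>range (put_pair k x). ent (op2 M k) x z * ent A z y)"
    by (rule ent_mult_on) (auto simp: op2.rep_eq agree_off2_range split: if_splits)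
  then show ?thesis by (simp add: sum.reindex inj_put_pair op2_upd_r)
qed

text \<open>The columns of the right factor may be finite instead of the rows of the left one.\<close>

lemma ent_mult_right_on:
  fixes A B :: "('i, 'b::ring_1) rfm"
  assumes "finite F" "\<And>z. ent B z y \<noteq> 0 \<Longrightarrow> z \<in> F"
  shows "ent (A * B) x y = (\<Sum>z\<in>F. ent A x z * ent B z y)"
proof -
  have "ent (A * B) x y = (\<Sum>z\<in>F \<union> {z. ent A x z \<noteq> 0}. ent A x z * ent B z y)"
    by (rule ent_mult_on) (use assms in auto)
  also have "\<dots> = (\<Sum>z\<in>F. ent A x z * ent B z y)"
  proof (rule sum.mono_neutral_right)
    have "ent B z y = 0" if "z \<notin> F" for z using assms(2) that by blast
    then show "\<forall>z\<in>F \<union> {z. ent A x z \<noteq> 0} - F. ent A x z * ent B z y = 0" by simp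
  qed (use assms in auto)
  finally show ?thesis .
qed

lemma mult_op1:
  fixes A :: "('n::finite, 'b::ring_1) lop"
  shows "ent (A * op1 M k) x y = (\<Sum>a\<in>UNIV. ent A x (y(k := a)) * M $ a $ y k)"
proof -
  have "z \<in> range (\<lambda>a. y(k := a))" if "ent (op1 M k) z y \<noteq> 0" for z
    using that agree_off_range[of k y z] by (auto simp: op1.rep_eq agree_off_sym[of k z] split: if_splits)
  then have "ent (A * op1 M k) x y = (\<Sum>z\<in>range (\<lambda>a. y(k := a)). ent A x z * ent (op1 M k) z y)"
    by (intro ent_mult_right_on) auto
  then show ?thesis by (simp add: sum.reindex inj_upd op1_upd_l)
qed

lemma mult_op2:
  fixes A :: "('n::finite, 'b::ring_1) lop"
  shows "ent (A * op2 M k) x y = (\<Sum>ab\<in>UNIV. ent A x (put_pair k y ab) * M $ ab $ get_pair k y)"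
proof -
  have "z \<in> range (put_pair k y)" if "ent (op2 M k) z y \<noteq> 0" for z
    using that agree_off2_range[of k y z] by (auto simp: op2.rep_eq agree_off2_sym[of k z] split: if_splits)
  then have "ent (A * op2 M k) x y = (\<Sum>z\<in>range (put_pair k y). ent A x z * ent (op2 M k) z y)"
    by (intro ent_mult_right_on) auto
  then show ?thesis by (simp add: sum.reindex inj_put_pair op2_upd_l)
qed

lemma op1_hom: "op1 (M ** N) k = op1 M k * (op1 N k :: ('n::finite, 'b::ring_1) lop)"
  by (rule rfm_eqI) (simp add: op1_mult op1.rep_eq matrix_matrix_mult_def)

lemma op2_hom: "op2 (M ** N) k = op2 M k * (op2 N k :: ('n::finite, 'b::ring_1) lop)"
  by (rule rfm_eqI) (simp add: op2_mult op2.rep_eq matrix_matrix_mult_def)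

lemma op1_add: "op1 (M + N) k = op1 M k + (op1 N k :: ('n::finite, 'b::ring_1) lop)"
  by (rule rfm_eqI) (simp add: op1.rep_eq ent_simps)
lemma op2_diff: "op2 (M - N) k = op2 M k - (op2 N k :: ('n::finite, 'b::ring_1) lop)"
  by (rule rfm_eqI) (simp add: op2.rep_eq ent_simps)
lemma op2_add: "op2 (M + N) k = op2 M k + (op2 N k :: ('n::finite, 'b::ring_1) lop)"
  by (rule rfm_eqI) (simp add: op2.rep_eq ent_simps)

lift_definition diag :: "'b::zero \<Rightarrow> ('i, 'b) rfm" is "\<lambda>c x y. if x = y then c else 0" by simp

lemma op1_mat: "op1 (mat c) k = (diag c :: ('n::finite, 'b::ring_1) lop)"
  by (rule rfm_eqI) (auto simp: op1.rep_eq diag.rep_eq mat_def agree_off_def fun_eq_iff)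
lemma op2_mat: "op2 (mat c) k = (diag c :: ('n::finite, 'b::ring_1) lop)"
  by (rule rfm_eqI) (auto simp: op2.rep_eq diag.rep_eq mat_def get_pair_def agree_off2_def fun_eq_iff)

subsection \<open>Operators trivial at a site\<close>

definition triv_at :: "nat \<Rightarrow> ('n, 'b::zero) lop set" where
  "triv_at k = {A. (\<forall>x y. x k \<noteq> y k \<longrightarrow> ent A x y = 0) \<and>
     (\<forall>x y c. x k = y k \<longrightarrow> ent A (x(k := c)) (y(k := c)) = ent A x y)}"

lemma triv_at_zero: "A \<in> triv_at k \<Longrightarrow> x k \<noteq> y k \<Longrightarrow> ent A x y = 0" by (simp add: triv_at_def)
lemma triv_at_upd: "A \<in> triv_at k \<Longrightarrow> x k = y k \<Longrightarrow> ent A (x(k := c)) (y(k := c)) = ent A x y"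
  by (simp add: triv_at_def)

lemma triv_at_upd': "A \<in> triv_at k \<Longrightarrow> ent A (x(k := c)) (y(k := c)) = ent A x (y(k := x k))"
  using triv_at_upd[of A k x "y(k := x k)" c] by simp

lemma triv_at_one: "(1 :: ('n, 'b::ring_1) lop) \<in> triv_at k"
proof -
  have "x = y" if "x(k := c) = y(k := c)" "x k = y k" for x y :: "nat \<Rightarrow> 'n" and c
    using that by (metis fun_upd_triv fun_upd_upd)
  then show ?thesis by (auto simp: triv_at_def ent_simps)
qed

lemma triv_at_add: "A \<in> triv_at k \<Longrightarrow> B \<in> triv_at k \<Longrightarrow> A + (B :: ('n, 'b::ring_1) lop) \<in> triv_at k"
  by (auto simp: triv_at_def ent_simps)

text \<open>Row sums of an operator trivial at \<open>k\<close> may be taken over the row with site \<open>k\<close> changed.\<close>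

lemma triv_at_row_sum:
  fixes A :: "('n, 'b::ring_1) lop"
  assumes A: "A \<in> triv_at k"
  shows "(\<Sum>z | ent A (x(k := c)) z \<noteq> 0. ent A (x(k := c)) z * f z) =
    (\<Sum>z | ent A x z \<noteq> 0. ent A x z * f (z(k := c)))"
proof (rule sum.reindex_bij_witness[where i = "\<lambda>z. z(k := c)" and j = "\<lambda>z. z(k := x k)"])
  fix z assume "z \<in> {z. ent A (x(k := c)) z \<noteq> 0}"
  then have nz: "ent A (x(k := c)) z \<noteq> 0" by simp
  then have c: "z k = c" using triv_at_zero[OF A, of "x(k := c)" z] by auto
  then show "z(k := x k, k := c) = z" by auto
  have "ent A (x(k := c)) z = ent A x (z(k := x k))"
    using triv_at_upd'[OF A, of x c z] c by auto
  then show "z(k := x k) \<in> {z. ent A x z \<noteq> 0}"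
    "ent A x (z(k := x k)) * f (z(k := x k, k := c)) = ent A (x(k := c)) z * f z"
    using nz c by auto
next
  fix z assume "z \<in> {z. ent A x z \<noteq> 0}"
  then have nz: "ent A x z \<noteq> 0" by simp
  then have c: "z k = x k" using triv_at_zero[OF A, of x z] by metis
  then show "z(k := c, k := x k) = z" by auto
  show "z(k := c) \<in> {z. ent A (x(k := c)) z \<noteq> 0}" using triv_at_upd[OF A, of x z c] c nz by simp
qed

lemma triv_at_mult:
  fixes A B :: "('n, 'b::ring_1) lop"
  assumes A: "A \<in> triv_at k" and B: "B \<in> triv_at k"
  shows "A * B \<in> triv_at k"
  unfolding triv_at_def
proof (intro CollectI conjI allI impI)
  fix x y :: "nat \<Rightarrow> 'n" assume "x k \<noteq> y k"
  then show "ent (A * B) x y = 0"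
    unfolding times_rfm.rep_eq
    using triv_at_zero[OF A, of x] triv_at_zero[OF B, of _ y]
    by (intro sum.neutral) (metis (mono_tags, lifting) mem_Collect_eq mult_zero_right)
next
  fix x y :: "nat \<Rightarrow> 'n" and c assume xy: "x k = y k"
  have "ent (A * B) (x(k := c)) (y(k := c)) = (\<Sum>z | ent A x z \<noteq> 0. ent A x z * ent B (z(k := c)) (y(k := c)))"
    unfolding times_rfm.rep_eq by (rule triv_at_row_sum[OF A])
  also have "\<dots> = (\<Sum>z | ent A x z \<noteq> 0. ent A x z * ent B z y)"
  proof (rule sum.cong)
    fix z assume "z \<in> {z. ent A x z \<noteq> 0}"
    then have "z k = y k" using triv_at_zero[OF A, of x z] xy by (metis mem_Collect_eq)
    then show "ent A x z * ent B (z(k := c)) (y(k := c)) = ent A x z * ent B z y"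
      using triv_at_upd[OF B] by simp
  qed simp
  finally show "ent (A * B) (x(k := c)) (y(k := c)) = ent (A * B) x y" by (simp add: times_rfm.rep_eq)
qed

lemma op1_triv: "j \<noteq> k \<Longrightarrow> op1 M k \<in> triv_at j"
  by (auto simp: triv_at_def op1.rep_eq agree_off_def)

lemma op2_triv: "j \<noteq> k \<Longrightarrow> j \<noteq> Suc k \<Longrightarrow> op2 M k \<in> triv_at j"
  by (auto simp: triv_at_def op2.rep_eq get_pair_def agree_off2_def)

definition centr :: "'b::ring_1 \<Rightarrow> bool" where "centr c \<longleftrightarrow> (\<forall>x. c * x = x * c)"

lemma centr_left: "centr c \<Longrightarrow> c * (x * y) = x * (c * y)"
  unfolding centr_def by (metis mult.assoc)

lemma op2_comm:
  fixes A :: "('n::finite, 'b::ring_1) lop"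
  assumes "A \<in> triv_at k" "A \<in> triv_at (Suc k)" and M: "\<And>i j. centr (M $ i $ j)"
  shows "op2 M k * A = A * op2 M k"
proof (rule rfm_eqI)
  fix x y :: "nat \<Rightarrow> 'n"
  have 1: "ent A (put_pair k x ab) y = (if ab = get_pair k y then ent A (put_pair k x (get_pair k y)) y else 0)" for ab
    using triv_at_zero[OF assms(1), of "put_pair k x ab" y] triv_at_zero[OF assms(2), of "put_pair k x ab" y]
    by (cases ab) (auto simp: put_pair_def get_pair_def)
  have 2: "ent A x (put_pair k y ab) = (if ab = get_pair k x then ent A x (put_pair k y (get_pair k x)) else 0)" for ab
    using triv_at_zero[OF assms(1), of x "put_pair k y ab"] triv_at_zero[OF assms(2), of x "put_pair k y ab"]
    by (cases ab) (auto simp: put_pair_def get_pair_def)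
  have 3: "ent A (put_pair k x (get_pair k y)) y = ent A x (put_pair k y (get_pair k x))"
  proof -
    have "y = put_pair k y (get_pair k y)" by (auto simp: put_pair_def get_pair_def)
    then have "ent A (put_pair k x (get_pair k y)) y = ent A (put_pair k x (get_pair k y)) (put_pair k y (get_pair k y))" by simp
    also have "\<dots> = ent A (x(k := y k)) ((y(k := y k))(Suc k := x (Suc k)))"
      unfolding put_pair_def get_pair_def by (simp add: triv_at_upd'[OF assms(2)] del: fun_upd_triv)
    also have "\<dots> = ent A (x(k := y k)) ((y(Suc k := x (Suc k)))(k := y k))"
      by (simp add: fun_upd_twist)
    also have "\<dots> = ent A x (y(Suc k := x (Suc k), k := x k))"
      by (simp only: triv_at_upd'[OF assms(1)])
    also have "y(Suc k := x (Suc k), k := x k) = put_pair k y (get_pair k x)"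
      by (auto simp: put_pair_def get_pair_def)
    finally show ?thesis .
  qed
  have "ent (op2 M k * A) x y = M $ get_pair k x $ get_pair k y * ent A (put_pair k x (get_pair k y)) y"
    unfolding op2_mult by (subst 1) (simp add: if_distrib cong: if_cong)
  also have "\<dots> = ent A x (put_pair k y (get_pair k x)) * M $ get_pair k x $ get_pair k y"
    using M by (simp add: 3 centr_def)
  also have "\<dots> = ent (A * op2 M k) x y"
    unfolding mult_op2 by (subst 2) (simp add: if_distrib if_distribR cong: if_cong)
  finally show "ent (op2 M k * A) x y = ent (A * op2 M k) x y" .
qed

subsection \<open>Weighted partial traces\<close>

text \<open>
  The trace over site \<open>k\<close> of the product with \<open>M\<close> at this site, extended by the identity at \<open>k\<close>.
\<close>

lift_definition ptrace :: "('n::finite, 'b::ring_1) op1 \<Rightarrow> nat \<Rightarrow> ('n, 'b) lop \<Rightarrow> ('n, 'b) lop" is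
  "\<lambda>M k A x y. if x k = y k then \<Sum>a\<in>UNIV. \<Sum>b\<in>UNIV. M $ a $ b * A (x(k := b)) (y(k := a)) else 0"
proof -
  fix M :: "('n, 'b) op1" and k and A :: "(nat \<Rightarrow> 'n) \<Rightarrow> (nat \<Rightarrow> 'n) \<Rightarrow> 'b" and x :: "nat \<Rightarrow> 'n"
  assume "\<And>x. finite {y. A x y \<noteq> 0}"
  then have "finite ((\<lambda>y. y(k := x k)) ` (\<Union>b. {y. A (x(k := b)) y \<noteq> 0}))" by simp
  moreover have "{y. (if x k = y k then \<Sum>a\<in>UNIV. \<Sum>b\<in>UNIV. M $ a $ b * A (x(k := b)) (y(k := a)) else 0) \<noteq> 0}
    \<subseteq> (\<lambda>y. y(k := x k)) ` (\<Union>b. {y. A (x(k := b)) y \<noteq> 0})"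
  proof
    fix y assume "y \<in> {y. (if x k = y k then \<Sum>a\<in>UNIV. \<Sum>b\<in>UNIV. M $ a $ b * A (x(k := b)) (y(k := a)) else 0) \<noteq> 0}"
    then have y: "x k = y k" "(\<Sum>a\<in>UNIV. \<Sum>b\<in>UNIV. M $ a $ b * A (x(k := b)) (y(k := a))) \<noteq> 0"
      by (auto split: if_splits)
    then obtain a where "(\<Sum>b\<in>UNIV. M $ a $ b * A (x(k := b)) (y(k := a))) \<noteq> 0"
      using sum.not_neutral_contains_not_neutral by blast
    then obtain b where "M $ a $ b * A (x(k := b)) (y(k := a)) \<noteq> 0"
      using sum.not_neutral_contains_not_neutral by blast
    then have "A (x(k := b)) (y(k := a)) \<noteq> 0" by auto
    then show "y \<in> (\<lambda>y. y(k := x k)) ` (\<Union>b. {y. A (x(k := b)) y \<noteq> 0})"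
      by (intro image_eqI[of _ _ "y(k := a)"]) (use y in auto)
  qed
  ultimately show "finite {y. (if x k = y k then \<Sum>a\<in>UNIV. \<Sum>b\<in>UNIV. M $ a $ b * A (x(k := b)) (y(k := a)) else 0) \<noteq> 0}"
    by (rule rev_finite_subset)
qed

lemma ptrace_triv: "ptrace M k A \<in> triv_at k"
  by (auto simp: triv_at_def ptrace.rep_eq)

lemma ptrace_add: "ptrace M k (A + B) = ptrace M k A + ptrace M k B"
  by (rule rfm_eqI) (simp add: ptrace.rep_eq ent_simps distrib_left sum.distrib)

lemma ptrace_lmult:
  assumes A: "A \<in> triv_at k" and M: "\<And>i j. centr (M $ i $ j)"
  shows "ptrace M k (A * X) = A * ptrace M k X"
proof (rule rfm_eqI)
  fix x y :: "nat \<Rightarrow> 'a"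
  let ?F = "{z. ent A x z \<noteq> 0}"
  have zk: "z k = x k" if "z \<in> ?F" for z using that triv_at_zero[OF A, of x z] by (metis mem_Collect_eq)
  show "ent (ptrace M k (A * X)) x y = ent (A * ptrace M k X) x y"
  proof (cases "x k = y k")
    case True
    have "ent (ptrace M k (A * X)) x y =
        (\<Sum>a\<in>UNIV. \<Sum>b\<in>UNIV. \<Sum>z\<in>?F. M $ a $ b * (ent A x z * ent X (z(k := b)) (y(k := a))))"
      using True by (simp add: ptrace.rep_eq times_rfm.rep_eq triv_at_row_sum[OF A] sum_distrib_left)
    also have "\<dots> = (\<Sum>a\<in>UNIV. \<Sum>b\<in>UNIV. \<Sum>z\<in>?F. ent A x z * (M $ a $ b * ent X (z(k := b)) (y(k := a))))"
      by (simp only: centr_left[OF M])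
    also have "\<dots> = (\<Sum>a\<in>UNIV. \<Sum>z\<in>?F. \<Sum>b\<in>UNIV. ent A x z * (M $ a $ b * ent X (z(k := b)) (y(k := a))))"
      by (intro sum.cong refl sum.swap)
    also have "\<dots> = (\<Sum>z\<in>?F. \<Sum>a\<in>UNIV. \<Sum>b\<in>UNIV. ent A x z * (M $ a $ b * ent X (z(k := b)) (y(k := a))))"
      by (rule sum.swap)
    also have "\<dots> = (\<Sum>z\<in>?F. ent A x z * ent (ptrace M k X) z y)"
      by (rule sum.cong) (use zk True in \<open>auto simp: ptrace.rep_eq sum_distrib_left\<close>)
    finally show ?thesis by (simp add: times_rfm.rep_eq)
  next
    case False
    have "ent (A * ptrace M k X) x y = 0"
      unfolding times_rfm.rep_eq by (rule sum.neutral) (use zk False in \<open>auto simp: ptrace.rep_eq\<close>)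
    then show ?thesis using False by (simp add: ptrace.rep_eq)
  qed
qed

lemma ptrace_rmult:
  assumes B: "B \<in> triv_at k"
  shows "ptrace M k (X * B) = ptrace M k X * B"
proof (rule rfm_eqI)
  fix x y :: "nat \<Rightarrow> 'a"
  let ?G = "\<Union>b. {z. ent X (x(k := b)) z \<noteq> 0}"
  let ?F = "(\<lambda>z. z(k := x k)) ` ?G"
  have F: "finite ?F" by simp
  have sub: "z \<in> ?F" if "ent (ptrace M k X) x z \<noteq> 0" for z
  proof -
    have z: "x k = z k" "(\<Sum>a\<in>UNIV. \<Sum>b\<in>UNIV. M $ a $ b * ent X (x(k := b)) (z(k := a))) \<noteq> 0"
      using that by (auto simp: ptrace.rep_eq split: if_splits)
    then obtain a b where "M $ a $ b * ent X (x(k := b)) (z(k := a)) \<noteq> 0"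
      by (meson sum.not_neutral_contains_not_neutral)
    then have "ent X (x(k := b)) (z(k := a)) \<noteq> 0" by (metis mult_zero_right)
    then show ?thesis by (intro image_eqI[of _ _ "z(k := a)"]) (use z in auto)
  qed
  have inj: "inj_on (\<lambda>z. z(k := a)) ?F" for a
    by (rule inj_on_inverseI[where g = "\<lambda>z. z(k := x k)"]) auto
  have row: "ent (X * B) (x(k := b)) (y(k := a)) = (\<Sum>z\<in>?F. ent X (x(k := b)) (z(k := a)) * ent B z y)"
    if xy: "x k = y k" for a b
  proof -
    have "ent (X * B) (x(k := b)) (y(k := a)) =
        (\<Sum>z\<in>?G. ent X (x(k := b)) z * ent B z (y(k := a)))"
      by (rule ent_mult_on) auto
    also have "\<dots> = (\<Sum>z\<in>?G \<union> (\<lambda>z. z(k := a)) ` ?F. ent X (x(k := b)) z * ent B z (y(k := a)))"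
      by (rule sum.mono_neutral_left) auto
    also have "\<dots> = (\<Sum>z\<in>(\<lambda>z. z(k := a)) ` ?F. ent X (x(k := b)) z * ent B z (y(k := a)))"
    proof (rule sum.mono_neutral_right)
      show "\<forall>z\<in>(?G \<union> (\<lambda>z. z(k := a)) ` ?F) - (\<lambda>z. z(k := a)) ` ?F.
          ent X (x(k := b)) z * ent B z (y(k := a)) = 0"
      proof
        fix z assume z: "z \<in> (?G \<union> (\<lambda>z. z(k := a)) ` ?F) - (\<lambda>z. z(k := a)) ` ?F"
        have "z k \<noteq> a"
        proof
          assume "z k = a"
          then have "z = (z(k := x k))(k := a)" by auto
          then show False using z by blast
        qed
        then show "ent X (x(k := b)) z * ent B z (y(k := a)) = 0"
          using triv_at_zero[OF B, of z "y(k := a)"] by simp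
      qed
    qed auto
    also have "\<dots> = (\<Sum>z\<in>?F. ent X (x(k := b)) (z(k := a)) * ent B (z(k := a)) (y(k := a)))"
      by (simp add: sum.reindex[OF inj] o_def)
    also have "\<dots> = (\<Sum>z\<in>?F. ent X (x(k := b)) (z(k := a)) * ent B z y)"
    proof (rule sum.cong)
      fix z assume "z \<in> ?F"
      then have "z k = y k" using xy by auto
      then show "ent X (x(k := b)) (z(k := a)) * ent B (z(k := a)) (y(k := a)) =
          ent X (x(k := b)) (z(k := a)) * ent B z y"
        using triv_at_upd[OF B] by simp
    qed simp
    finally show ?thesis .
  qed
  show "ent (ptrace M k (X * B)) x y = ent (ptrace M k X * B) x y"
  proof (cases "x k = y k")
    case True
    have "ent (ptrace M k (X * B)) x y =
        (\<Sum>a\<in>UNIV. \<Sum>b\<in>UNIV. \<Sum>z\<in>?F. M $ a $ b * (ent X (x(k := b)) (z(k := a)) * ent B z y))"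
      using True by (simp add: ptrace.rep_eq row sum_distrib_left)
    also have "\<dots> = (\<Sum>a\<in>UNIV. \<Sum>z\<in>?F. \<Sum>b\<in>UNIV. M $ a $ b * (ent X (x(k := b)) (z(k := a)) * ent B z y))"
      by (intro sum.cong refl sum.swap)
    also have "\<dots> = (\<Sum>z\<in>?F. \<Sum>a\<in>UNIV. \<Sum>b\<in>UNIV. M $ a $ b * (ent X (x(k := b)) (z(k := a)) * ent B z y))"
      by (rule sum.swap)
    also have "\<dots> = (\<Sum>z\<in>?F. ent (ptrace M k X) x z * ent B z y)"
      by (rule sum.cong) (auto simp: ptrace.rep_eq sum_distrib_right mult.assoc)
    also have "\<dots> = ent (ptrace M k X * B) x y" by (rule ent_mult_on[symmetric, OF F sub])
    finally show ?thesis .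
  next
    case False
    have "ent (ptrace M k X * B) x y = (\<Sum>z\<in>?F. ent (ptrace M k X) x z * ent B z y)"
      by (rule ent_mult_on[OF F sub])
    also have "\<dots> = 0"
      by (rule sum.neutral) (use triv_at_zero[OF B, of _ y] False in auto)
    finally show ?thesis using False by (simp add: ptrace.rep_eq)
  qed
qed

lemma ptrace_swap:
  assumes "j \<noteq> k" and M: "\<And>i j. centr (M $ i $ j)"
  shows "ptrace M j (ptrace N k A) = ptrace N k (ptrace M j A)"
proof (rule rfm_eqI)
  fix x y :: "nat \<Rightarrow> 'a"
  have tw: "z(j := b, k := d) = z(k := d, j := b)" for z :: "nat \<Rightarrow> 'a" and b d
    using assms(1) by (rule fun_upd_twist)
  have "(\<Sum>a\<in>UNIV. \<Sum>b\<in>UNIV. M $ a $ b * (\<Sum>c\<in>UNIV. \<Sum>d\<in>UNIV. N $ c $ d * ent A (x(j := b, k := d)) (y(j := a, k := c))))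
    = (\<Sum>(a, b)\<in>UNIV \<times> UNIV. \<Sum>(c, d)\<in>UNIV \<times> UNIV. M $ a $ b * (N $ c $ d * ent A (x(j := b, k := d)) (y(j := a, k := c))))"
    by (simp only: sum.cartesian_product[symmetric] sum_distrib_left)
  also have "\<dots> = (\<Sum>(c, d)\<in>UNIV \<times> UNIV. \<Sum>(a, b)\<in>UNIV \<times> UNIV. M $ a $ b * (N $ c $ d * ent A (x(j := b, k := d)) (y(j := a, k := c))))"
    unfolding split_def by (rule sum.swap)
  also have "\<dots> = (\<Sum>(c, d)\<in>UNIV \<times> UNIV. \<Sum>(a, b)\<in>UNIV \<times> UNIV. N $ c $ d * (M $ a $ b * ent A (x(k := d, j := b)) (y(k := c, j := a))))"
    by (simp only: tw centr_left[OF M])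
  also have "\<dots> = (\<Sum>c\<in>UNIV. \<Sum>d\<in>UNIV. N $ c $ d * (\<Sum>a\<in>UNIV. \<Sum>b\<in>UNIV. M $ a $ b * ent A (x(k := d, j := b)) (y(k := c, j := a))))"
    by (simp only: sum.cartesian_product[symmetric] sum_distrib_left)
  finally show "ent (ptrace M j (ptrace N k A)) x y = ent (ptrace N k (ptrace M j A)) x y"
    using assms(1) by (simp add: ptrace.rep_eq)
qed

abbreviation ptrace0 :: "nat \<Rightarrow> ('n::finite, 'b::ring_1) lop \<Rightarrow> ('n, 'b) lop" where
  "ptrace0 \<equiv> ptrace (mat 1)"

lemma centr_mat: "centr ((mat 1 :: ('n::finite, 'b::ring_1) op1) $ i $ j)"
  by (simp add: mat_def centr_def)

lemma ptrace0_ent: "ent (ptrace0 k A) x y = (if x k = y k then \<Sum>a\<in>UNIV. ent A (x(k := a)) (y(k := a)) else 0)"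
  by (simp add: ptrace.rep_eq mat_def mult_delta_left)

lemma ptrace_ptrace0: "ptrace M k A = ptrace0 k (op1 M k * A)"
  by (rule rfm_eqI) (simp add: ptrace0_ent op1_mult, simp add: ptrace.rep_eq)

lemma ptrace0_cyc:
  assumes M: "\<And>i j. centr (M $ i $ j)"
  shows "ptrace0 k (ptrace0 (Suc k) (op2 M k * A)) = ptrace0 k (ptrace0 (Suc k) (A * op2 M k))"
proof (rule rfm_eqI)
  fix x y :: "nat \<Rightarrow> 'a"
  have e: "ent (ptrace0 k (ptrace0 (Suc k) B)) x y =
     (if get_pair k x = get_pair k y then \<Sum>ab\<in>UNIV. ent B (put_pair k x ab) (put_pair k y ab) else 0)" for B :: "('a, 'b) lop"
    by (auto simp: ptrace0_ent get_pair_def put_pair_def UNIV_Times_UNIV[symmetric] sum.cartesian_product split_def simp del: UNIV_Times_UNIV)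
  have u: "put_pair k (put_pair k z ab) cd = put_pair k z cd" for z :: "nat \<Rightarrow> 'a" and ab cd
    by (auto simp: put_pair_def)
  have "(\<Sum>ab\<in>UNIV. ent (op2 M k * A) (put_pair k x ab) (put_pair k y ab)) =
    (\<Sum>ab\<in>UNIV. \<Sum>cd\<in>UNIV. M $ ab $ cd * ent A (put_pair k x cd) (put_pair k y ab))"
    by (simp add: op2_mult u)
  also have "\<dots> = (\<Sum>cd\<in>UNIV. \<Sum>ab\<in>UNIV. M $ ab $ cd * ent A (put_pair k x cd) (put_pair k y ab))"
    by (rule sum.swap)
  also have "\<dots> = (\<Sum>ab\<in>UNIV. ent (A * op2 M k) (put_pair k x ab) (put_pair k y ab))"
    using M by (simp add: mult_op2 u centr_def)
  finally show "ent (ptrace0 k (ptrace0 (Suc k) (op2 M k * A))) x y = ent (ptrace0 k (ptrace0 (Suc k) (A * op2 M k))) x y"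
    by (simp add: e)
qed

subsection \<open>Tensor operators as local operators\<close>

definition window :: "nat \<Rightarrow> nat \<Rightarrow> (nat \<Rightarrow> 'n) \<Rightarrow> 'n list" where
  "window s n x = map x [s..<s + n]"

definition place :: "nat \<Rightarrow> (nat \<Rightarrow> 'n) \<Rightarrow> 'n list \<Rightarrow> nat \<Rightarrow> 'n" where
  "place s x w = (\<lambda>p. if s \<le> p \<and> p < s + length w then w ! (p - s) else x p)"

definition agree_outside :: "nat \<Rightarrow> nat \<Rightarrow> (nat \<Rightarrow> 'n) \<Rightarrow> (nat \<Rightarrow> 'n) \<Rightarrow> bool" where
  "agree_outside s n x y \<longleftrightarrow> (\<forall>p. p < s \<or> s + n \<le> p \<longrightarrow> x p = y p)"

lemma length_window [simp]: "length (window s n x) = n" by (simp add: window_def)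
lemma nth_window [simp]: "i < n \<Longrightarrow> window s n x ! i = x (s + i)" by (simp add: window_def)
lemma window_place [simp]: "length w = n \<Longrightarrow> window s n (place s x w) = w"
  by (rule nth_equalityI) (auto simp: place_def)
lemma agree_outside_place [simp]: "length w = n \<Longrightarrow> agree_outside s n (place s x w) y = agree_outside s n x y"
  "length w = n \<Longrightarrow> agree_outside s n x (place s y w) = agree_outside s n x y"
  by (auto simp: agree_outside_def place_def)
lemma agree_outside_refl [simp]: "agree_outside s n x x" by (simp add: agree_outside_def)
lemma agree_outside_iff: "agree_outside s n x y \<longleftrightarrow> y \<in> place s x ` {w. length w = n}"
proof
  assume "agree_outside s n x y"
  then have "y = place s x (window s n y)" by (auto simp: agree_outside_def place_def fun_eq_iff)
  then show "y \<in> place s x ` {w. length w = n}" by (intro image_eqI) auto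
qed (auto simp: agree_outside_def place_def)
lemma inj_place: "inj_on (place s x) {w. length w = n}"
  by (rule inj_on_inverseI[where g = "window s n"]) simp
lemma finite_lists_len [simp]: "finite {w :: 'n::finite list. length w = n}"
  using finite_lists_length_eq[of "UNIV :: 'n set" n] by simp
lemma agree_outside_window: "agree_outside s n x y \<Longrightarrow> x = y \<longleftrightarrow> window s n x = window s n y"
proof
  assume *: "agree_outside s n x y" "window s n x = window s n y"
  show "x = y"
  proof
    fix p show "x p = y p"
    proof (cases "s \<le> p \<and> p < s + n")
      case True
      then have "p - s < n" "s + (p - s) = p" by auto
      then show ?thesis using *(2) nth_window by metis
    qed (use *(1) in \<open>auto simp: agree_outside_def\<close>)
  qed
qed simp

text \<open>
  The tensor operator acts at the sites \<open>s,\<dots>,s + n - 1\<close>; the offset transports the braid relation to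
  every site.
\<close>

lift_definition emb :: "nat \<Rightarrow> nat \<Rightarrow> ('n::finite, 'b::zero) tens \<Rightarrow> ('n, 'b) lop" is
  "\<lambda>s n a x y. if agree_outside s n x y then a (window s n x) (window s n y) else 0"
proof -
  fix s n and a :: "('n, 'b) tens" and x :: "nat \<Rightarrow> 'n"
  show "finite {y. (if agree_outside s n x y then a (window s n x) (window s n y) else 0) \<noteq> 0}"
    by (rule finite_subset[of _ "place s x ` {w. length w = n}"]) (auto simp: agree_outside_iff split: if_splits)
qed

lemma emb_mult: "emb s n (tens_mult n a b) = emb s n a * (emb s n b :: ('n::finite, 'b::ring_1) lop)"
proof (rule rfm_eqI)
  fix x y :: "nat \<Rightarrow> 'n"
  have "ent (emb s n a * emb s n b) x y =
      (\<Sum>z\<in>place s x ` {w. length w = n}. ent (emb s n a) x z * ent (emb s n b) z y)"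
    by (rule ent_mult_on) (auto simp: emb.rep_eq agree_outside_iff split: if_splits)
  also have "\<dots> = (\<Sum>w | length w = n. ent (emb s n a) x (place s x w) * ent (emb s n b) (place s x w) y)"
    by (simp add: sum.reindex inj_place)
  also have "\<dots> = ent (emb s n (tens_mult n a b)) x y"
    by (auto simp: emb.rep_eq tens_mult_def intro!: sum.cong)
  finally show "ent (emb s n (tens_mult n a b)) x y = ent (emb s n a * emb s n b) x y" by simp
qed

lemma emb_id: "emb s n tens_id = (1 :: ('n::finite, 'b::ring_1) lop)"
  by (rule rfm_eqI) (auto simp: emb.rep_eq tens_id_def ent_simps agree_outside_window)

lemma emb_prod:
  "emb s n (tens_prod n as) = (prod_list (map (emb s n) as) :: ('n::finite, 'b::ring_1) lop)"
  by (induction as) (simp_all add: tens_prod_def emb_id emb_mult)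

lemma emb_cong: "(\<And>x y. length x = n \<Longrightarrow> length y = n \<Longrightarrow> a x y = b x y) \<Longrightarrow> emb s n a = emb s n b"
  by (rule rfm_eqI) (simp add: emb.rep_eq)

lemma emb_ent: "length v = n \<Longrightarrow> length w = n \<Longrightarrow> ent (emb s n a) (place s x v) (place s x w) = a v w"
  by (simp add: emb.rep_eq)

lemma emb_at1:
  assumes "1 \<le> i" "i \<le> n"
  shows "emb s n (at1 M i) = op1 M (s + (i - 1))"
proof (rule rfm_eqI)
  fix x y :: "nat \<Rightarrow> 'a"
  have "(agree_outside s n x y \<and> (\<forall>p<n. p \<noteq> i - 1 \<longrightarrow> x (s + p) = y (s + p))) \<longleftrightarrow> agree_off (s + (i - 1)) x y"
  proof
    assume *: "agree_outside s n x y \<and> (\<forall>p<n. p \<noteq> i - 1 \<longrightarrow> x (s + p) = y (s + p))"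
    show "agree_off (s + (i - 1)) x y" unfolding agree_off_def
    proof (intro allI impI)
      fix p assume p: "p \<noteq> s + (i - 1)"
      show "x p = y p"
      proof (cases "s \<le> p \<and> p < s + n")
        case True
        then have "p - s < n" "p - s \<noteq> i - 1" "s + (p - s) = p" using p by auto
        then show ?thesis using * by metis
      qed (use * in \<open>auto simp: agree_outside_def\<close>)
    qed
  next
    show "agree_off (s + (i - 1)) x y \<Longrightarrow> agree_outside s n x y \<and> (\<forall>p<n. p \<noteq> i - 1 \<longrightarrow> x (s + p) = y (s + p))"
      using assms unfolding agree_off_def agree_outside_def by force
  qed
  note iff = this
  have n: "i - 1 < n" using assms by simp
  have "ent (emb s n (at1 M i)) x y =
      (if agree_outside s n x y \<and> (\<forall>p<n. p \<noteq> i - 1 \<longrightarrow> x (s + p) = y (s + p))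
       then M $ x (s + (i - 1)) $ y (s + (i - 1)) else 0)"
    unfolding emb.rep_eq at1_def length_window using n by (simp cong: conj_cong)
  then show "ent (emb s n (at1 M i)) x y = ent (op1 M (s + (i - 1))) x y"
    unfolding iff op1.rep_eq .
qed

lemma emb_at2:
  assumes "1 \<le> i" "i < n"
  shows "emb s n (at2 M i) = op2 M (s + (i - 1))"
proof (rule rfm_eqI)
  fix x y :: "nat \<Rightarrow> 'a"
  have e: "Suc (s + (i - 1)) = s + i" using assms by simp
  have "(agree_outside s n x y \<and> (\<forall>p<n. p \<noteq> i - 1 \<and> p \<noteq> i \<longrightarrow> x (s + p) = y (s + p))) \<longleftrightarrow> agree_off2 (s + (i - 1)) x y"
  proof
    assume *: "agree_outside s n x y \<and> (\<forall>p<n. p \<noteq> i - 1 \<and> p \<noteq> i \<longrightarrow> x (s + p) = y (s + p))"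
    show "agree_off2 (s + (i - 1)) x y" unfolding agree_off2_def e
    proof (intro allI impI)
      fix p assume p: "p \<noteq> s + (i - 1) \<and> p \<noteq> s + i"
      show "x p = y p"
      proof (cases "s \<le> p \<and> p < s + n")
        case True
        then have "p - s < n" "p - s \<noteq> i - 1" "p - s \<noteq> i" "s + (p - s) = p" using p by auto
        then show ?thesis using * by metis
      qed (use * in \<open>auto simp: agree_outside_def\<close>)
    qed
  next
    show "agree_off2 (s + (i - 1)) x y \<Longrightarrow> agree_outside s n x y \<and> (\<forall>p<n. p \<noteq> i - 1 \<and> p \<noteq> i \<longrightarrow> x (s + p) = y (s + p))"
      using assms unfolding agree_off2_def e agree_outside_def by force
  qed
  note iff = this
  have n: "i - 1 < n" using assms by simp
  have "ent (emb s n (at2 M i)) x y =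
      (if agree_outside s n x y \<and> (\<forall>p<n. p \<noteq> i - 1 \<and> p \<noteq> i \<longrightarrow> x (s + p) = y (s + p))
       then M $ (x (s + (i - 1)), x (s + i)) $ (y (s + (i - 1)), y (s + i)) else 0)"
    unfolding emb.rep_eq at2_def length_window using n assms by (simp cong: conj_cong)
  then show "ent (emb s n (at2 M i)) x y = ent (op2 M (s + (i - 1))) x y"
    unfolding iff op2.rep_eq get_pair_def e .
qed

lemma sum_lists_Suc:
  "(\<Sum>w :: 'n::finite list | length w = Suc n. f w) = (\<Sum>w | length w = n. \<Sum>a\<in>UNIV. f (w @ [a]))"
proof -
  have "(\<Sum>w | length w = n. \<Sum>a\<in>UNIV. f (w @ [a])) = (\<Sum>(w, a)\<in>{w. length w = n} \<times> UNIV. f (w @ [a]))"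
    by (rule sum.cartesian_product)
  also have "\<dots> = (\<Sum>w :: 'n list | length w = Suc n. f w)"
  proof (rule sum.reindex_bij_witness[where i = "\<lambda>w. (butlast w, last w)" and j = "\<lambda>(w, a). w @ [a]"])
    show "(case (butlast w, last w) of (w, a) \<Rightarrow> w @ [a]) = w"
      if "w \<in> {w. length w = Suc n}" for w :: "'n list"
      using that append_butlast_last_id[of w] by fastforce
  qed auto
  finally show ?thesis by simp
qed

lemma place_Nil [simp]: "place s x [] = x" by (auto simp: place_def fun_eq_iff)

lemma iter_ptrace0:
  fixes A :: "('n::finite, 'b::ring_1) lop"
  shows "ent (iter_trace ptrace0 0 n A) x y =
    (if \<forall>p<n. x p = y p then \<Sum>w | length w = n. ent A (place 0 x w) (place 0 y w) else 0)"
proof (induction n arbitrary: A)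
  case 0
  then show ?case by simp
next
  case (Suc n)
  have pl: "(place 0 z w)(n := a) = place 0 z (w @ [a])" if "length w = n" for z :: "nat \<Rightarrow> 'n" and w a
    using that by (auto simp: place_def fun_eq_iff nth_append)
  have n: "place 0 z w n = z n" if "length w = n" for z :: "nat \<Rightarrow> 'n" and w
    using that by (simp add: place_def)
  have "ent (iter_trace ptrace0 0 (Suc n) A) x y =
    (if \<forall>p<n. x p = y p then \<Sum>w | length w = n. ent (ptrace0 n A) (place 0 x w) (place 0 y w) else 0)"
    by (simp add: Suc)
  also have "\<dots> = (if \<forall>p<Suc n. x p = y p then \<Sum>w | length w = n. \<Sum>a\<in>UNIV. ent A (place 0 x (w @ [a])) (place 0 y (w @ [a])) else 0)"
    by (auto simp: ptrace0_ent n pl less_Suc_eq intro!: sum.cong)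
  finally show ?case by (simp only: sum_lists_Suc)
qed

lemma iter_ptrace0_emb: "iter_trace ptrace0 0 n (emb 0 n a) = diag (tens_trace n a)"
proof (rule rfm_eqI)
  fix x y :: "nat \<Rightarrow> 'a"
  have "(\<forall>p<n. x p = y p) \<and> agree_outside 0 n x y \<longleftrightarrow> x = y"
    by (auto simp: agree_outside_def fun_eq_iff) (metis not_le)
  then show "ent (iter_trace ptrace0 0 n (emb 0 n a)) x y = ent (diag (tens_trace n a)) x y"
    by (auto simp: iter_ptrace0 emb.rep_eq diag.rep_eq tens_trace_def)
qed

text \<open>The weights at different sites are collected on the left, since \<open>M\<close> at one site is trivial at the others.\<close>

lemma iter_ptrace:
  assumes M: "\<And>i j. centr (M $ i $ j)"
  shows "iter_trace (ptrace M) 0 n A = iter_trace ptrace0 0 n (prod_list (map (op1 M) [0..<n]) * A)"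
proof (induction n arbitrary: A)
  case (Suc n)
  have tr: "prod_list (map (op1 M) [0..<m]) \<in> triv_at n" if "m \<le> n" for m
    using that by (induction m) (auto intro!: triv_at_one triv_at_mult op1_triv)
  have "iter_trace (ptrace M) 0 (Suc n) A =
      iter_trace ptrace0 0 n (prod_list (map (op1 M) [0..<n]) * ptrace0 n (op1 M n * A))"
    by (simp add: Suc ptrace_ptrace0[of M])
  also have "prod_list (map (op1 M) [0..<n]) * ptrace0 n (op1 M n * A) =
      ptrace0 n (prod_list (map (op1 M) [0..<n]) * (op1 M n * A))"
    by (rule ptrace_lmult[symmetric]) (auto intro: tr centr_mat)
  finally show ?case by (simp add: mult.assoc)
qed simp

subsection \<open>Scalars\<close>

definition mapm :: "('a \<Rightarrow> 'b) \<Rightarrow> 'a ^ 'm ^ 'k \<Rightarrow> 'b ^ 'm ^ 'k" where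
  "mapm f M = (\<chi> i j. f (M $ i $ j))"

lemma mapm_nth [simp]: "mapm f M $ i $ j = f (M $ i $ j)" by (simp add: mapm_def)

lemma ent_diag_mult: "ent (diag c * A) x y = c * ent A x (y :: 'i)" for c :: "'b::ring_1"
  by (subst ent_mult_on[of "{x}"]) (auto simp: diag.rep_eq split: if_splits)

lemma ent_mult_diag: "ent (A * diag c) x y = ent A x y * c" for c :: "'b::ring_1"
  by (subst ent_mult_right_on[of "{y}"]) (auto simp: diag.rep_eq split: if_splits)

text \<open>
  Two instances are used: the identity of the ground field, where matrix identities for \<open>R\<close> and \<open>C\<close> are
  obtained, and the constant series over the free algebra.
\<close>

locale scalar_map =
  fixes \<sigma> :: "'a::field \<Rightarrow> 'b::ring_1"
  assumes \<sigma>_add: "\<sigma> (a + b) = \<sigma> a + \<sigma> b" and \<sigma>_mult: "\<sigma> (a * b) = \<sigma> a * \<sigma> b"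
    and \<sigma>_one [simp]: "\<sigma> 1 = 1" and \<sigma>_centr: "centr (\<sigma> a)"
begin

lemma \<sigma>_zero [simp]: "\<sigma> 0 = 0" using \<sigma>_add[of 0 0] by simp
lemma \<sigma>_minus: "\<sigma> (- a) = - \<sigma> a"
  using \<sigma>_add[of a "- a"] by (simp add: eq_neg_iff_add_eq_0 add.commute)
lemma \<sigma>_diff: "\<sigma> (a - b) = \<sigma> a - \<sigma> b" using \<sigma>_add[of a "- b"] by (simp add: \<sigma>_minus)
lemma \<sigma>_sum: "\<sigma> (sum f A) = (\<Sum>i\<in>A. \<sigma> (f i))"
  by (induction A rule: infinite_finite_induct) (simp_all add: \<sigma>_add)

lemma mapm_mult: "mapm \<sigma> (M ** N) = mapm \<sigma> M ** mapm \<sigma> N"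
  by (simp add: vec_eq_iff matrix_matrix_mult_def \<sigma>_sum \<sigma>_mult)
lemma mapm_diff: "mapm \<sigma> (M - N) = mapm \<sigma> M - mapm \<sigma> N"
  by (simp add: vec_eq_iff \<sigma>_diff)
lemma mapm_add: "mapm \<sigma> (M + N) = mapm \<sigma> M + mapm \<sigma> N"
  by (simp add: vec_eq_iff \<sigma>_add)
lemma mapm_mat: "mapm \<sigma> (mat c) = mat (\<sigma> c)" by (simp add: vec_eq_iff mat_def)
lemma mapm_centr: "centr (mapm \<sigma> M $ i $ j)" by (simp add: \<sigma>_centr)

lemma tens_map_at1: "tens_map \<sigma> (at1 M i) = at1 (mapm \<sigma> M) i"
  by (auto simp: tens_map_def at1_def fun_eq_iff)
lemma tens_map_at2: "tens_map \<sigma> (at2 M i) = at2 (mapm \<sigma> M) i"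
  by (auto simp: tens_map_def at2_def fun_eq_iff)
lemma tens_map_id: "tens_map \<sigma> tens_id = tens_id"
  by (auto simp: tens_map_def tens_id_def fun_eq_iff)
lemma tens_map_mult: "tens_map \<sigma> (tens_mult n a b) = tens_mult n (tens_map \<sigma> a) (tens_map \<sigma> b)"
  by (simp add: tens_map_def tens_mult_def fun_eq_iff \<sigma>_sum \<sigma>_mult)
lemma tens_map_prod: "tens_map \<sigma> (tens_prod n as) = tens_prod n (map (tens_map \<sigma>) as)"
  by (induction as) (simp_all add: tens_prod_def tens_map_id tens_map_mult)

definition smult :: "'a \<Rightarrow> ('i, 'b) rfm \<Rightarrow> ('i, 'b) rfm" where "smult c A = diag (\<sigma> c) * A"

lemma ent_smult: "ent (smult c A) x y = \<sigma> c * ent A x y" by (simp add: smult_def ent_diag_mult)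

lemma diag_comm: "diag (\<sigma> c) * A = A * diag (\<sigma> c)"
  by (rule rfm_eqI) (use \<sigma>_centr in \<open>simp add: ent_diag_mult ent_mult_diag centr_def\<close>)

sublocale scalar_algebra smult
proof
  fix a b and x y :: "('i, 'b) rfm"
  show "smult (a + b) x = smult a x + smult b x"
    by (rule rfm_eqI) (simp add: ent_smult ent_simps \<sigma>_add distrib_right)
  show "smult a (x + y) = smult a x + smult a y" by (simp add: smult_def distrib_left)
  show "smult a (smult b x) = smult (a * b) x"
    by (rule rfm_eqI) (simp add: ent_smult \<sigma>_mult mult.assoc)
  show "smult 1 x = x" by (rule rfm_eqI) (simp add: ent_smult)
  show "smult a x * y = smult a (x * y)" by (simp add: smult_def mult.assoc)
  show "x * smult a y = smult a (x * y)" unfolding smult_def by (metis diag_comm mult.assoc)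
qed

lemma op2_smult: "op2 (mapm \<sigma> (mat c)) k = smult c (1 :: ('n::finite, 'b) lop)"
  by (simp add: mapm_mat op2_mat smult_def)
lemma op1_smult: "op1 (mat (\<sigma> c)) k = smult c (1 :: ('n::finite, 'b) lop)"
  by (simp add: op1_mat smult_def)

lemma emb_smult: "emb s n (\<lambda>x y. \<sigma> c * a x y) = smult c (emb s n a)"
  by (rule rfm_eqI) (simp add: emb.rep_eq ent_smult)

end

lemma emb_diff: "emb s n (\<lambda>x y. a x y - b x y) = emb s n a - (emb s n b :: ('n::finite, 'b::ring_1) lop)"
  by (rule rfm_eqI) (simp add: emb.rep_eq ent_simps)

section \<open>The R-trace\<close>

text \<open>The inverse of \<open>R\<close>, by the Hecke relation.\<close>

definition inv_of :: "'a::field \<Rightarrow> ('n::finite, 'a) op2 \<Rightarrow> ('n, 'a) op2" where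
  "inv_of q R = R - mat (q - inverse q)"

lemma id_scalar_map: "scalar_map (\<lambda>a::'a::field. a)"
  by standard (auto simp: centr_def)

context scalar_map
begin

definition S_op :: "('n::finite, 'a) op2 \<Rightarrow> nat \<Rightarrow> ('n, 'b) lop" where
  "S_op R k = op2 (mapm \<sigma> R) k"

lemma S_op_braid:
  assumes "braiding R"
  shows "S_op R k * S_op R (Suc k) * S_op R k = S_op R (Suc k) * S_op R k * S_op R (Suc k)"
proof -
  have "emb k 3 (tens_map \<sigma> (tens_prod 3 [at2 R 1, at2 R 2, at2 R 1])) =
      emb k 3 (tens_map \<sigma> (tens_prod 3 [at2 R 2, at2 R 1, at2 R 2]))"
    by (rule emb_cong) (use assms in \<open>simp add: braiding_def tens_map_def\<close>)
  then show ?thesis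
    by (simp add: tens_map_prod tens_map_at2 emb_prod emb_at2 S_op_def mult.assoc)
qed

lemma S_op_quad:
  assumes "(mat q - R) ** (mat (inverse q) + R) = 0" "q \<noteq> 0"
  shows "S_op R k * S_op R k = 1 + smult (q - inverse q) (S_op R k)"
proof -
  have "op2 (mapm \<sigma> ((mat q - R) ** (mat (inverse q) + R))) k = (0 :: ('c, 'b) lop)"
    unfolding assms(1) by (rule rfm_eqI) (simp add: op2.rep_eq ent_simps)
  then have "(smult q 1 - S_op R k) * (smult (inverse q) 1 + S_op R k) = 0"
    by (simp add: mapm_mult mapm_diff mapm_add op2_hom op2_diff op2_add op2_smult S_op_def)
  then show ?thesis using assms(2)
    by (simp add: algebra_simps sc_diff sc_diff_left sc_add)
qed

lemma S_op_triv: "j \<noteq> k \<Longrightarrow> j \<noteq> Suc k \<Longrightarrow> S_op R k \<in> triv_at j"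
  by (simp add: S_op_def op2_triv)

lemma S_op_comm: "A \<in> triv_at k \<Longrightarrow> A \<in> triv_at (Suc k) \<Longrightarrow> S_op R k * A = A * S_op R k"
  unfolding S_op_def by (rule op2_comm) (auto simp: \<sigma>_centr)

lemma S_op_inv: "S_op (inv_of q R) k = S_op R k - smult (q - inverse q) 1"
  by (simp add: S_op_def inv_of_def mapm_diff op2_diff op2_smult)

lemma S_op_inverse:
  assumes "(mat q - R) ** (mat (inverse q) + R) = 0" "q \<noteq> 0"
  shows "S_op R k * S_op (inv_of q R) k = 1" "S_op (inv_of q R) k * S_op R k = 1"
  by (simp_all add: S_op_inv left_diff_distrib right_diff_distrib S_op_quad[OF assms])

end

lemma sum_UNIV_prod: "(\<Sum>ab\<in>UNIV. f ab) = (\<Sum>a\<in>UNIV. \<Sum>b\<in>UNIV. f (a, b))"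
  for f :: "'a::finite \<times> 'b::finite \<Rightarrow> 'c::comm_monoid_add"
  unfolding UNIV_Times_UNIV[symmetric] by (simp only: sum.cartesian_product) simp

text \<open>
  The coefficients in this expansion do not depend on \<open>X\<close>. This serves in two directions: one-site
  operators \<open>X\<close> over the ground field determine the coefficients (\<open>C_conj1\<close>), which then give the
  trace for every \<open>X\<close> (\<open>T_copy\<close>).
\<close>

lemma ptrace_conj_ent:
  fixes X :: "('n::finite, 'b::ring_1) lop"
  assumes X: "X \<in> triv_at (Suc k)" and xy: "x (Suc k) = y (Suc k)"
    and N: "\<And>i j. centr (N $ i $ j)"
  shows "ent (ptrace C (Suc k) (op2 M k * X * op2 N k)) x y =
    (\<Sum>a\<in>UNIV. \<Sum>d\<in>UNIV. (\<Sum>u\<in>UNIV. \<Sum>v\<in>UNIV. \<Sum>e\<in>UNIV.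
        C $ u $ v * (M $ (x k, v) $ (a, e) * N $ (d, e) $ (y k, u))) * ent X (x(k := a)) (y(k := d)))"
proof -
  have Xe: "ent X (put_pair k z (a, e)) (put_pair k w (d, e')) = (if e = e' then ent X (x(k := a)) (y(k := d)) else 0)"
    if "z = x(Suc k := v)" "w = y(Suc k := u)" for z w a e d e' u v
  proof -
    have "put_pair k z (a, e) = x(k := a, Suc k := e)" "put_pair k w (d, e') = y(k := d, Suc k := e')"
      using that by (auto simp: put_pair_def)
    then show ?thesis
      using triv_at_zero[OF X, of "x(k := a, Suc k := e)" "y(k := d, Suc k := e')"]
        triv_at_upd[OF X, of "x(k := a)" "y(k := d)" e] xy by auto
  qed
  have inner: "ent (op2 M k * X * op2 N k) (x(Suc k := v)) (y(Suc k := u)) =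
     (\<Sum>a\<in>UNIV. \<Sum>d\<in>UNIV. \<Sum>e\<in>UNIV.
        (M $ (x k, v) $ (a, e) * N $ (d, e) $ (y k, u)) * ent X (x(k := a)) (y(k := d)))" for u v
  proof -
    have "ent (op2 M k * X * op2 N k) (x(Suc k := v)) (y(Suc k := u)) =
      (\<Sum>d\<in>UNIV. \<Sum>e'\<in>UNIV. (\<Sum>a\<in>UNIV. \<Sum>e\<in>UNIV. M $ (x k, v) $ (a, e) *
         (if e = e' then ent X (x(k := a)) (y(k := d)) else 0)) * N $ (d, e') $ (y k, u))"
      by (simp add: mult_op2 op2_mult sum_UNIV_prod Xe get_pair_def)
    also have "\<dots> = (\<Sum>d\<in>UNIV. \<Sum>e'\<in>UNIV. \<Sum>a\<in>UNIV.
         (M $ (x k, v) $ (a, e') * N $ (d, e') $ (y k, u)) * ent X (x(k := a)) (y(k := d)))"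
    proof (intro sum.cong refl)
      fix d e'
      show "(\<Sum>a\<in>UNIV. \<Sum>e\<in>UNIV. M $ (x k, v) $ (a, e) *
         (if e = e' then ent X (x(k := a)) (y(k := d)) else 0)) * N $ (d, e') $ (y k, u) =
         (\<Sum>a\<in>UNIV. (M $ (x k, v) $ (a, e') * N $ (d, e') $ (y k, u)) * ent X (x(k := a)) (y(k := d)))"
        using N unfolding centr_def
        by (simp add: mult_delta_right sum_distrib_right mult.assoc)
    qed
    also have "\<dots> = (\<Sum>d\<in>UNIV. \<Sum>a\<in>UNIV. \<Sum>e'\<in>UNIV.
         (M $ (x k, v) $ (a, e') * N $ (d, e') $ (y k, u)) * ent X (x(k := a)) (y(k := d)))"
      by (rule sum.cong[OF refl], rule sum.swap)
    also have "\<dots> = (\<Sum>a\<in>UNIV. \<Sum>d\<in>UNIV. \<Sum>e'\<in>UNIV.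
         (M $ (x k, v) $ (a, e') * N $ (d, e') $ (y k, u)) * ent X (x(k := a)) (y(k := d)))"
      by (rule sum.swap)
    finally show ?thesis .
  qed
  have "ent (ptrace C (Suc k) (op2 M k * X * op2 N k)) x y =
    (\<Sum>(u, v)\<in>UNIV. \<Sum>(a, d)\<in>UNIV. \<Sum>e\<in>UNIV.
        C $ u $ v * (M $ (x k, v) $ (a, e) * N $ (d, e) $ (y k, u)) * ent X (x(k := a)) (y(k := d)))"
    using xy by (simp add: ptrace.rep_eq inner sum_UNIV_prod sum_distrib_left) (simp only: mult.assoc)
  also have "\<dots> = (\<Sum>(a, d)\<in>UNIV. \<Sum>(u, v)\<in>UNIV. \<Sum>e\<in>UNIV.
        C $ u $ v * (M $ (x k, v) $ (a, e) * N $ (d, e) $ (y k, u)) * ent X (x(k := a)) (y(k := d)))"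
    unfolding split_def by (rule sum.swap)
  also have "\<dots> = (\<Sum>a\<in>UNIV. \<Sum>d\<in>UNIV. (\<Sum>u\<in>UNIV. \<Sum>v\<in>UNIV. \<Sum>e\<in>UNIV.
        C $ u $ v * (M $ (x k, v) $ (a, e) * N $ (d, e) $ (y k, u))) * ent X (x(k := a)) (y(k := d)))"
    by (simp add: sum_UNIV_prod sum_distrib_right)
  finally show ?thesis .
qed

locale skew_hecke =
  fixes q :: "'a::field" and R :: "('n::finite, 'a) op2"
  assumes hecke: "hecke_symmetry q R" and skew: "skew_invertible R"
begin

abbreviation "\<Psi> \<equiv> skew_inv R"
abbreviation "C \<equiv> C_op R"
abbreviation "Ri \<equiv> inv_of q R"

lemma q_nonzero: "q \<noteq> 0" using hecke by (simp add: hecke_symmetry_def)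
lemma braid: "braiding R" using hecke by (simp add: hecke_symmetry_def)
lemma quad: "(mat q - R) ** (mat (inverse q) + R) = 0" using hecke by (simp add: hecke_symmetry_def)

lemma skew1:
  "(\<Sum>j\<in>UNIV. \<Sum>l\<in>UNIV. R $ (i, j) $ (k, l) * \<Psi> $ (l, p) $ (j, r)) = (if i = r \<and> p = k then 1 else 0)"
  using someI_ex[OF skew[unfolded skew_invertible_def]] unfolding skew_inv_def skew_inverse_def by blast

text \<open>Regrouping the indices of \<open>R\<close> and \<open>\<Psi>\<close> turns skew-invertibility into the inversion of a square
  matrix, so that the inverse is two-sided.\<close>

lemma skew2:
  "(\<Sum>r\<in>UNIV. \<Sum>p\<in>UNIV. \<Psi> $ (l, p) $ (j, r) * R $ (r, b) $ (p, d)) = (if j = b \<and> l = d then 1 else 0)"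
proof -
  define A :: "'a ^ ('n \<times> 'n) ^ ('n \<times> 'n)" where "A = (\<chi> ik jl. R $ (fst ik, fst jl) $ (snd ik, snd jl))"
  define B :: "'a ^ ('n \<times> 'n) ^ ('n \<times> 'n)" where "B = (\<chi> jl rp. \<Psi> $ (snd jl, snd rp) $ (fst jl, fst rp))"
  have "A ** B = mat 1"
    using skew1 by (auto simp: vec_eq_iff matrix_matrix_mult_def A_def B_def mat_def sum_UNIV_prod)
  then have "B ** A = mat 1" using matrix_left_right_inverse by blast
  then have "(B ** A) $ (j, l) $ (b, d) = (mat 1 :: 'a ^ ('n \<times> 'n) ^ ('n \<times> 'n)) $ (j, l) $ (b, d)" by simp
  then show ?thesis by (simp add: matrix_matrix_mult_def A_def B_def mat_def sum_UNIV_prod)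
qed

lemma C_R: "(\<Sum>u\<in>UNIV. \<Sum>v\<in>UNIV. C $ u $ v * R $ (i, v) $ (k, u)) = (if i = k then 1 else 0)"
proof -
  have "(\<Sum>u\<in>UNIV. \<Sum>v\<in>UNIV. C $ u $ v * R $ (i, v) $ (k, u)) =
     (\<Sum>(u, v)\<in>UNIV. \<Sum>p\<in>UNIV. R $ (i, v) $ (k, u) * \<Psi> $ (u, p) $ (v, p))"
    by (simp add: sum_UNIV_prod C_op_def sum_distrib_right sum_distrib_left mult.commute)
  also have "\<dots> = (\<Sum>p\<in>UNIV. \<Sum>(u, v)\<in>UNIV. R $ (i, v) $ (k, u) * \<Psi> $ (u, p) $ (v, p))"
    unfolding split_def by (rule sum.swap)
  also have "\<dots> = (\<Sum>p\<in>UNIV. \<Sum>v\<in>UNIV. \<Sum>u\<in>UNIV. R $ (i, v) $ (k, u) * \<Psi> $ (u, p) $ (v, p))"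
    unfolding sum_UNIV_prod prod.case by (rule sum.cong[OF refl], rule sum.swap)
  also have "\<dots> = (\<Sum>p\<in>UNIV. if i = p \<and> p = k then 1 else 0)" by (simp add: skew1)
  also have "\<dots> = (\<Sum>p\<in>UNIV. if i = p then (if p = k then 1 else 0) else 0)"
    by (intro sum.cong) auto
  also have "\<dots> = (if i = k then 1 else 0)" by (subst sum.delta') auto
  finally show ?thesis .
qed

end

locale skew_rep = skew_hecke q R + scalar_map \<sigma>
  for q :: "'a::field" and R :: "('n::finite, 'a) op2" and \<sigma> :: "'a \<Rightarrow> 'b::ring_1"
begin

abbreviation S :: "nat \<Rightarrow> ('n, 'b) lop" where "S \<equiv> S_op R"
abbreviation T :: "nat \<Rightarrow> ('n, 'b) lop \<Rightarrow> ('n, 'b) lop" where "T \<equiv> ptrace (mapm \<sigma> C)"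

lemma ptrace_S_op: "T (Suc k) (S k) = 1"
proof (rule rfm_eqI)
  fix x y :: "nat \<Rightarrow> 'n"
  have e: "ent (S k) (x(Suc k := v)) (y(Suc k := u)) = (if agree_off2 k x y then \<sigma> (R $ (x k, v) $ (y k, u)) else 0)" for u v
    by (auto simp: S_op_def op2.rep_eq get_pair_def agree_off2_def)
  have xy: "x = y \<longleftrightarrow> agree_off2 k x y \<and> x k = y k \<and> x (Suc k) = y (Suc k)"
    by (auto simp: agree_off2_def fun_eq_iff)
  have "ent (T (Suc k) (S k)) x y = (if x (Suc k) = y (Suc k) \<and> agree_off2 k x y
      then \<sigma> (\<Sum>a\<in>UNIV. \<Sum>b\<in>UNIV. C $ a $ b * R $ (x k, b) $ (y k, a)) else 0)"
    by (auto simp: ptrace.rep_eq e \<sigma>_sum \<sigma>_mult)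
  then show "ent (T (Suc k) (S k)) x y = ent 1 x y"
    unfolding C_R using xy by (auto simp: ent_simps)
qed

end

context skew_hecke
begin

text \<open>
  Every one-site matrix is a partial contraction of \<open>R\<close> with some matrix at the neighbouring site.
\<close>

lemma contract_R:
  fixes X :: "('n, 'a) op1"
  shows "(\<Sum>r\<in>UNIV. \<Sum>p\<in>UNIV. R $ (r, s) $ (p, t) * (\<Sum>j\<in>UNIV. \<Sum>l\<in>UNIV. X $ j $ l * \<Psi> $ (l, p) $ (j, r)))
    = X $ s $ t"
  proof -
    have "(\<Sum>r\<in>UNIV. \<Sum>p\<in>UNIV. R $ (r, s) $ (p, t) * (\<Sum>j\<in>UNIV. \<Sum>l\<in>UNIV. X $ j $ l * \<Psi> $ (l, p) $ (j, r))) =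
      (\<Sum>(r, p)\<in>UNIV. \<Sum>(j, l)\<in>UNIV. X $ j $ l * (\<Psi> $ (l, p) $ (j, r) * R $ (r, s) $ (p, t)))"
      by (simp add: sum_UNIV_prod sum_distrib_left mult_ac)
    also have "\<dots> = (\<Sum>(j, l)\<in>UNIV. \<Sum>(r, p)\<in>UNIV. X $ j $ l * (\<Psi> $ (l, p) $ (j, r) * R $ (r, s) $ (p, t)))"
      unfolding split_def by (rule sum.swap)
    also have "\<dots> = (\<Sum>jl\<in>UNIV. if jl = (s, t) then X $ s $ t else 0)"
    proof (rule sum.cong[OF refl])
      fix jl :: "'n \<times> 'n"
      obtain j l where jl: "jl = (j, l)" by (cases jl)
      have "(\<Sum>(r, p)\<in>UNIV. X $ j $ l * (\<Psi> $ (l, p) $ (j, r) * R $ (r, s) $ (p, t))) =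
          X $ j $ l * (if j = s \<and> l = t then 1 else 0)"
        by (simp only: sum_UNIV_prod prod.case) (simp only: sum_distrib_left[symmetric] skew2)
      moreover have "X $ j $ l * (if j = s \<and> l = t then 1 else 0) = (if jl = (s, t) then X $ s $ t else 0)"
        unfolding jl by (cases "j = s \<and> l = t") auto
      ultimately show "(case jl of (j, l) \<Rightarrow> \<Sum>(r, p)\<in>UNIV. X $ j $ l * (\<Psi> $ (l, p) $ (j, r) * R $ (r, s) $ (p, t))) =
          (if jl = (s, t) then X $ s $ t else 0)"
        unfolding jl prod.case by (simp only:)
    qed
    finally show ?thesis by simp
  qed

text \<open>
  The matrix form of \<open>Tr\<^sub>R\<^sub>(\<^sub>2\<^sub>) (R\<^sub>1\<^sub>2\<^sup>-\<^sup>1 X\<^sub>1 R\<^sub>1\<^sub>2) = Tr\<^sub>R(X) I\<close>. Write \<open>X\<^sub>1 = Tr\<^sub>0 (R\<^sub>0\<^sub>1 Y\<^sub>0)\<close> with an auxiliary site 0.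
  By the braid relation \<open>R\<^sub>1\<^sub>2\<^sup>-\<^sup>1 R\<^sub>0\<^sub>1 R\<^sub>1\<^sub>2 = R\<^sub>0\<^sub>1 R\<^sub>1\<^sub>2 R\<^sub>0\<^sub>1\<^sup>-\<^sup>1\<close>, and since \<open>Tr\<^sub>R\<^sub>(\<^sub>2\<^sub>) R\<^sub>1\<^sub>2 = I\<close>, the left side
  becomes \<open>Tr\<^sub>0 Y\<^sub>0\<close>; the right side becomes the same, as \<open>Tr\<^sub>R\<^sub>(\<^sub>1\<^sub>) R\<^sub>0\<^sub>1 = I\<close>.
\<close>

lemma C_conj1:
  "(\<Sum>u\<in>UNIV. \<Sum>v\<in>UNIV. \<Sum>e\<in>UNIV. C $ u $ v * (Ri $ (i, v) $ (a, e) * R $ (d, e) $ (b, u))) =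
   (if i = b then C $ d $ a else 0)"
proof -
  define X :: "('n, 'a) op1" where "X = (\<chi> s t. if s = a \<and> t = d then 1 else 0)"
  define Y :: "('n, 'a) op1" where "Y = (\<chi> p r. \<Sum>j\<in>UNIV. \<Sum>l\<in>UNIV. X $ j $ l * \<Psi> $ (l, p) $ (j, r))"
  have XY: "(\<Sum>r\<in>UNIV. \<Sum>p\<in>UNIV. R $ (r, s) $ (p, t) * Y $ p $ r) = X $ s $ t" for s t
    unfolding Y_def by (simp add: contract_R)
  let ?S = "\<lambda>k. op2 R k" and ?Si = "\<lambda>k. op2 Ri k"
  have m: "mapm (\<lambda>a. a) M = M" for M :: "'a ^ 'i ^ 'j" by (simp add: vec_eq_iff)
  have S: "scalar_map.S_op (\<lambda>a. a) M k = op2 M k" for M :: "('n, 'a) op2" and k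
    by (simp add: scalar_map.S_op_def[OF id_scalar_map] m)
  have inv: "?S k * ?Si k = 1" "?Si k * ?S k = 1" for k
    using scalar_map.S_op_inverse[OF id_scalar_map quad q_nonzero] by (simp_all add: S)
  have br: "?S 0 * ?S 1 * ?S 0 = ?S 1 * ?S 0 * ?S 1"
    using scalar_map.S_op_braid[OF id_scalar_map braid, of 0] by (simp add: S)
  have cen: "centr (M $ s $ t)" for M :: "'a ^ 'i ^ 'j" and s t by (simp add: centr_def mult.commute)
  have TS: "ptrace C (Suc k) (?S k) = 1" for k
    using skew_rep.ptrace_S_op[OF skew_rep.intro[OF skew_hecke_axioms id_scalar_map]] by (simp add: S m)
  have X1: "op1 X 1 = ptrace0 0 (?S 0 * op1 Y 0)"
  proof (rule rfm_eqI)
    fix x y :: "nat \<Rightarrow> 'n"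
    have "ent (?S 0 * op1 Y 0) (x(0 := r)) (y(0 := r)) =
       (\<Sum>p\<in>UNIV. if agree_off2 0 x y then R $ (r, x 1) $ (p, y 1) * Y $ p $ r else 0)" for r
      unfolding mult_op1 by (intro sum.cong) (auto simp: op2.rep_eq get_pair_def agree_off2_def)
    then have "ent (ptrace0 0 (?S 0 * op1 Y 0)) x y = (if x 0 = y 0 \<and> agree_off2 0 x y then X $ x 1 $ y 1 else 0)"
      unfolding XY[symmetric] by (auto simp: ptrace0_ent)
    moreover have "agree_off 1 x y \<longleftrightarrow> x 0 = y 0 \<and> agree_off2 0 x y"
      unfolding agree_off_def agree_off2_def One_nat_def by (metis Suc_neq_Zero)
    ultimately show "ent (op1 X 1) x y = ent (ptrace0 0 (?S 0 * op1 Y 0)) x y" by (simp add: op1.rep_eq)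
  qed
  have tr1: "?S 1 \<in> triv_at 0" "?Si 1 \<in> triv_at 0" "?S 0 \<in> triv_at 2" "?Si 0 \<in> triv_at 2"
    "op1 Y 0 \<in> triv_at 2" "op1 Y 0 \<in> triv_at 1" by (auto intro!: op2_triv op1_triv)
  have "op2 Ri 1 * op1 X 1 * op2 R 1 = ptrace0 0 (?Si 1 * (?S 0 * op1 Y 0) * ?S 1)"
    unfolding X1 using tr1 by (simp add: ptrace_lmult ptrace_rmult cen)
  also have "?Si 1 * (?S 0 * op1 Y 0) * ?S 1 = ?Si 1 * ?S 0 * (op1 Y 0 * ?S 1)" by (simp only: mult.assoc)
  also have "op1 Y 0 * ?S 1 = ?S 1 * op1 Y 0"
    by (rule op2_comm[symmetric]) (use tr1 cen in \<open>auto simp: numeral_2_eq_2\<close>)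
  also have "?Si 1 * ?S 0 * (?S 1 * op1 Y 0) = ?S 0 * ?S 1 * (?Si 0 * op1 Y 0)"
  proof -
    have "?Si 1 * (?S 1 * ?S 0 * ?S 1) * ?Si 0 = ?Si 1 * (?S 0 * ?S 1 * ?S 0) * ?Si 0" by (simp only: br)
    then have "(?Si 1 * ?S 1) * ?S 0 * ?S 1 * ?Si 0 = ?Si 1 * ?S 0 * ?S 1 * (?S 0 * ?Si 0)"
      by (simp only: mult.assoc)
    then have "?S 0 * ?S 1 * ?Si 0 = ?Si 1 * ?S 0 * ?S 1" by (simp only: inv mult_1_left mult_1_right)
    then show ?thesis by (simp only: mult.assoc[symmetric])
  qed
  finally have "ptrace C (Suc 1) (op2 Ri 1 * op1 X 1 * op2 R 1) = ptrace C 2 (ptrace0 0 (?S 0 * ?S 1 * (?Si 0 * op1 Y 0)))"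
    by (simp add: numeral_2_eq_2)
  also have "\<dots> = ptrace0 0 (ptrace C 2 (?S 0 * ?S 1 * (?Si 0 * op1 Y 0)))" by (rule ptrace_swap) (auto simp: cen)
  also have "ptrace C 2 (?S 0 * ?S 1 * (?Si 0 * op1 Y 0)) = ?S 0 * ptrace C 2 (?S 1) * (?Si 0 * op1 Y 0)"
    using tr1 by (simp only: ptrace_lmult ptrace_rmult cen triv_at_mult)
  also have "ptrace C 2 (?S 1) = 1" using TS[of 1] by (simp add: numeral_2_eq_2)
  also have "?S 0 * 1 * (?Si 0 * op1 Y 0) = (?S 0 * ?Si 0) * op1 Y 0" by (simp only: mult_1_right mult.assoc)
  also have "\<dots> = ptrace C 1 (?S 0) * op1 Y 0" using TS[of 0] by (simp add: inv)
  also have "\<dots> = ptrace C 1 (?S 0 * op1 Y 0)" using tr1 by (simp only: ptrace_rmult)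
  also have "ptrace0 0 \<dots> = ptrace C 1 (op1 X 1)" unfolding X1 by (rule ptrace_swap[symmetric]) (auto simp: cen)
  finally have eq: "ptrace C (Suc 1) (op2 Ri 1 * op1 X 1 * op2 R 1) = ptrace C 1 (op1 X 1)" .
  define x y :: "nat \<Rightarrow> 'n" where "x = (\<lambda>_. i)" and "y = x(1 := b)"
  have "ent (ptrace C (Suc 1) (op2 Ri 1 * op1 X 1 * op2 R 1)) x y =
    (\<Sum>s\<in>UNIV. \<Sum>t\<in>UNIV. (\<Sum>u\<in>UNIV. \<Sum>v\<in>UNIV. \<Sum>e\<in>UNIV.
        C $ u $ v * (Ri $ (i, v) $ (s, e) * R $ (t, e) $ (b, u))) * X $ s $ t)"
    by (subst ptrace_conj_ent) (auto simp: cen op1_triv x_def y_def op1.rep_eq)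
  also have "\<dots> = (\<Sum>s\<in>UNIV. \<Sum>t\<in>UNIV. if s = a then if t = d then (\<Sum>u\<in>UNIV. \<Sum>v\<in>UNIV. \<Sum>e\<in>UNIV.
        C $ u $ v * (Ri $ (i, v) $ (s, e) * R $ (t, e) $ (b, u))) else 0 else 0)"
    by (intro sum.cong) (auto simp: X_def)
  also have "\<dots> = (\<Sum>u\<in>UNIV. \<Sum>v\<in>UNIV. \<Sum>e\<in>UNIV. C $ u $ v * (Ri $ (i, v) $ (a, e) * R $ (d, e) $ (b, u)))"
    by (subst sum.swap) simp
  also have "ent (ptrace C (Suc 1) (op2 Ri 1 * op1 X 1 * op2 R 1)) x y = ent (ptrace C 1 (op1 X 1)) x y"
    by (simp only: eq)
  also have "\<dots> = (if i = b then \<Sum>s\<in>UNIV. \<Sum>t\<in>UNIV. C $ s $ t * X $ t $ s else 0)"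
    by (auto simp: ptrace.rep_eq x_def y_def op1.rep_eq)
  also have "(\<Sum>s\<in>UNIV. \<Sum>t\<in>UNIV. C $ s $ t * X $ t $ s) = (\<Sum>s\<in>UNIV. \<Sum>t\<in>UNIV. if s = d then if t = a then C $ s $ t else 0 else 0)"
    by (intro sum.cong) (auto simp: X_def)
  also have "\<dots> = C $ d $ a" by (subst sum.swap) simp
  finally show ?thesis by simp
qed

lemma Ri_nth: "Ri $ ij $ kl = R $ ij $ kl - (if ij = kl then q - inverse q else 0)"
  by (simp add: inv_of_def mat_def)

text \<open>
  Since \<open>R\<close> and \<open>R\<^sup>-\<^sup>1\<close> differ by a multiple of the identity, exchanging them changes the trace by a
  multiple of \<open>Tr\<^sub>R\<^sub>(\<^sub>2\<^sub>) (R X\<^sub>1 - X\<^sub>1 R) = 0\<close>.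
\<close>

lemma C_conj2:
  "(\<Sum>u\<in>UNIV. \<Sum>v\<in>UNIV. \<Sum>e\<in>UNIV. C $ u $ v * (R $ (i, v) $ (a, e) * Ri $ (d, e) $ (b, u))) =
   (if i = b then C $ d $ a else 0)"
proof -
  let ?c = "q - inverse q"
  let ?W = "\<Sum>u\<in>UNIV. \<Sum>v\<in>UNIV. \<Sum>e\<in>UNIV. C $ u $ v * (R $ (i, v) $ (a, e) * R $ (d, e) $ (b, u))"
  have 1: "(\<Sum>e\<in>UNIV. C $ u $ v * (Ri $ (i, v) $ (a, e) * R $ (d, e) $ (b, u))) =
     (\<Sum>e\<in>UNIV. C $ u $ v * (R $ (i, v) $ (a, e) * R $ (d, e) $ (b, u))) -
     (if i = a then ?c * (C $ u $ v * R $ (d, v) $ (b, u)) else 0)" for u v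
  proof -
    have "(\<Sum>e\<in>UNIV. C $ u $ v * (Ri $ (i, v) $ (a, e) * R $ (d, e) $ (b, u))) =
     (\<Sum>e\<in>UNIV. C $ u $ v * (R $ (i, v) $ (a, e) * R $ (d, e) $ (b, u)) -
        (if v = e then (if i = a then ?c * (C $ u $ v * R $ (d, e) $ (b, u)) else 0) else 0))"
      by (intro sum.cong) (auto simp: Ri_nth algebra_simps)
    then show ?thesis by (simp add: sum_subtractf)
  qed
  have 2: "(\<Sum>e\<in>UNIV. C $ u $ v * (R $ (i, v) $ (a, e) * Ri $ (d, e) $ (b, u))) =
     (\<Sum>e\<in>UNIV. C $ u $ v * (R $ (i, v) $ (a, e) * R $ (d, e) $ (b, u))) -
     (if d = b then ?c * (C $ u $ v * R $ (i, v) $ (a, u)) else 0)" for u v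
  proof -
    have "(\<Sum>e\<in>UNIV. C $ u $ v * (R $ (i, v) $ (a, e) * Ri $ (d, e) $ (b, u))) =
     (\<Sum>e\<in>UNIV. C $ u $ v * (R $ (i, v) $ (a, e) * R $ (d, e) $ (b, u)) -
        (if e = u then (if d = b then ?c * (C $ u $ v * R $ (i, v) $ (a, e)) else 0) else 0))"
      by (intro sum.cong) (auto simp: Ri_nth algebra_simps)
    then show ?thesis by (simp add: sum_subtractf)
  qed
  have "?W - (if i = a \<and> d = b then ?c else 0) = (if i = b then C $ d $ a else 0)"
    unfolding C_conj1[symmetric] 1
    by (cases "i = a"; cases "d = b") (simp_all add: sum_subtractf sum_distrib_left[symmetric] C_R)
  moreover have "(\<Sum>u\<in>UNIV. \<Sum>v\<in>UNIV. \<Sum>e\<in>UNIV. C $ u $ v * (R $ (i, v) $ (a, e) * Ri $ (d, e) $ (b, u))) =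
      ?W - (if i = a \<and> d = b then ?c else 0)"
    unfolding 2
    by (cases "i = a"; cases "d = b") (simp_all add: sum_subtractf sum_distrib_left[symmetric] C_R)
  ultimately show ?thesis by simp
qed

text \<open>
  In invariant form \<open>C\<^sub>2 R\<^sup>-\<^sup>1 = \<Psi>\<^sub>2\<^sub>1 C\<^sub>1\<close>, and in the next lemma \<open>R\<^sup>-\<^sup>1 C\<^sub>2 = C\<^sub>1 \<Psi>\<^sub>2\<^sub>1\<close>: contract the two
  conjugation identities with \<open>\<Psi>\<close>, which cancels the factor \<open>R\<close>.
\<close>

lemma C_Ri: "(\<Sum>v\<in>UNIV. C $ l $ v * Ri $ (i, v) $ (a, j)) = (\<Sum>r\<in>UNIV. \<Psi> $ (l, i) $ (j, r) * C $ r $ a)"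
proof -
  let ?F = "\<lambda>u e. \<Sum>v\<in>UNIV. C $ u $ v * Ri $ (i, v) $ (a, e)"
  have "(\<Sum>u\<in>UNIV. \<Sum>v\<in>UNIV. \<Sum>e\<in>UNIV. C $ u $ v * (Ri $ (i, v) $ (a, e) * R $ (r, e) $ (b, u))) =
    (\<Sum>u\<in>UNIV. \<Sum>e\<in>UNIV. R $ (r, e) $ (b, u) * ?F u e)" for r b
  proof (rule sum.cong[OF refl])
    fix u
    have "(\<Sum>v\<in>UNIV. \<Sum>e\<in>UNIV. C $ u $ v * (Ri $ (i, v) $ (a, e) * R $ (r, e) $ (b, u))) =
      (\<Sum>e\<in>UNIV. \<Sum>v\<in>UNIV. C $ u $ v * (Ri $ (i, v) $ (a, e) * R $ (r, e) $ (b, u)))"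
      by (rule sum.swap)
    then show "(\<Sum>v\<in>UNIV. \<Sum>e\<in>UNIV. C $ u $ v * (Ri $ (i, v) $ (a, e) * R $ (r, e) $ (b, u))) =
      (\<Sum>e\<in>UNIV. R $ (r, e) $ (b, u) * ?F u e)" by (simp add: sum_distrib_left mult_ac)
  qed
  then have "(\<Sum>r\<in>UNIV. \<Sum>b\<in>UNIV. \<Psi> $ (l, b) $ (j, r) * (if i = b then C $ r $ a else 0)) =
     (\<Sum>(r, b)\<in>UNIV. \<Sum>(u, e)\<in>UNIV. (\<Psi> $ (l, b) $ (j, r) * R $ (r, e) $ (b, u)) * ?F u e)"
    unfolding C_conj1[symmetric] sum_UNIV_prod prod.case by (simp add: sum_distrib_left mult.assoc)
  also have "\<dots> = (\<Sum>(u, e)\<in>UNIV. \<Sum>(r, b)\<in>UNIV. (\<Psi> $ (l, b) $ (j, r) * R $ (r, e) $ (b, u)) * ?F u e)"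
    unfolding split_def by (rule sum.swap)
  also have "\<dots> = (\<Sum>(u, e)\<in>UNIV. (if j = e \<and> l = u then 1 else 0) * ?F u e)"
    unfolding skew2[symmetric] sum_UNIV_prod sum_distrib_right prod.case ..
  also have "\<dots> = (\<Sum>ue\<in>UNIV. if ue = (l, j) then ?F l j else 0)"
    by (rule sum.cong[OF refl]) (simp split: prod.splits)
  finally show ?thesis by (simp add: mult_delta_right)
qed

lemma Ri_C: "(\<Sum>u\<in>UNIV. Ri $ (d, l) $ (b, u) * C $ u $ j) = (\<Sum>a\<in>UNIV. C $ d $ a * \<Psi> $ (l, a) $ (j, b))"
proof -
  let ?G = "\<lambda>e v. \<Sum>u\<in>UNIV. Ri $ (d, e) $ (b, u) * C $ u $ v"
  have "(\<Sum>i\<in>UNIV. \<Sum>a\<in>UNIV. \<Psi> $ (l, a) $ (j, i) * (if i = b then C $ d $ a else 0)) =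
     (\<Sum>(i, a)\<in>UNIV. \<Sum>(v, e)\<in>UNIV. (\<Psi> $ (l, a) $ (j, i) * R $ (i, v) $ (a, e)) * ?G e v)"
  proof -
    have "(\<Sum>u\<in>UNIV. \<Sum>v\<in>UNIV. \<Sum>e\<in>UNIV. C $ u $ v * (R $ (i, v) $ (a, e) * Ri $ (d, e) $ (b, u))) =
      (\<Sum>v\<in>UNIV. \<Sum>e\<in>UNIV. R $ (i, v) $ (a, e) * ?G e v)" for i a
    proof -
      have "(\<Sum>u\<in>UNIV. \<Sum>v\<in>UNIV. \<Sum>e\<in>UNIV. C $ u $ v * (R $ (i, v) $ (a, e) * Ri $ (d, e) $ (b, u))) =
        (\<Sum>v\<in>UNIV. \<Sum>u\<in>UNIV. \<Sum>e\<in>UNIV. C $ u $ v * (R $ (i, v) $ (a, e) * Ri $ (d, e) $ (b, u)))"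
        by (rule sum.swap)
      also have "\<dots> = (\<Sum>v\<in>UNIV. \<Sum>e\<in>UNIV. \<Sum>u\<in>UNIV. C $ u $ v * (R $ (i, v) $ (a, e) * Ri $ (d, e) $ (b, u)))"
        by (rule sum.cong[OF refl], rule sum.swap)
      finally show ?thesis by (simp add: sum_distrib_left mult_ac)
    qed
    then show ?thesis
      unfolding C_conj2[symmetric] sum_UNIV_prod prod.case by (simp add: sum_distrib_left mult.assoc)
  qed
  also have "\<dots> = (\<Sum>(v, e)\<in>UNIV. \<Sum>(i, a)\<in>UNIV. (\<Psi> $ (l, a) $ (j, i) * R $ (i, v) $ (a, e)) * ?G e v)"
    unfolding split_def by (rule sum.swap)
  also have "\<dots> = (\<Sum>(v, e)\<in>UNIV. (if j = v \<and> l = e then 1 else 0) * ?G e v)"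
    unfolding skew2[symmetric] sum_UNIV_prod sum_distrib_right prod.case ..
  also have "\<dots> = (\<Sum>ve\<in>UNIV. if ve = (j, l) then ?G l j else 0)"
    by (rule sum.cong[OF refl]) (simp split: prod.splits)
  finally have "(\<Sum>i\<in>UNIV. \<Sum>a\<in>UNIV. \<Psi> $ (l, a) $ (j, i) * (if i = b then C $ d $ a else 0)) = ?G l j" by simp
  then show ?thesis by (subst (asm) sum.swap) (simp add: mult_delta_right mult.commute)
qed

definition C_C :: "('n, 'a) op2" where "C_C = (\<chi> il jk. C $ fst il $ fst jk * C $ snd il $ snd jk)"

text \<open>
  Both \<open>C\<^sub>1 C\<^sub>2 R\<^sup>-\<^sup>1\<close> and \<open>R\<^sup>-\<^sup>1 C\<^sub>2 C\<^sub>1\<close> are equal to \<open>C\<^sub>1 \<Psi>\<^sub>2\<^sub>1 C\<^sub>1\<close>.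
\<close>

lemma C_C_comm: "C_C ** R = R ** C_C"
proof -
  have "(C_C ** Ri) $ (i, l) $ (a, j) = (Ri ** C_C) $ (i, l) $ (a, j)" for i l a j
  proof -
    have "(C_C ** Ri) $ (i, l) $ (a, j) = (\<Sum>s\<in>UNIV. C $ i $ s * (\<Sum>v\<in>UNIV. C $ l $ v * Ri $ (s, v) $ (a, j)))"
      by (simp add: matrix_matrix_mult_def C_C_def sum_UNIV_prod sum_distrib_left mult.assoc)
    also have "\<dots> = (\<Sum>r\<in>UNIV. (\<Sum>s\<in>UNIV. C $ i $ s * \<Psi> $ (l, s) $ (j, r)) * C $ r $ a)"
      unfolding C_Ri sum_distrib_left sum_distrib_right by (subst sum.swap) (simp add: mult.assoc)
    also have "\<dots> = (Ri ** C_C) $ (i, l) $ (a, j)"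
      unfolding Ri_C[symmetric]
      by (simp add: matrix_matrix_mult_def C_C_def sum_UNIV_prod sum_distrib_right sum_distrib_left mult_ac)
    finally show ?thesis .
  qed
  then have "C_C ** Ri = Ri ** C_C" by (simp add: vec_eq_iff)
  moreover have "C_C ** mat c = mat c ** C_C" for c
    by (simp add: vec_eq_iff matrix_matrix_mult_def mat_def mult_delta_right mult_delta_left mult.commute)
  moreover have "R = Ri + mat (q - inverse q)" by (simp add: inv_of_def)
  moreover have "(A + B) ** M = A ** M + B ** M" for A B M :: "('n, 'a) op2"
    by (simp add: vec_eq_iff matrix_matrix_mult_def distrib_right sum.distrib)
  ultimately show ?thesis by (metis matrix_add_ldistrib)
qed

end

context skew_rep
begin

lemma T_one: "T k 1 = smult (\<Sum>a\<in>UNIV. C $ a $ a) 1"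
proof (rule rfm_eqI)
  fix x y :: "nat \<Rightarrow> 'n"
  show "ent (T k 1) x y = ent (smult (\<Sum>a\<in>UNIV. C $ a $ a) 1) x y"
  proof (cases "x k = y k")
    case True
    have "x(k := b) = y(k := a) \<longleftrightarrow> a = b \<and> x = y" for a b
      using True by (metis fun_upd_eqD fun_upd_triv fun_upd_upd)
    then show ?thesis using True
      by (auto simp: ptrace.rep_eq ent_simps ent_smult \<sigma>_sum mult_delta_right)
  qed (auto simp: ptrace.rep_eq ent_simps ent_smult)
qed

lemma T_copy:
  assumes X: "X \<in> triv_at (Suc k)"
  shows "T (Suc k) (S k * X * (S k - smult (q - inverse q) 1)) = T k X"
  unfolding S_op_inv[symmetric]
proof (rule rfm_eqI)
  fix x y :: "nat \<Rightarrow> 'n"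
  show "ent (T (Suc k) (S k * X * S_op Ri k)) x y = ent (T k X) x y"
  proof (cases "x (Suc k) = y (Suc k)")
    case True
    have "ent (T (Suc k) (S k * X * S_op Ri k)) x y =
      (\<Sum>a\<in>UNIV. \<Sum>d\<in>UNIV. \<sigma> (\<Sum>u\<in>UNIV. \<Sum>v\<in>UNIV. \<Sum>e\<in>UNIV.
        C $ u $ v * (R $ (x k, v) $ (a, e) * Ri $ (d, e) $ (y k, u))) * ent X (x(k := a)) (y(k := d)))"
      unfolding S_op_def
      by (subst ptrace_conj_ent[where x = x and y = y]) (use X True in \<open>simp_all add: \<sigma>_centr \<sigma>_sum \<sigma>_mult\<close>)
    also have "\<dots> = (\<Sum>a\<in>UNIV. \<Sum>d\<in>UNIV. if x k = y k then \<sigma> (C $ d $ a) * ent X (x(k := a)) (y(k := d)) else 0)"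
      by (simp only: C_conj2) (intro sum.cong refl, simp)
    also have "\<dots> = ent (T k X) x y"
      by (subst sum.swap) (simp add: ptrace.rep_eq)
    finally show ?thesis .
  next
    case False
    have "ent X (x(k := b)) (y(k := a)) = 0" for a b
      using triv_at_zero[OF X, of "x(k := b)" "y(k := a)"] False by simp
    then show ?thesis using False by (simp add: ptrace.rep_eq)
  qed
qed

lemma T_cyc: "T k (T (Suc k) (S k * X)) = T k (T (Suc k) (X * S k))"
proof -
  let ?c = "\<lambda>k. op1 (mapm \<sigma> C) k :: ('n, 'b) lop"
  let ?K = "op2 (mapm \<sigma> C_C) k :: ('n, 'b) lop"
  have K: "?c k * ?c (Suc k) = ?K"
  proof (rule rfm_eqI)
    fix x y :: "nat \<Rightarrow> 'n"
    have ag: "agree_off (Suc k) (x(k := a)) y \<longleftrightarrow> a = y k \<and> agree_off2 k x y" for a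
      unfolding agree_off_def agree_off2_def by (metis fun_upd_apply n_not_Suc_n)
    have "\<sigma> (C $ x k $ a) * ent (?c (Suc k)) (x(k := a)) y =
        (if a = y k then (if agree_off2 k x y then \<sigma> (C $ x k $ y k) * \<sigma> (C $ x (Suc k) $ y (Suc k)) else 0) else 0)" for a
      unfolding op1.rep_eq ag by simp
    then show "ent (?c k * ?c (Suc k)) x y = ent ?K x y"
      by (simp add: op1_mult op2.rep_eq get_pair_def C_C_def \<sigma>_mult)
  qed
  have e: "T k (T (Suc k) Z) = ptrace0 k (ptrace0 (Suc k) (?K * Z))" for Z
  proof -
    have "T k (T (Suc k) Z) = ptrace0 k (?c k * ptrace0 (Suc k) (?c (Suc k) * Z))"
      by (simp add: ptrace_ptrace0[of "mapm \<sigma> C"])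
    also have "?c k * ptrace0 (Suc k) (?c (Suc k) * Z) = ptrace0 (Suc k) (?c k * (?c (Suc k) * Z))"
      by (rule ptrace_lmult[symmetric]) (auto intro: op1_triv centr_mat)
    finally show ?thesis by (simp add: mult.assoc[symmetric] K)
  qed
  have KS: "?K * S k = S k * ?K"
    by (simp add: S_op_def op2_hom[symmetric] mapm_mult[symmetric] C_C_comm)
  have "ptrace0 k (ptrace0 (Suc k) (?K * (S k * X))) = ptrace0 k (ptrace0 (Suc k) (S k * (?K * X)))"
    by (simp only: mult.assoc[symmetric] KS)
  also have "\<dots> = ptrace0 k (ptrace0 (Suc k) (?K * X * S k))"
    unfolding S_op_def by (rule ptrace0_cyc) (simp add: \<sigma>_centr)
  finally show ?thesis by (simp add: e mult.assoc)
qed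

end

section \<open>The free algebra and its ideals\<close>

lemma poly_mapping_add_induct [case_names zero single add]:
  assumes "P 0" "\<And>k c. P (Poly_Mapping.single k c)" "\<And>f g. P f \<Longrightarrow> P g \<Longrightarrow> P (f + g)"
  shows "P (f :: 'k \<Rightarrow>\<^sub>0 'c::monoid_add)"
proof (induction f rule: update_induct)
  case const
  show ?case by (rule assms(1))
next
  case (update f a b)
  have "Poly_Mapping.update a b f = f + Poly_Mapping.single a b"
    by (rule poly_mapping_eqI)
       (use update(1) in \<open>auto simp: lookup_update lookup_add lookup_single when_def in_keys_iff\<close>)
  then show ?case using assms update by metis
qed

lemma list_zero [simp]: "(0 :: 'x list) = []" by (simp add: zero_list_def)
lemma list_plus [simp]: "(xs :: 'x list) + ys = xs @ ys" by (simp add: plus_list_def)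

lemma scal_single: "scal c * Poly_Mapping.single w d = (Poly_Mapping.single w (c * d) :: ('x, 'a::ring_1) free_alg)"
  "Poly_Mapping.single w d * scal c = (Poly_Mapping.single w (d * c) :: ('x, 'a::ring_1) free_alg)"
  by (simp_all add: scal_def mult_single)

lemma scal_hom: "scal (a + b) = scal a + (scal b :: ('x, 'a::ring_1) free_alg)"
  "scal (a * b) = scal a * (scal b :: ('x, 'a) free_alg)"
  "scal 1 = (1 :: ('x, 'a) free_alg)" "scal 0 = (0 :: ('x, 'a) free_alg)"
  by (simp_all add: scal_def single_add mult_single single_one[symmetric])

lemma scal_centr: "centr (scal c :: ('x, 'a::field) free_alg)"
  unfolding centr_def
proof
  fix f :: "('x, 'a) free_alg"
  show "scal c * f = f * scal c"
    by (induction f rule: poly_mapping_add_induct) (simp_all add: scal_single mult.commute algebra_simps)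
qed

lemma scal_ser_map: "scalar_map (scal_ser :: 'a::field \<Rightarrow> ('x, 'a) free_alg fps)"
proof
  show "centr (scal_ser a :: ('x, 'a) free_alg fps)" for a
    using scal_centr[of a] by (auto simp: centr_def scal_ser_def fps_eq_iff)
qed (simp_all add: scal_ser_def scal_hom)

lemma ring_of_ring_1: "ring (ring_of_type_algebra :: 'r::ring_1 ring)"
proof -
  have "\<exists>y. x + y = 0" for x :: 'r using add.right_inverse by blast
  then show ?thesis unfolding ring_of_type_algebra_def using add.right_inverse
    by unfold_locales (auto simp: algebra_simps Units_def)
qed

lemma ring_of_simps: "carrier ring_of_type_algebra = UNIV" "x \<otimes>\<^bsub>ring_of_type_algebra\<^esub> y = x * y"
  "x \<oplus>\<^bsub>ring_of_type_algebra\<^esub> y = x + y" "\<zero>\<^bsub>ring_of_type_algebra\<^esub> = 0" "\<one>\<^bsub>ring_of_type_algebra\<^esub> = 1"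
  by (simp_all add: ring_of_type_algebra_def)

lemma rel_ideal_ideal: "ideal (rel_ideal S) ring_of_type_algebra"
  unfolding rel_ideal_def by (rule ring.genideal_ideal[OF ring_of_ring_1]) (simp add: ring_of_simps)

lemma rel_ideal:
  fixes S :: "('x, 'a::ring_1) free_alg set"
  shows "x \<in> S \<Longrightarrow> x \<in> rel_ideal S" "0 \<in> rel_ideal S"
  "x \<in> rel_ideal S \<Longrightarrow> y \<in> rel_ideal S \<Longrightarrow> x + y \<in> rel_ideal S"
  "x \<in> rel_ideal S \<Longrightarrow> a * x \<in> rel_ideal S" "x \<in> rel_ideal S \<Longrightarrow> x * a \<in> rel_ideal S"
proof -
  interpret ideal "rel_ideal S" "ring_of_type_algebra :: ('x, 'a) free_alg ring"
    by (rule rel_ideal_ideal)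
  show "x \<in> S \<Longrightarrow> x \<in> rel_ideal S"
    unfolding rel_ideal_def using ring.genideal_self[OF ring_of_ring_1, of S] by (auto simp: ring_of_simps)
  show "0 \<in> rel_ideal S" using additive_subgroup.zero_closed[OF is_additive_subgroup] by (simp add: ring_of_simps)
  show "x \<in> rel_ideal S \<Longrightarrow> y \<in> rel_ideal S \<Longrightarrow> x + y \<in> rel_ideal S"
    using additive_subgroup.a_closed[OF is_additive_subgroup, of x y] by (simp add: ring_of_simps)
  show "x \<in> rel_ideal S \<Longrightarrow> a * x \<in> rel_ideal S" using I_l_closed[of x a] by (simp add: ring_of_simps)
  show "x \<in> rel_ideal S \<Longrightarrow> x * a \<in> rel_ideal S" using I_r_closed[of x a] by (simp add: ring_of_simps)
qed

lemma rel_ideal_least: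
  fixes S K :: "('x, 'a::ring_1) free_alg set"
  assumes "S \<subseteq> K" "0 \<in> K" "\<And>x y. x \<in> K \<Longrightarrow> y \<in> K \<Longrightarrow> x + y \<in> K" "\<And>x. x \<in> K \<Longrightarrow> - x \<in> K"
    "\<And>a x. x \<in> K \<Longrightarrow> a * x \<in> K" "\<And>a x. x \<in> K \<Longrightarrow> x * a \<in> K"
  shows "rel_ideal S \<subseteq> K"
proof -
  interpret ring "ring_of_type_algebra :: ('x, 'a) free_alg ring" by (rule ring_of_ring_1)
  have "ideal K ring_of_type_algebra"
  proof (rule idealI)
    show "subgroup K (add_monoid ring_of_type_algebra)"
    proof (rule group.subgroupI[OF a_group])
      fix x assume "x \<in> K"
      moreover have "inv\<^bsub>add_monoid ring_of_type_algebra\<^esub> x = - x"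
        using minus_equality[of "- x" x] by (simp add: ring_of_simps a_inv_def)
      ultimately show "inv\<^bsub>add_monoid ring_of_type_algebra\<^esub> x \<in> K" using assms(4) by simp
    qed (use assms in \<open>auto simp: ring_of_simps\<close>)
  qed (use assms in \<open>auto simp: ring_of_simps ring_of_ring_1\<close>)
  then show ?thesis unfolding rel_ideal_def by (rule genideal_minimal) (rule assms(1))
qed

lemma presented_class_zero:
  fixes S :: "('x, 'a::ring_1) free_alg set"
  shows "f \<in> rel_ideal S \<Longrightarrow> presented_class S f = \<zero>\<^bsub>presented S\<^esub>"
proof -
  interpret ideal "rel_ideal S" "ring_of_type_algebra :: ('x, 'a) free_alg ring"
    by (rule rel_ideal_ideal)
  assume "f \<in> rel_ideal S"
  then show ?thesis by (simp add: presented_class_def presented_def FactRing_def a_rcos_const)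
qed

definition ser_ideal :: "('x, 'a::ring_1) free_alg set \<Rightarrow> ('x, 'a) free_alg fps set" where
  "ser_ideal S = {f. \<forall>n. fps_nth f n \<in> rel_ideal S}"

lemma rel_ideal_sum: "(\<And>i. i \<in> A \<Longrightarrow> f i \<in> rel_ideal S) \<Longrightarrow> sum f A \<in> rel_ideal S"
  by (induction A rule: infinite_finite_induct) (auto intro: rel_ideal(2,3))

lemma ser_ideal:
  "0 \<in> ser_ideal S" "x \<in> ser_ideal S \<Longrightarrow> y \<in> ser_ideal S \<Longrightarrow> x + y \<in> ser_ideal S"
  "x \<in> ser_ideal S \<Longrightarrow> a * x \<in> ser_ideal S" "x \<in> ser_ideal S \<Longrightarrow> x * a \<in> ser_ideal S"
  by (auto simp: ser_ideal_def fps_mult_nth intro: rel_ideal(2,3) intro!: rel_ideal_sum)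
    (auto intro: rel_ideal(4,5))

lemma ser_ideal_sum: "(\<And>i. i \<in> A \<Longrightarrow> f i \<in> ser_ideal S) \<Longrightarrow> sum f A \<in> ser_ideal S"
  by (induction A rule: infinite_finite_induct) (auto intro: ser_ideal(1,2))

lemma ser_ideal_X: "fps_X * f \<in> ser_ideal S \<Longrightarrow> f \<in> ser_ideal S"
proof -
  assume *: "fps_X * f \<in> ser_ideal S"
  have "fps_nth f n \<in> rel_ideal S" for n
  proof -
    have "fps_nth (fps_X * f) (Suc n) \<in> rel_ideal S"
      using * by (simp only: ser_ideal_def mem_Collect_eq)
    then show ?thesis by simp
  qed
  then show ?thesis by (simp add: ser_ideal_def)
qed

section \<open>Substitution into the defining relations\<close>

definition rescale :: "'a::field \<Rightarrow> ('x, 'a) free_alg fps \<Rightarrow> ('x, 'a) free_alg fps" where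
  "rescale c f = Abs_fps (\<lambda>n. scal (inverse c ^ n) * fps_nth f n)"

definition xi :: "'a::field \<Rightarrow> ('x, 'a) free_alg fps" where "xi d = scal_ser (inverse d) * fps_X"

text \<open>
  Substitution of \<open>c u\<close> for \<open>u\<close> and \<open>d u\<close> for \<open>v\<close>. The outer variable becomes \<open>xi d\<close>, which stands for
  \<open>(d u)\<^sup>-\<^sup>1\<close>; its \<open>b\<close>-th power starts in degree \<open>b\<close>, so that each coefficient is a finite sum.
\<close>

definition subst_uv :: "'a::field \<Rightarrow> 'a \<Rightarrow> ('x, 'a) free_alg fps fps \<Rightarrow> ('x, 'a) free_alg fps" where
  "subst_uv c d F = Abs_fps (\<lambda>n. \<Sum>b\<le>n. fps_nth (rescale c (fps_nth F b) * xi d ^ b) n)"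

lemma rescale_add: "rescale c (f + g) = rescale c f + rescale c g"
  by (simp add: rescale_def fps_eq_iff distrib_left)

lemma rescale_mult: "rescale c (f * g) = rescale c f * rescale c g"
proof (rule fps_ext)
  fix n
  have "scal (inverse c ^ n) * (fps_nth f i * fps_nth g (n - i)) =
    scal (inverse c ^ i) * fps_nth f i * (scal (inverse c ^ (n - i)) * fps_nth g (n - i))" if "i \<le> n" for i
  proof -
    have "scal (inverse c ^ n) = scal (inverse c ^ i) * scal (inverse c ^ (n - i))"
      using that by (simp add: scal_hom(2)[symmetric] power_add[symmetric])
    then show ?thesis using scal_centr[of "inverse c ^ (n - i)"] unfolding centr_def by (metis mult.assoc)
  qed
  then show "fps_nth (rescale c (f * g)) n = fps_nth (rescale c f * rescale c g) n"
    by (simp add: rescale_def fps_mult_nth sum_distrib_left)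
qed

lemma rescale_sum: "rescale c (sum f A) = (\<Sum>i\<in>A. rescale c (f i))"
proof (induction A rule: infinite_finite_induct)
qed (simp_all add: rescale_add, simp_all add: rescale_def fps_eq_iff)

lemma centr_mult: "centr a \<Longrightarrow> centr b \<Longrightarrow> centr (a * b)"
  unfolding centr_def by (metis mult.assoc)
lemma centr_power: "centr a \<Longrightarrow> centr (a ^ n)"
proof (induction n)
  case 0
  show ?case by (simp add: centr_def)
next
  case (Suc n)
  then show ?case unfolding power_Suc by (intro centr_mult)
qed

lemma fps_X_centr: "centr (fps_X :: 'r::ring_1 fps)"
  by (simp add: centr_def fps_mult_fps_X_commute)

lemma scal_ser_centr: "centr (scal_ser a :: ('x, 'a::field) free_alg fps)"
  using scalar_map.\<sigma>_centr[OF scal_ser_map] .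

lemma xi_centr: "centr (xi d)" unfolding xi_def by (intro centr_mult scal_ser_centr fps_X_centr)

lemma xi_power: "(xi d :: ('x, 'a::field) free_alg fps) ^ b = scal_ser (inverse d ^ b) * fps_X ^ b"
proof (induction b)
  case (Suc b)
  have "(xi d :: ('x, 'a) free_alg fps) ^ Suc b = xi d * (scal_ser (inverse d ^ b) * fps_X ^ b)" by (simp only: power_Suc Suc)
  also have "\<dots> = scal_ser (inverse d) * (fps_X * scal_ser (inverse d ^ b)) * fps_X ^ b"
    by (simp only: xi_def mult.assoc)
  also have "fps_X * scal_ser (inverse d ^ b) = (scal_ser (inverse d ^ b) * fps_X :: ('x, 'a) free_alg fps)"
    using fps_X_centr unfolding centr_def by metis
  also have "scal_ser (inverse d) * (scal_ser (inverse d ^ b) * fps_X) * fps_X ^ b =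
      (scal_ser (inverse d) * scal_ser (inverse d ^ b)) * (fps_X * fps_X ^ b :: ('x, 'a) free_alg fps)"
    by (simp only: mult.assoc)
  also have "\<dots> = scal_ser (inverse d ^ Suc b) * fps_X ^ Suc b"
    by (simp only: scalar_map.\<sigma>_mult[OF scal_ser_map, symmetric] power_Suc)
  finally show ?case .
qed (simp add: scalar_map.\<sigma>_one[OF scal_ser_map])

lemma mult_xi_power_nth: "fps_nth (f * xi d ^ b) n = (if n < b then 0 else fps_nth (f * scal_ser (inverse d ^ b)) (n - b))"
  by (simp add: xi_power mult.assoc[symmetric] fps_X_power_mult_right_nth)

lemma subst_uv_nth:
  "n \<le> N \<Longrightarrow> fps_nth (subst_uv c d F) n = fps_nth (\<Sum>b\<le>N. rescale c (fps_nth F b) * xi d ^ b) n"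
  unfolding subst_uv_def fps_sum_nth fps_nth_Abs_fps
  by (rule sum.mono_neutral_left) (auto simp: mult_xi_power_nth)

lemma subst_uv_add: "subst_uv c d (F + G) = subst_uv c d F + subst_uv c d G"
  by (simp add: subst_uv_def fps_eq_iff rescale_add distrib_right sum.distrib)

text \<open>
  Up to degree \<open>n\<close> both factors agree with polynomials in the central element \<open>xi d\<close>, and the products
  of their terms of total degree beyond \<open>n\<close> do not contribute.
\<close>

lemma subst_uv_mult: "subst_uv c d (F * G) = subst_uv c d F * subst_uv c d G"
proof (rule fps_ext)
  fix n
  let ?f = "\<lambda>i. rescale c (fps_nth F i)" and ?g = "\<lambda>i. rescale c (fps_nth G i)" and ?x = "xi d"
  let ?t = "\<lambda>i j. fps_nth (?f i * ?g j * ?x ^ (i + j)) n"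
  have t: "?f i * ?x ^ i * (?g j * ?x ^ j) = ?f i * ?g j * ?x ^ (i + j)" for i j
  proof -
    have "?x ^ i * ?g j = ?g j * ?x ^ i" using centr_power[OF xi_centr] unfolding centr_def by metis
    then have "?f i * ?x ^ i * (?g j * ?x ^ j) = ?f i * (?g j * ?x ^ i) * ?x ^ j" by (metis mult.assoc)
    then show ?thesis by (simp add: power_add mult.assoc)
  qed
  have "rescale c (fps_nth (F * G) b) * ?x ^ b = (\<Sum>i\<le>b. ?f i * ?g (b - i) * ?x ^ (i + (b - i)))" for b
    by (simp add: fps_mult_nth atLeast0AtMost rescale_sum rescale_mult sum_distrib_right)
  then have "fps_nth (subst_uv c d (F * G)) n = (\<Sum>b\<le>n. \<Sum>i\<le>b. ?t i (b - i))"
    by (simp only: subst_uv_def fps_nth_Abs_fps fps_sum_nth)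
  also have "\<dots> = (\<Sum>(i, j)\<in>{(i, j). i + j \<le> n}. ?t i j)"
    by (rule sum.triangle_reindex_eq[symmetric])
  also have "\<dots> = (\<Sum>(i, j)\<in>{..n} \<times> {..n}. ?t i j)"
    by (rule sum.mono_neutral_left) (auto simp: mult_xi_power_nth split: if_splits)
  also have "\<dots> = fps_nth ((\<Sum>i\<le>n. ?f i * ?x ^ i) * (\<Sum>j\<le>n. ?g j * ?x ^ j)) n"
    by (simp add: sum_product t fps_sum_nth sum.cartesian_product split_def)
  also have "\<dots> = fps_nth (subst_uv c d F * subst_uv c d G) n"
    by (simp add: fps_mult_nth subst_uv_nth[of _ n])
  finally show "fps_nth (subst_uv c d (F * G)) n = fps_nth (subst_uv c d F * subst_uv c d G) n" .
qed

lemma rescale_0 [simp]: "rescale c 0 = 0" by (simp add: rescale_def fps_eq_iff)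
lemma rescale_1 [simp]: "rescale c 1 = 1" by (simp add: rescale_def fps_eq_iff scal_hom)

lemma subst_uv_const: "subst_uv c d (fps_const f) = rescale c f"
proof (rule fps_ext)
  fix n
  have "fps_nth (subst_uv c d (fps_const f)) n = (\<Sum>b\<le>n. if b = 0 then fps_nth (rescale c f) n else 0)"
    unfolding subst_uv_def fps_nth_Abs_fps by (rule sum.cong) auto
  then show "fps_nth (subst_uv c d (fps_const f)) n = fps_nth (rescale c f) n" by simp
qed

lemma subst_uv_X: "subst_uv c d fps_X = xi d"
proof (rule fps_ext)
  fix n
  have "fps_nth (subst_uv c d fps_X) n = (\<Sum>b\<le>n. if b = 1 then fps_nth (xi d) n else 0)"
    unfolding subst_uv_def fps_nth_Abs_fps by (rule sum.cong) (auto simp: fps_X_def)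
  then show "fps_nth (subst_uv c d fps_X) n = fps_nth (xi d) n"
    by (cases n) (auto simp: xi_def)
qed

lemma subst_uv_0 [simp]: "subst_uv c d 0 = 0" using subst_uv_const[of c d 0] by simp
lemma subst_uv_1 [simp]: "subst_uv c d 1 = 1" using subst_uv_const[of c d 1] by simp
lemma subst_uv_minus: "subst_uv c d (- F) = - subst_uv c d F"
  using subst_uv_add[of c d F "- F"] by (simp add: eq_neg_iff_add_eq_0 add.commute)
lemma subst_uv_diff: "subst_uv c d (F - G) = subst_uv c d F - subst_uv c d G"
  using subst_uv_add[of c d F "- G"] by (simp add: subst_uv_minus)
lemma subst_uv_scal: "subst_uv c d (scal_uv a) = scal_ser a"
  by (simp add: scal_uv_def subst_uv_const) (simp add: rescale_def scal_ser_def fps_eq_iff scal_hom)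

lemma subst_uv_L_u: "subst_uv c d (L_u $ i $ j) = L_at c $ i $ j"
  by (simp add: L_u_def L_at_def subst_uv_const) (simp add: rescale_def)

lemma subst_uv_L_v:
  fixes i j :: "'n::finite" and c d :: "'a::field"
  shows "subst_uv c d (L_v $ i $ j) = L_at d $ i $ j"
proof (rule fps_ext)
  fix n
  have "fps_nth (rescale c (fps_const (L_coeff b $ i $ j)) * xi d ^ b) n =
     (if b = n then scal (inverse d ^ n) * L_coeff n $ i $ j else 0)" if "b \<le> n" for b
  proof -
    have "rescale c (fps_const f) = fps_const f" for f :: "('n \<times> 'n \<times> nat, 'a) free_alg"
      by (simp add: rescale_def fps_eq_iff scal_hom)
    moreover have "f * scal (inverse d ^ n) = scal (inverse d ^ n) * f" for f :: "('n \<times> 'n \<times> nat, 'a) free_alg"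
      using scal_centr unfolding centr_def by metis
    ultimately show ?thesis using that by (auto simp: mult_xi_power_nth scal_ser_def)
  qed
  then have "fps_nth (subst_uv c d (L_v $ i $ j)) n = (\<Sum>b\<le>n. if b = n then scal (inverse d ^ n) * L_coeff n $ i $ j else 0)"
    by (simp add: subst_uv_def L_v_def)
  then show "fps_nth (subst_uv c d (L_v $ i $ j)) n = fps_nth (L_at d $ i $ j) n"
    by (simp add: L_at_def)
qed

lemma subst_uv_ideal:
  assumes "\<And>a b. fps_nth (fps_nth F b) a \<in> rel_ideal S"
  shows "subst_uv c d F \<in> ser_ideal S"
proof -
  have "rescale c (fps_nth F b) \<in> ser_ideal S" for b
    using assms by (auto simp: ser_ideal_def rescale_def intro: rel_ideal)
  then have "rescale c (fps_nth F b) * xi d ^ b \<in> ser_ideal S" for b by (rule ser_ideal)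
  then show ?thesis by (auto simp: ser_ideal_def subst_uv_def intro!: rel_ideal_sum)
qed

lemma tens_map_hom:
  fixes as :: "('n, 'b::semiring_1) tens list" and f :: "'b \<Rightarrow> 'c::semiring_1"
  assumes "f 0 = 0" "f 1 = 1" "\<And>x y. f (x + y) = f x + f y" "\<And>x y. f (x * y) = f x * f y"
  shows "tens_map f (tens_prod n as) = tens_prod n (map (tens_map f) as)"
proof -
  have s: "f (sum g A) = (\<Sum>i\<in>A. f (g i))" for g :: "'z \<Rightarrow> _" and A
    by (induction A rule: infinite_finite_induct) (simp_all add: assms)
  have "tens_map f (tens_mult n a b) = tens_mult n (tens_map f a) (tens_map f b)" for a b :: "('n, 'b) tens"
    by (simp add: tens_map_def tens_mult_def fun_eq_iff s assms)
  moreover have "tens_map f (tens_id :: ('n, 'b) tens) = tens_id" by (auto simp: tens_map_def tens_id_def fun_eq_iff assms)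
  ultimately show ?thesis by (induction as) (simp_all add: tens_prod_def)
qed

section \<open>The bi-rank and the vanishing of a skew-symmetrizer\<close>

lemma field_of_field: "Ring.field (ring_of_type_algebra :: 'a::field ring)"
  by (rule field_from_type_algebra)

context
  fixes S :: "('x, 'a::field) free_alg set"
begin

lemma class_hom:
  "presented_class S (f + g) = presented_class S f \<oplus>\<^bsub>presented S\<^esub> presented_class S g"
  "presented_class S (f * g) = presented_class S f \<otimes>\<^bsub>presented S\<^esub> presented_class S g"
  "presented_class S 1 = \<one>\<^bsub>presented S\<^esub>" "presented_class S f \<in> carrier (presented S)"
proof -
  have *: "(+>\<^bsub>ring_of_type_algebra\<^esub>) (rel_ideal S) \<in> ring_hom ring_of_type_algebra (presented S)"
    unfolding presented_def by (rule ideal.rcos_ring_hom[OF rel_ideal_ideal])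
  show "presented_class S (f + g) = presented_class S f \<oplus>\<^bsub>presented S\<^esub> presented_class S g"
    "presented_class S (f * g) = presented_class S f \<otimes>\<^bsub>presented S\<^esub> presented_class S g"
    "presented_class S 1 = \<one>\<^bsub>presented S\<^esub>" "presented_class S f \<in> carrier (presented S)"
    using ring_hom_add[OF *, of f g] ring_hom_mult[OF *, of f g] ring_hom_one[OF *] ring_hom_closed[OF *, of f]
    by (simp_all add: presented_class_def ring_of_simps)
qed

lemma class_zero_iff: "presented_class S f = \<zero>\<^bsub>presented S\<^esub> \<longleftrightarrow> f \<in> rel_ideal S"
proof
  interpret ideal "rel_ideal S" "ring_of_type_algebra :: ('x, 'a) free_alg ring"
    by (rule rel_ideal_ideal)
  assume "presented_class S f = \<zero>\<^bsub>presented S\<^esub>"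
  then have "rel_ideal S +>\<^bsub>ring_of_type_algebra\<^esub> f = rel_ideal S"
    by (simp add: presented_class_def presented_def FactRing_def)
  then show "f \<in> rel_ideal S"
    using a_rcos_self[of f] by (simp add: ring_of_simps)
qed (rule presented_class_zero)

lemma presented_ring: "ring (presented S)"
  unfolding presented_def by (rule ideal.quotient_is_ring[OF rel_ideal_ideal])

lemma Span_words:
  "ring.Span (presented S) (presented_class S ` range scal)
     (map (\<lambda>w. presented_class S (Poly_Mapping.single w 1)) ws) =
   presented_class S ` {f. Poly_Mapping.keys f \<subseteq> set ws}"
proof (induction ws)
  case Nil
  have "{f :: ('x, 'a) free_alg. Poly_Mapping.keys f \<subseteq> {}} = {0}" by auto
  then show ?case by (simp add: ring.Span.simps[OF presented_ring] presented_class_zero[OF rel_ideal(2)])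
next
  case (Cons w ws)
  interpret ring "presented S" by (rule presented_ring)
  let ?cls = "presented_class S"
  have "line_extension (?cls ` range scal) (?cls (Poly_Mapping.single w 1)) (?cls ` {f. Poly_Mapping.keys f \<subseteq> set ws}) =
     {?cls (Poly_Mapping.single w c + f) | c f. Poly_Mapping.keys f \<subseteq> set ws}"
    unfolding line_extension_def set_add_def r_coset_def set_mult_def
    by (auto simp: class_hom(1,2)[symmetric] scal_single intro!: exI)
  also have "\<dots> = ?cls ` {f. Poly_Mapping.keys f \<subseteq> set (w # ws)}"
  proof (intro equalityI subsetI)
    fix z assume "z \<in> {?cls (Poly_Mapping.single w c + f) | c f. Poly_Mapping.keys f \<subseteq> set ws}"
    then obtain c f where z: "z = ?cls (Poly_Mapping.single w c + f)" "Poly_Mapping.keys f \<subseteq> set ws" by auto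
    have "Poly_Mapping.keys (Poly_Mapping.single w c + f) \<subseteq> set (w # ws)"
      using keys_add[of "Poly_Mapping.single w c" f] z(2) by (auto split: if_splits)
    then show "z \<in> ?cls ` {f. Poly_Mapping.keys f \<subseteq> set (w # ws)}" using z(1) by blast
  next
    fix z assume "z \<in> ?cls ` {f. Poly_Mapping.keys f \<subseteq> set (w # ws)}"
    then obtain f where f: "z = ?cls f" "Poly_Mapping.keys f \<subseteq> set (w # ws)" by auto
    let ?c = "Poly_Mapping.lookup f w"
    let ?g = "f - Poly_Mapping.single w ?c"
    have "Poly_Mapping.keys ?g \<subseteq> set ws"
    proof
      fix v assume "v \<in> Poly_Mapping.keys ?g"
      then have "Poly_Mapping.lookup f v - Poly_Mapping.lookup (Poly_Mapping.single w ?c) v \<noteq> 0"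
        by (simp add: in_keys_iff lookup_minus)
      then have "v \<noteq> w" "Poly_Mapping.lookup f v \<noteq> 0" by (auto simp: lookup_single when_def split: if_splits)
      then show "v \<in> set ws" using f(2) by (auto simp: in_keys_iff)
    qed
    moreover have "z = ?cls (Poly_Mapping.single w ?c + ?g)" using f(1) by simp
    ultimately show "z \<in> {?cls (Poly_Mapping.single w c + f) | c f. Poly_Mapping.keys f \<subseteq> set ws}"
      by (intro CollectI exI[of _ ?c] exI[of _ ?g] conjI)
  qed
  finally show ?case unfolding Cons[symmetric] by simp
qed

text \<open>
  The dimension is a definite description, and it denotes the actual dimension because the words in \<open>W\<close> span
  the space and the scalars map onto a subfield, unless the quotient is the zero ring.
\<close>

lemma dim_zero_imp_in_ideal:
  assumes W: "finite W" and dim: "ring.dim (presented S) (presented_class S ` range scal)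
       (presented_class S ` {f. Poly_Mapping.keys f \<subseteq> W}) = 0"
    and f: "Poly_Mapping.keys f \<subseteq> W"
  shows "f \<in> rel_ideal S"
proof (cases "(1 :: ('x, 'a) free_alg) \<in> rel_ideal S")
  case True
  then show ?thesis using rel_ideal(4)[of 1 S f] by simp
next
  case False
  interpret ring "presented S" by (rule presented_ring)
  let ?cls = "presented_class S" and ?F = "ring_of_type_algebra :: 'a ring"
  have hom: "(\<lambda>c. ?cls (scal c)) \<in> ring_hom ?F (presented S)"
    by (rule ring_hom_memI) (auto simp: ring_of_simps scal_hom class_hom)
  then have "ring_hom_ring ?F (presented S) (\<lambda>c. ?cls (scal c))"
    by (intro ring_hom_ringI2) (auto simp: ring_of_ring_1 presented_ring)
  moreover have "\<one>\<^bsub>presented S\<^esub> \<noteq> \<zero>\<^bsub>presented S\<^esub>"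
    using False class_zero_iff[of 1] by (simp add: class_hom)
  moreover have "subfield (carrier ?F) ?F"
    by (rule field.carrier_is_subfield[OF field_of_field])
  ultimately have "subfield ((\<lambda>c. ?cls (scal c)) ` carrier ?F) (presented S)"
    using ring_hom_ring.img_is_subfield(2) by metis
  then have sub: "subfield (?cls ` range scal) (presented S)"
    by (simp add: ring_of_simps image_image)
  obtain ws where ws: "set ws = W" using finite_list[OF W] by auto
  have "finite_dimension (?cls ` range scal) (Span (?cls ` range scal) (map (\<lambda>w. ?cls (Poly_Mapping.single w 1)) ws))"
    by (rule Span_finite_dimension[OF sub]) (auto simp: class_hom)
  then have "finite_dimension (?cls ` range scal) (?cls ` {f. Poly_Mapping.keys f \<subseteq> W})"
    unfolding Span_words ws .
  from finite_dimensionE[OF sub this] have "dimension 0 (?cls ` range scal) (?cls ` {f. Poly_Mapping.keys f \<subseteq> W})"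
    using dim by (simp add: over_def)
  then have "?cls ` {f. Poly_Mapping.keys f \<subseteq> W} = {\<zero>\<^bsub>presented S\<^esub>}"
    by (rule dimension_zero[OF sub])
  then have "?cls f = \<zero>\<^bsub>presented S\<^esub>" using f by blast
  then show ?thesis by (simp add: class_zero_iff)
qed

end

lemma bi_rank_ext_dim:
  assumes "bi_rank q R m 0"
  shows "ext_dim q R (Suc m) = 0"
proof -
  obtain num den :: "rat poly" where *: "den \<noteq> 0"
    "poincare_minus q R * fps_of_poly den = fps_of_poly num"
    "Polynomial.degree num = m" "Polynomial.degree den = 0"
    using assms by (auto simp: bi_rank_def)
  obtain c where c: "den = [:c:]" using *(4) degree_eq_zeroE by blast
  then have "c \<noteq> 0" using *(1) by auto
  have "fps_nth (poincare_minus q R * fps_const c) (Suc m) = fps_nth (fps_of_poly num) (Suc m)"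
    using *(2) by (simp add: c fps_of_poly_const)
  then have "of_nat (ext_dim q R (Suc m)) * c = 0"
    using *(3) by (simp add: poincare_minus_def coeff_eq_0)
  then show ?thesis using \<open>c \<noteq> 0\<close> by simp
qed

text \<open>A functional on the tensor algebra that only sees the words of length \<open>k\<close>.\<close>

definition word_pairing :: "nat \<Rightarrow> ('n::finite list \<Rightarrow> 'a) \<Rightarrow> ('n, 'a::field) free_alg \<Rightarrow> 'a" where
  "word_pairing k p f = (\<Sum>w | length w = k. Poly_Mapping.lookup f w * p w)"

lemma word_pairing_add: "word_pairing k p (f + g) = word_pairing k p f + word_pairing k p g"
  by (simp add: word_pairing_def lookup_add distrib_right sum.distrib)

lemma word_pairing_single: "word_pairing k p (Poly_Mapping.single w c) = (if length w = k then c * p w else 0)"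
proof -
  have "word_pairing k p (Poly_Mapping.single w c) = (\<Sum>v | length v = k. if v = w then c * p w else 0)"
    unfolding word_pairing_def by (rule sum.cong) (auto simp: lookup_single when_def)
  then show ?thesis by simp
qed

lemma word_pairing_sum: "word_pairing k p (sum f A) = (\<Sum>i\<in>A. word_pairing k p (f i))"
  by (induction A rule: infinite_finite_induct) (simp_all add: word_pairing_add, simp_all add: word_pairing_def)

lemma word_pairing_zero [simp]: "word_pairing k p 0 = 0" by (simp add: word_pairing_def)

lemma word_pairing_uminus: "word_pairing k p (- f) = - word_pairing k p f"
  using word_pairing_add[of k p f "- f"] by (simp add: eq_neg_iff_add_eq_0 add.commute)

text \<open>
  The functional is zero on every product of two words with a relation between them, since the relations
  are combinations of the rows of \<open>q\<^sup>-\<^sup>1 I + R\<close>; such products span the ideal.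
\<close>

lemma word_pairing_kills:
  fixes R :: "('n::finite, 'a::field) op2"
  assumes kill: "\<And>u v ij. length u + 2 + length v = k \<Longrightarrow>
      (\<Sum>ab\<in>UNIV. (mat (inverse q) + R) $ ij $ ab * p (u @ [fst ab, snd ab] @ v)) = 0"
    and f: "f \<in> rel_ideal (ext_rels q R)"
  shows "word_pairing k p f = 0"
proof -
  let ?M = "mat (inverse q) + R"
  define K where "K = {f :: ('n, 'a) free_alg. \<forall>a b. word_pairing k p (a * f * b) = 0}"
  have "rel_ideal (ext_rels q R) \<subseteq> K"
  proof (rule rel_ideal_least)
    show "ext_rels q R \<subseteq> K"
    proof
      fix r assume "r \<in> ext_rels q R"
      then obtain v :: "'a ^ ('n \<times> 'n)" where
        r: "r = (\<Sum>k\<in>UNIV. \<Sum>l\<in>UNIV. scal ((v v* ?M) $ (k, l)) * (gen k * gen l))"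
        by (auto simp: ext_rels_def)
      have r: "r = (\<Sum>ab\<in>UNIV. Poly_Mapping.single [fst ab, snd ab] ((v v* ?M) $ ab))"
        unfolding r sum_UNIV_prod by (simp add: gen_def mult_single scal_single)
      have "word_pairing k p (a * r * b) = 0" for a b
      proof (induction a rule: poly_mapping_add_induct)
        case (single u c)
        show ?case
        proof (induction b rule: poly_mapping_add_induct)
          case (single w d)
          have "Poly_Mapping.single u c * r * Poly_Mapping.single w d =
              (\<Sum>ab\<in>UNIV. Poly_Mapping.single (u @ [fst ab, snd ab] @ w) (c * (v v* ?M) $ ab * d))"
            unfolding r sum_distrib_left sum_distrib_right by (simp add: mult_single)
          then have "word_pairing k p (Poly_Mapping.single u c * r * Poly_Mapping.single w d) =
              (\<Sum>ab\<in>UNIV. if length u + 2 + length w = k then c * (v v* ?M) $ ab * d * p (u @ [fst ab, snd ab] @ w) else 0)"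
            by (simp add: word_pairing_sum word_pairing_single cong: if_cong)
          also have "\<dots> = 0"
          proof (cases "length u + 2 + length w = k")
            case True
            have "(\<Sum>ab\<in>UNIV. c * (v v* ?M) $ ab * d * p (u @ [fst ab, snd ab] @ w)) =
              (\<Sum>ab\<in>UNIV. \<Sum>ij\<in>UNIV. c * d * v $ ij * (?M $ ij $ ab * p (u @ [fst ab, snd ab] @ w)))"
              by (simp add: vector_matrix_mult_def sum_distrib_left sum_distrib_right mult_ac)
            also have "\<dots> = (\<Sum>ij\<in>UNIV. \<Sum>ab\<in>UNIV. c * d * v $ ij * (?M $ ij $ ab * p (u @ [fst ab, snd ab] @ w)))"
              by (rule sum.swap)
            also have "\<dots> = 0"
              by (simp only: sum_distrib_left[symmetric] kill[OF True]) simp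
            finally show ?thesis using True by simp
          qed simp
          finally show ?case .
        qed (simp_all add: distrib_left word_pairing_add)
      qed (simp_all add: distrib_right word_pairing_add)
      then show "r \<in> K" by (simp add: K_def)
    qed
  qed (auto simp: K_def distrib_left distrib_right word_pairing_add word_pairing_uminus mult.assoc,
       (simp add: mult.assoc[symmetric])+)
  then have "word_pairing k p (1 * f * 1) = 0" using f unfolding K_def by blast
  then show ?thesis by simp
qed

section \<open>Cayley--Hamilton for the braided Yangian\<close>

locale generic_skew_hecke = skew_rep q R \<sigma>
  for q :: "'a::field" and R :: "('n::finite, 'a) op2" and \<sigma> :: "'a \<Rightarrow> 'b::ring_1" +
  assumes gen_q: "generic q"
begin

lemma q_algebra: "q_algebra (smult :: 'a \<Rightarrow> ('n, 'b) lop \<Rightarrow> _) q"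
proof
  show "q \<noteq> 0" by (rule q_nonzero)
  have pw: "q ^ k - inverse q ^ k \<noteq> 0" if "0 < k" for k
  proof
    assume "q ^ k - inverse q ^ k = 0"
    then have "q ^ k * q ^ k = inverse q ^ k * q ^ k" by simp
    also have "\<dots> = 1" using q_nonzero by (metis left_inverse power_mult_distrib power_one)
    finally have "q ^ (k + k) = 1" by (simp only: power_add)
    then have "q powi int (k + k) = 1" by (simp only: power_int_of_nat)
    moreover have "int (k + k) \<noteq> 0" using that by simp
    ultimately show False using gen_q unfolding generic_def by blast
  qed
  show "q - inverse q \<noteq> 0" using pw[of 1] by simp
  then show "qnum q k \<noteq> 0" if "0 < k" for k
    using pw[OF that] by (simp add: qnum_def)
qed

sublocale q_algebra "smult :: 'a \<Rightarrow> ('n, 'b) lop \<Rightarrow> _" q by (rule q_algebra)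

lemma hecke_S: "hecke_seq n S"
  unfolding hecke_seq_def
proof (intro conjI allI impI)
  show "S i * S i = 1 + smult qd (S i)" for i
    unfolding qd_def by (rule S_op_quad[OF quad q_nonzero])
  show "S i * S (Suc i) * S i = S (Suc i) * S i * S (Suc i)" for i
    by (rule S_op_braid[OF braid])
  show "S i * S j = S j * S i" if "Suc i < j \<and> j < n" for i j
    using that by (intro S_op_comm S_op_triv) auto
qed

lemma emb_skew_symmetrizer: "k \<le> n \<Longrightarrow> emb 0 n (tens_map \<sigma> (skew_symmetrizer q R n k)) = asym S k"
proof (induction S k rule: asym.induct)
  case (3 k)
  let ?P = "tens_map \<sigma> (skew_symmetrizer q R n (Suc k))"
  let ?m = "\<lambda>x y. q ^ (k + 1) * tens_id x y - qnum q (k + 1) * at2 R (k + 1) x y"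
  have m: "emb 0 n (tens_map \<sigma> ?m) = smult (q ^ (k + 1)) 1 - smult (qnum q (k + 1)) (S k)"
  proof -
    have "tens_map \<sigma> ?m = (\<lambda>x y. \<sigma> (q ^ (k + 1)) * tens_map \<sigma> tens_id x y
        - \<sigma> (qnum q (k + 1)) * tens_map \<sigma> (at2 R (k + 1)) x y)"
      by (simp add: tens_map_def fun_eq_iff \<sigma>_diff \<sigma>_mult)
    then show ?thesis using "3.prems"
      by (simp add: emb_diff emb_smult tens_map_id emb_id tens_map_at2 emb_at2 S_op_def)
  qed
  have "tens_map \<sigma> (skew_symmetrizer q R n (Suc (Suc k))) =
     (\<lambda>x y. \<sigma> (inverse (qnum q (k + 2))) *
        tens_map \<sigma> (tens_prod n [skew_symmetrizer q R n (Suc k), ?m, skew_symmetrizer q R n (Suc k)]) x y)"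
    by (simp add: tens_map_def fun_eq_iff \<sigma>_mult)
  then have "emb 0 n (tens_map \<sigma> (skew_symmetrizer q R n (Suc (Suc k)))) =
     smult (inverse (qnum q (k + 2))) (emb 0 n ?P * (emb 0 n (tens_map \<sigma> ?m) * emb 0 n ?P))"
    by (simp only: emb_smult tens_map_prod list.map emb_prod prod_list.Cons prod_list.Nil mult_1_right)
  then show ?case using 3 by (simp only: m asym.simps mult.assoc Suc_leD)
qed (simp_all add: tens_map_id emb_id)

text \<open>
  These are the entries of \<open>(q\<^sup>-\<^sup>1 + R\<^sub>i) P\<^sub>k = 0\<close>, with \<open>i\<close> the position after the word \<open>u\<close>.
\<close>

lemma asym_kill:
  assumes k: "length u + 2 + length v = k"
  shows "(\<Sum>ab\<in>UNIV. \<sigma> ((mat (inverse q) + R) $ ij $ ab) *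
    ent (asym S k) (place 0 z (u @ [fst ab, snd ab] @ v)) y) = 0"
proof -
  let ?i = "length u" and ?x = "place 0 z (u @ [fst ij, snd ij] @ v)"
  have "S ?i * asym S k = smult (- inverse q) (asym S k)"
    using asym_eigen[OF hecke_S, of ?i k] k by auto
  moreover have "op2 (mapm \<sigma> (mat (inverse q) + R)) ?i = smult (inverse q) 1 + S ?i"
    by (simp add: mapm_add op2_add op2_smult S_op_def)
  ultimately have "op2 (mapm \<sigma> (mat (inverse q) + R)) ?i * asym S k = 0"
    by (simp add: distrib_right)
  then have zero: "ent (op2 (mapm \<sigma> (mat (inverse q) + R)) ?i * asym S k) ?x y = 0" by (simp add: ent_simps)
  have pr: "get_pair ?i ?x = ij" by (simp add: get_pair_def place_def nth_append)
  have upd: "put_pair ?i ?x ab = place 0 z (u @ [fst ab, snd ab] @ v)" for ab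
  proof
    fix p
    consider "p < ?i" | "p = ?i" | "p = Suc ?i" | "Suc (Suc ?i) \<le> p" by linarith
    then show "put_pair ?i ?x ab p = place 0 z (u @ [fst ab, snd ab] @ v) p"
    proof cases
      case 4
      then obtain r where "p = Suc (Suc (?i + r))" using le_Suc_ex by (metis add_Suc)
      then show ?thesis by (simp add: put_pair_def place_def nth_append)
    qed (auto simp: put_pair_def place_def nth_append)
  qed
  show ?thesis using zero unfolding op2_mult pr upd mapm_nth .
qed

end

lemma skew_symmetrizer_zero:
  fixes R :: "('n::finite, 'a::field) op2"
  assumes "hecke_symmetry q R" "skew_invertible R" "generic q" "bi_rank q R m 0"
    and w: "length w = Suc m" and y: "length y = Suc m"
  shows "skew_symmetrizer q R (Suc m) (Suc m) w y = 0"
proof -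
  let ?P = "skew_symmetrizer q R (Suc m) (Suc m)" and ?W = "{w :: 'n list. length w = Suc m}"
  have loc: "generic_skew_hecke q R (\<lambda>a. a)"
    using assms id_scalar_map
    by (simp add: generic_skew_hecke_def skew_rep_def skew_hecke_def generic_skew_hecke_axioms_def)
  define z :: "nat \<Rightarrow> 'n" where "z = (\<lambda>_. undefined)"
  have tm: "tens_map (\<lambda>a. a) ?P = ?P" by (intro ext) (simp only: tens_map_def)
  have P: "ent (q_algebra.asym (scalar_map.smult (\<lambda>a. a)) q (scalar_map.S_op (\<lambda>a. a) R) (Suc m)) (place 0 z v) (place 0 z y) = ?P v y"
    if "length v = Suc m" for v
    using emb_ent[OF that y, of 0 ?P z]
      generic_skew_hecke.emb_skew_symmetrizer[OF loc order_refl, of "Suc m"] by (simp only: tm)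
  have kill: "(\<Sum>ab\<in>UNIV. (mat (inverse q) + R) $ ij $ ab * ?P (u @ [fst ab, snd ab] @ v) y) = 0"
    if uv: "length u + 2 + length v = Suc m" for u v ij
  proof -
    have "length (u @ [fst ab, snd ab] @ v) = Suc m" for ab :: "'n \<times> 'n" using uv by simp
    then have "?P (u @ [fst ab, snd ab] @ v) y = ent (q_algebra.asym (scalar_map.smult (\<lambda>a. a)) q
        (scalar_map.S_op (\<lambda>a. a) R) (Suc m)) (place 0 z (u @ [fst ab, snd ab] @ v)) (place 0 z y)" for ab
      using P by metis
    then show ?thesis
      using generic_skew_hecke.asym_kill[OF loc uv, of ij z "place 0 z y"] by (simp only:)
  qed
  have "ext_dim q R (Suc m) = 0" by (rule bi_rank_ext_dim[OF assms(4)])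
  moreover have "homogeneous (Suc m) = {f :: ('n, 'a) free_alg. Poly_Mapping.keys f \<subseteq> ?W}"
    by (auto simp: homogeneous_def)
  ultimately have "Poly_Mapping.single w 1 \<in> rel_ideal (ext_rels q R)"
    by (intro dim_zero_imp_in_ideal[of ?W]) (auto simp: ext_dim_def w)
  from word_pairing_kills[where p = "\<lambda>w. ?P w y" and k = "Suc m", OF kill this] show ?thesis
    using w by (simp add: word_pairing_single)
qed

lemma op2_inj: "op2 M k = op2 N k \<Longrightarrow> M = (N :: ('n::finite, 'b::zero) op2)"
proof -
  assume *: "op2 M k = op2 N k"
  have "M $ ij $ ab = N $ ij $ ab" for ij ab
    using op2_upd_r[of M k "put_pair k (\<lambda>_. undefined) ij" ab] op2_upd_r[of N k "put_pair k (\<lambda>_. undefined) ij" ab] *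
    by simp
  then show "M = N" by (simp add: vec_eq_iff)
qed

lemma (in skew_hecke) matrix_inv_R: "matrix_inv R = Ri"
proof -
  note inv = scalar_map.S_op_inverse[OF id_scalar_map quad q_nonzero]
  have m: "mapm (\<lambda>a. a) M = M" for M :: "'a ^ 'i ^ 'j" by (simp add: vec_eq_iff)
  have S: "scalar_map.S_op (\<lambda>a. a) M k = op2 M k" for M :: "('n, 'a) op2" and k
    by (simp add: scalar_map.S_op_def[OF id_scalar_map] m)
  have one: "op2 (mat 1 :: ('n, 'a) op2) 0 = 1"
    by (rule rfm_eqI) (simp add: op2_mat diag.rep_eq ent_simps)
  have "op2 (R ** Ri) 0 = op2 (mat 1) 0" "op2 (Ri ** R) 0 = op2 (mat 1) 0"
    using inv[of 0] by (simp_all add: S op2_hom one)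
  then have "R ** Ri = mat 1" "Ri ** R = mat 1" by (auto dest: op2_inj)
  then show ?thesis
    unfolding matrix_inv_def
    by (intro some_equality) (auto, metis matrix_mul_assoc matrix_mul_lid matrix_mul_rid)
qed

lemma rescale_X: "rescale c fps_X = xi c"
proof (rule fps_ext)
  fix n show "fps_nth (rescale c fps_X) n = fps_nth (xi c) n"
    by (cases n) (auto simp: rescale_def xi_def scal_ser_def fps_X_def scal_hom)
qed

lemma diag_centr: "centr c \<Longrightarrow> diag c * A = A * diag c"
  by (rule rfm_eqI) (simp add: ent_diag_mult ent_mult_diag centr_def)

lemma emb_lmult: "emb s n (\<lambda>x y. c * a x y) = diag c * (emb s n a :: ('n::finite, 'b::ring_1) lop)"
  by (rule rfm_eqI) (simp add: emb.rep_eq ent_diag_mult)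

locale yangian_setting =
  generic_skew_hecke q R "scal_ser :: 'a \<Rightarrow> ('n, 'a) yfree fps"
  for q :: "'a::field" and R :: "('n::finite, 'a) op2"
begin

definition J :: "('n, ('n, 'a) yfree fps) lop set" where
  "J = {X. \<forall>x y. ent X x y \<in> ser_ideal (yangian_rels q R)}"

definition L_op :: "'a \<Rightarrow> ('n, ('n, 'a) yfree fps) lop" where "L_op c = op1 (L_at c) 0"

text \<open>
  After the substitution, the factor \<open>v\<^sup>-\<^sup>1 - u\<^sup>-\<^sup>1\<close> by which the relations were multiplied turns into
  \<open>(d\<^sup>-\<^sup>1 - c\<^sup>-\<^sup>1) u\<^sup>-\<^sup>1\<close>. The scalar is invertible, and a series lies in the ideal as soon as its product
  with \<open>u\<^sup>-\<^sup>1\<close> does.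
\<close>

lemma J_relation:
  assumes "c \<noteq> 0" "d \<noteq> 0" "c \<noteq> d"
  shows "(S 0 - smult (qd / (1 - d / c)) 1) * L_op c * S 0 * L_op d -
      L_op d * S 0 * L_op c * (S 0 - smult (qd / (1 - d / c)) 1) \<in> J" (is "?B \<in> J")
proof -
  let ?f = "subst_uv c d :: ('n, 'a) yfree fps fps \<Rightarrow> _" and ?\<sigma> = "scal_ser :: 'a \<Rightarrow> ('n, 'a) yfree fps"
  let ?X = "fps_X :: ('n, 'a) yfree fps" and ?e = "inverse d - inverse c"
  let ?s = "S 0 - smult (qd / (1 - d / c)) 1"
  have e: "?e \<noteq> 0" using assms by simp
  have ea: "?e * (qd / (1 - d / c)) = qd * inverse d"
    using assms by (simp add: field_simps)
  have hom: "tens_map ?f (tens_prod 2 as) = tens_prod 2 (map (tens_map ?f) as)"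
    for as :: "('n, ('n, 'a) yfree fps fps) tens list"
    by (rule tens_map_hom) (simp_all add: subst_uv_add subst_uv_mult)
  have Lu: "emb 0 2 (tens_map ?f (at1 L_u 1)) = L_op c"
  proof -
    have "tens_map ?f (at1 L_u 1) = at1 (L_at c) 1"
      by (auto simp: tens_map_def at1_def fun_eq_iff subst_uv_L_u)
    then show ?thesis by (simp add: emb_at1 L_op_def)
  qed
  have Lv: "emb 0 2 (tens_map ?f (at1 L_v 1)) = L_op d"
  proof -
    have "tens_map ?f (at1 L_v 1) = at1 (L_at d) 1"
      by (auto simp: tens_map_def at1_def fun_eq_iff subst_uv_L_v)
    then show ?thesis by (simp add: emb_at1 L_op_def)
  qed
  have S0: "emb 0 2 (tens_map ?\<sigma> (at2 R 1)) = S 0" by (simp add: tens_map_at2 emb_at2 S_op_def)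
  have R0: "emb 0 2 (tens_map ?f (tens_map scal_uv (at2 R 1))) = S 0"
  proof -
    have "tens_map ?f (tens_map scal_uv (at2 R 1)) = tens_map ?\<sigma> (at2 R 1)"
      by (intro ext) (simp only: tens_map_def subst_uv_scal)
    then show ?thesis by (simp only: S0)
  qed
  have RR: "emb 0 2 (tens_map ?f (R_uv q R)) = diag ?X * smult ?e ?s"
  proof -
    have X: "xi d' = ?X * ?\<sigma> (inverse d')" for d'
      using fps_X_centr unfolding xi_def centr_def by metis
    have "tens_map ?f (R_uv q R) = (\<lambda>x y. ?X * (?\<sigma> ?e * tens_map ?\<sigma> (at2 R 1) x y - ?\<sigma> (qd * inverse d) * tens_id x y))"
    proof (intro ext)
      fix x y :: "'n list"
      have comm: "?\<sigma> qd * ?X = ?X * ?\<sigma> qd" using fps_X_centr unfolding centr_def by metis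
      have id: "?f (tens_id x y) = tens_id x y" by (simp add: tens_id_def)
      have "tens_map ?f (R_uv q R) x y = (xi d - xi c) * ?\<sigma> (at2 R 1 x y) - ?\<sigma> qd * xi d * tens_id x y"
        by (simp add: tens_map_def R_uv_def subst_uv_diff subst_uv_mult subst_uv_X subst_uv_const rescale_X
            subst_uv_scal id qd_def)
      also have "\<dots> = ?X * ((?\<sigma> (inverse d) - ?\<sigma> (inverse c)) * ?\<sigma> (at2 R 1 x y)) - (?\<sigma> qd * ?X) * ?\<sigma> (inverse d) * tens_id x y"
        by (simp add: X left_diff_distrib right_diff_distrib mult.assoc)
      also have "\<dots> = ?X * (?\<sigma> ?e * tens_map ?\<sigma> (at2 R 1) x y - ?\<sigma> (qd * inverse d) * tens_id x y)"
        unfolding comm by (simp add: tens_map_def \<sigma>_diff \<sigma>_mult left_diff_distrib right_diff_distrib mult.assoc)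
      finally show "tens_map ?f (R_uv q R) x y = ?X * (?\<sigma> ?e * tens_map ?\<sigma> (at2 R 1) x y - ?\<sigma> (qd * inverse d) * tens_id x y)" .
    qed
    then have "emb 0 2 (tens_map ?f (R_uv q R)) = diag ?X * (smult ?e (S 0) - smult (qd * inverse d) 1)"
      by (simp only: emb_lmult[of 0 2 fps_X] emb_diff emb_smult S0 emb_id)
    also have "\<dots> = diag ?X * smult ?e ?s" by (simp only: sc_diff sc_sc ea)
    finally show ?thesis .
  qed
  have "tens_map ?f (yangian_defect q R) = (\<lambda>x y.
      tens_map ?f (tens_prod 2 [R_uv q R, at1 L_u 1, tens_map scal_uv (at2 R 1), at1 L_v 1]) x y -
      tens_map ?f (tens_prod 2 [at1 L_v 1, tens_map scal_uv (at2 R 1), at1 L_u 1, R_uv q R]) x y)"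
    by (simp add: tens_map_def yangian_defect_def fun_eq_iff subst_uv_diff)
  then have "emb 0 2 (tens_map ?f (yangian_defect q R)) =
      diag ?X * smult ?e ?s * (L_op c * (S 0 * L_op d)) - L_op d * (S 0 * (L_op c * (diag ?X * smult ?e ?s)))"
    by (simp only: emb_diff hom list.map emb_prod prod_list.Cons prod_list.Nil mult_1_right Lu Lv R0 RR)
  also have "L_op d * (S 0 * (L_op c * (diag ?X * smult ?e ?s))) = (L_op d * S 0 * L_op c * diag ?X) * smult ?e ?s"
    by (simp only: mult.assoc)
  also have "L_op d * S 0 * L_op c * diag ?X = diag ?X * (L_op d * S 0 * L_op c)"
    by (rule diag_centr[OF fps_X_centr, symmetric])
  finally have "emb 0 2 (tens_map ?f (yangian_defect q R)) =
      diag ?X * smult ?e ?s * (L_op c * (S 0 * L_op d)) - diag ?X * (L_op d * S 0 * L_op c) * smult ?e ?s" .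
  note defect = this
  have D: "emb 0 2 (tens_map ?f (yangian_defect q R)) = diag ?X * smult ?e ?B"
  proof -
    have "Z * smult b s * u - Z * v * smult b s = Z * smult b (s * u - v * s)"
      for Z s u v :: "('n, ('n, 'a) yfree fps) lop" and b
      by (simp add: right_diff_distrib sc_diff mult.assoc)
    from this[of "diag ?X" ?e ?s "L_op c * (S 0 * L_op d)" "L_op d * S 0 * L_op c"] show ?thesis
      using defect by (simp only: mult.assoc)
  qed
  show ?thesis
    unfolding J_def
  proof (intro CollectI allI)
    fix x y :: "nat \<Rightarrow> 'n"
    have "subst_uv c d (yangian_defect q R v w) \<in> ser_ideal (yangian_rels q R)"
      if "length v = 2" "length w = 2" for v w
      by (rule subst_uv_ideal, rule rel_ideal(1)) (use that in \<open>auto simp: yangian_rels_def\<close>)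
    then have "ent (emb 0 2 (tens_map ?f (yangian_defect q R))) x y \<in> ser_ideal (yangian_rels q R)"
      by (simp add: emb.rep_eq tens_map_def ser_ideal)
    then have "fps_X * (scal_ser ?e * ent ?B x y) \<in> ser_ideal (yangian_rels q R)"
      unfolding D by (simp only: ent_diag_mult ent_smult)
    then have "scal_ser ?e * ent ?B x y \<in> ser_ideal (yangian_rels q R)" by (rule ser_ideal_X)
    then have "scal_ser (inverse ?e) * (scal_ser ?e * ent ?B x y) \<in> ser_ideal (yangian_rels q R)"
      by (rule ser_ideal)
    moreover have "?\<sigma> (inverse ?e) * ?\<sigma> ?e = 1"
      by (simp only: \<sigma>_mult[symmetric] left_inverse[OF e] \<sigma>_one)
    ultimately show "ent ?B x y \<in> ser_ideal (yangian_rels q R)"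
      by (simp only: mult.assoc[symmetric] mult_1_left)
  qed
qed

sublocale q_algebra_ideal smult q J
proof
  show "0 \<in> J" by (simp add: J_def ent_simps ser_ideal)
  show "X + Y \<in> J" if "X \<in> J" "Y \<in> J" for X Y
    using that by (simp add: J_def ent_simps ser_ideal)
  show "Z * X \<in> J" "X * Z \<in> J" if "X \<in> J" for X Z
    using that by (auto simp: J_def times_rfm.rep_eq intro!: ser_ideal_sum intro: ser_ideal)
qed

sublocale tower: braided_tower smult q J S triv_at T "\<Sum>a\<in>UNIV. C $ a $ a" L_op
proof
  show "hecke_seq n S" for n by (rule hecke_S)
  show "1 \<in> triv_at k" for k by (rule triv_at_one)
  show add: "X + Y \<in> triv_at k" if "X \<in> triv_at k" "Y \<in> triv_at k" for X Y k
    using that by (rule triv_at_add)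
  show "X * Y \<in> triv_at k" if "X \<in> triv_at k" "Y \<in> triv_at k" for X Y k
    using that by (rule triv_at_mult)
  show "smult a X \<in> triv_at k" if "X \<in> triv_at k" for X k a
    using that by (simp add: triv_at_def ent_smult)
  show "S i \<in> triv_at k" if "k \<noteq> i" "k \<noteq> Suc i" for i k
    using that by (rule S_op_triv)
  show "T k (X + Y) = T k X + T k Y" for k X Y by (rule ptrace_add)
  show "T k (Y * X) = Y * T k X" if "Y \<in> triv_at k" for k X Y
    by (rule ptrace_lmult[OF that]) (rule mapm_centr)
  show "T k (X * Y) = T k X * Y" if "Y \<in> triv_at k" for k X Y by (rule ptrace_rmult[OF that])
  show "T k X \<in> triv_at k" for k X by (rule ptrace_triv)
  show "T k X \<in> J" if "X \<in> J" for k X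
    using that by (auto simp: J_def ptrace.rep_eq ser_ideal(1) intro!: ser_ideal_sum ser_ideal(3))
  show "T k 1 = smult (\<Sum>a\<in>UNIV. C $ a $ a) 1" for k by (rule T_one)
  show "T (Suc k) (S k) = 1" for k by (rule ptrace_S_op)
  show "T (Suc k) (S k * X * (S k - smult qd 1)) = T k X" if "X \<in> triv_at (Suc k)" for k X
    unfolding qd_def by (rule T_copy[OF that])
  show "T k (T (Suc k) (S k * X)) = T k (T (Suc k) (X * S k))" for k X by (rule T_cyc)
  show "L_op c \<in> triv_at k" if "0 < k" for c k
    using that by (simp add: L_op_def op1_triv)
  then show "S k * L_op c = L_op c * S k" if "0 < k" for c k
    using that by (intro S_op_comm) auto
  show "cong_J ((S 0 - smult (qd / (1 - d / c)) 1) * L_op c * S 0 * L_op d)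
      (L_op d * S 0 * L_op c * (S 0 - smult (qd / (1 - d / c)) 1))"
    if "c \<noteq> 0" "d \<noteq> 0" "c \<noteq> d" for c d
    unfolding cong_J_def using that by (rule J_relation)
qed

lemma emb_L_bar: "1 \<le> k \<Longrightarrow> k \<le> n \<Longrightarrow> emb 0 n (L_bar R n k c) = tower.bar (k - 1) c"
proof (induction k rule: induct_nat_012)
  case 1
  then show ?case by (simp add: emb_at1 L_op_def[symmetric])
next
  case (ge2 k)
  have "tower.S_inv k = S_op Ri k" unfolding tower.S_inv_def qd_def by (rule S_op_inv[symmetric])
  then show ?case using ge2
    by (simp add: emb_prod tens_map_at2 emb_at2 matrix_inv_R S_op_def[symmetric] mult.assoc)
qed simp

lemma prod_L_bar:
  "prod_list (map (\<lambda>i. tower.bar i (inverse q ^ (2 * i))) [0..<p]) = tower.bar_prod 0 (tower.qs p)"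
  by (induction p) (simp_all add: tower.qs_Suc tower.bar_prod_append, simp add: tower.qs_def)

text \<open>
  The trace over all occupied sites leaves a multiple of the identity, which may equally be read as a
  diagonal matrix at the first site.
\<close>

lemma elem_eq: "tower.elem p = op1 (mat (e_sym q R p 1)) 0"
proof (cases "p = 0")
  case True
  then show ?thesis
    by (simp add: tower.elem_def tower.asc_prod_def tower.qs_def tower.asym_at_def e_sym_def op1_mat)
      (rule rfm_eqI, simp add: diag.rep_eq ent_simps)
next
  case False
  let ?Ls = "map (\<lambda>i. L_bar R p i (inverse q ^ (2 * (i - 1)) * 1)) [1..<Suc p]"
  let ?X = "tens_prod p (tens_map scal_ser (skew_symmetrizer q R p p) # ?Ls)"
  have up: "[1..<Suc p] = map Suc [0..<p]" by (simp only: map_Suc_upt One_nat_def)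
  have Ls: "map (emb 0 p) ?Ls = map (\<lambda>i. tower.bar i (inverse q ^ (2 * i))) [0..<p]"
    unfolding up map_map by (rule map_cong[OF refl]) (simp add: emb_L_bar)
  have X: "emb 0 p ?X = tower.asym_at 0 p * tower.asc_prod p"
    by (simp only: emb_prod list.map prod_list.Cons Ls prod_L_bar emb_skew_symmetrizer[OF order_refl])
      (simp add: tower.asym_at_def tower.asc_prod_def)
  let ?\<sigma> = "scal_ser :: 'a \<Rightarrow> ('n, 'a) yfree fps"
  have Cs: "map (emb 0 p) (map (\<lambda>i. tens_map ?\<sigma> (at1 C i)) [1..<Suc p]) = map (op1 (mapm ?\<sigma> C)) [0..<p]"
    unfolding up map_map by (rule map_cong[OF refl]) (simp add: tens_map_at1 emb_at1)
  have "op1 (mat (e_sym q R p 1)) 0 = diag (R_trace R p ?X)"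
    using False by (simp only: op1_mat e_sym_def if_False)
  also have "\<dots> = iter_trace ptrace0 0 p (emb 0 p (tens_prod p
      (map (\<lambda>i. tens_map scal_ser (at1 C i)) [1..<Suc p] @ [?X])))"
    unfolding R_trace_def by (rule iter_ptrace0_emb[symmetric])
  also have "\<dots> = iter_trace ptrace0 0 p (prod_list (map (op1 (mapm scal_ser C)) [0..<p]) * emb 0 p ?X)"
    by (simp only: emb_prod map_append prod_list.append Cs list.map prod_list.Cons prod_list.Nil mult_1_right)
  also have "\<dots> = iter_trace T 0 p (emb 0 p ?X)"
    by (rule iter_ptrace[symmetric]) (rule mapm_centr)
  also have "\<dots> = tower.elem p" unfolding X tower.elem_def ..
  finally show ?thesis by (rule sym)
qed

lemma L_power_eq: "tower.L_power k c = op1 (L_pow q k c) 0"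
proof (induction k)
  case 0
  show ?case by (rule rfm_eqI) (simp add: op1_mat diag.rep_eq ent_simps)
qed (simp add: op1_hom L_op_def[symmetric])

theorem cayley_hamilton_yangian:
  assumes "bi_rank q R m 0"
  shows "(\<Sum>p\<le>m. mat (scal_ser ((- q) ^ p)) ** L_pow q (m - p) (inverse q ^ (2 * p))
      ** mat (e_sym q R p 1)) $ i $ j \<in> ser_ideal (yangian_rels q R)" (is "?M $ i $ j \<in> _")
proof -
  let ?P = "skew_symmetrizer q R (Suc m) (Suc m)"
  have "tower.asym_at 0 (Suc m) = emb 0 (Suc m) (tens_map scal_ser ?P)"
    using emb_skew_symmetrizer[OF order_refl, of "Suc m"] by (simp add: tower.asym_at_def)
  also have "\<dots> = 0"
    using skew_symmetrizer_zero[OF hecke skew gen_q assms]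
    by (intro rfm_eqI) (simp add: emb.rep_eq tens_map_def ent_simps)
  finally have "tower.asym_at 0 (Suc m) = 0" .
  from tower.cayley_hamilton[OF this]
  have *: "(\<Sum>p\<le>m. smult ((- q) ^ p) (tower.L_power (m - p) (inverse q ^ (2 * p)) * tower.elem p)) \<in> J"
    by (simp add: cong_0)
  have sum: "op1 (sum f A) 0 = (\<Sum>p\<in>A. op1 (f p) 0 :: ('n, ('n, 'a) yfree fps) lop)" for f and A :: "nat set"
  proof (induction A rule: infinite_finite_induct)
  qed (simp_all add: op1_add, (rule rfm_eqI, simp add: op1.rep_eq ent_simps)+)
  have "op1 ?M 0 \<in> J"
    using * by (simp only: sum op1_hom op1_smult L_power_eq elem_eq sc_mult_left mult_1_left)
  moreover define x :: "nat \<Rightarrow> 'n" where "x = (\<lambda>_. i)"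
  ultimately have "ent (op1 ?M 0) x (x(0 := j)) \<in> ser_ideal (yangian_rels q R)"
    unfolding J_def by blast
  then show ?thesis unfolding op1_upd_r by (simp only: x_def)
qed

end

theorem mainTheorem5:
  fixes R :: "'a::real_normed_field ^ ('n::finite \<times> 'n) ^ ('n \<times> 'n)"
    and q :: 'a
    and m :: nat
  assumes "hecke_symmetry q R"
    and "generic q"
    and "skew_invertible R"
    and "bi_rank q R m 0"
  shows "\<forall>i j n.
    yangian_class q R
      (fps_nth ((\<Sum>p\<le>m. mat (scal_ser ((- q) ^ p))
                    ** L_pow q (m - p) (inverse q ^ (2 * p))
                    ** mat (e_sym q R p 1)) $ i $ j) n)
    = \<zero>\<^bsub>braided_yangian q R\<^esub>"
proof (intro allI)
  fix i j n
  have "yangian_setting q R"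
    using assms scal_ser_map
    by (simp add: yangian_setting_def generic_skew_hecke_def skew_rep_def skew_hecke_def
        generic_skew_hecke_axioms_def)
  from yangian_setting.cayley_hamilton_yangian[OF this assms(4), of i j]
  show "yangian_class q R
      (fps_nth ((\<Sum>p\<le>m. mat (scal_ser ((- q) ^ p))
                    ** L_pow q (m - p) (inverse q ^ (2 * p))
                    ** mat (e_sym q R p 1)) $ i $ j) n)
    = \<zero>\<^bsub>braided_yangian q R\<^esub>"
    unfolding yangian_class_def braided_yangian_def ser_ideal_def
    by (intro presented_class_zero) simp
qed

end
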